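(* Let $\Gamma$ be a normal bunch of grapes. Then the subcomplex $UP_2(\Gamma)$ is locally convex in $UD_2(\Gamma)$ and $\mathbb{B}_2(\Gamma)\cong\pi_1(UP_2(\Gamma))\ast\mathbb{F}_N$ for some $N\ge 2$.
   Context: A bunch of grapes $\Gamma=(\mathsf{T},\ell)$ consists of a finite tree $\mathsf{T}$ (possibly a single vertex), called the stem, and a function $\ell:V(\mathsf{T})\to\mathbb{Z}_{\ge 0}$; the graph $\Gamma$ is obtained from $\mathsf{T}$ by attaching, at each vertex $v$, $\ell(v)$ copies of a $3$-cycle (grapes), each glued at $v$ along one of its vertices. $\Gamma$ is assumed to be a minimal simplicial model, i.e. $\ell(v)\ge 1$ whenever $v$ has valency $2$ in $\mathsf{T}$. (Equivalently, bunches of grapes are the simple graphs with the minimal number of vertices among simple graphs homeomorphic to a given finite connected graph all of whose cycles have length at most one, i.e. are loops.) $\Gamma$ is normal if it contains a pair of disjoint cycles and has no leaves (vertices of valency $1$); equivalently, $\ell(v)>0$ for at least two vertices $v$ and $\ell(v)\geq 1$ for every leaf $v$ of $\mathsf{T}$. For a finite simple graph $\Gamma$, $UD_2(\Gamma)$ is the (non-positively curved) square complex whose cells are unordered pairs of disjoint closed cells (vertices or edges) of $\Gamma$; $\pi_1(UD_2(\Gamma))$ is the graph $2$-braid group $\mathbb{B}_2(\Gamma)=\pi_1(\{(x,y)\in\Gamma^2:x\ne y\}/\mathbb{S}_2)$. For disjoint connected leafless subgraphs $\Gamma_1,\Gamma_2$ (each with at least one edge), $\Gamma_1\mathbin{\mathring\times}\Gamma_2$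 is the image of $\Gamma_1\times\Gamma_2\hookrightarrow UD_2(\Gamma)$, $(x,y)\mapsto\{x,y\}$; these are the standard product subcomplexes, and the maximal ones under inclusion are the maximal product subcomplexes. $UP_2(\Gamma)$ is the union of all maximal product subcomplexes of $UD_2(\Gamma)$. It is locally convex in $UD_2(\Gamma)$ if at every vertex its link is an induced (full) subcomplex of the link in $UD_2(\Gamma)$. $\mathbb{F}_N$ is the free group of rank $N$. *)

theory Defs
  imports "HOL-Analysis.Analysis" "HOL-Algebra.Group"
begin

section \<open>Simple graphs\<close>

record 'v sgraph =
  gverts :: "'v set"
  gedges :: "'v set set"

definition finite_simple_graph :: "'v sgraph \<Rightarrow> bool" where
  "finite_simple_graph G \<longleftrightarrow>
     finite (gverts G) \<and> (\<forall>e\<in>gedges G. e \<subseteq> gverts G \<and> card e = 2)"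

definition valency :: "'v sgraph \<Rightarrow> 'v \<Rightarrow> nat" where
  "valency G v = card {e \<in> gedges G. v \<in> e}"

definition connected_graph :: "'v sgraph \<Rightarrow> bool" where
  "connected_graph G \<longleftrightarrow> gverts G \<noteq> {} \<and>
     (\<forall>u\<in>gverts G. \<forall>w\<in>gverts G. (u, w) \<in> {(a, b). {a, b} \<in> gedges G}\<^sup>*)"

definition graph_cycle :: "'v sgraph \<Rightarrow> 'v list \<Rightarrow> bool" where
  "graph_cycle G vs \<longleftrightarrow> 3 \<le> length vs \<and> distinct vs \<and>
     (\<forall>i<length vs. {vs ! i, vs ! (Suc i mod length vs)} \<in> gedges G)"

definition finite_tree :: "'v sgraph \<Rightarrow> bool" where
  "finite_tree G \<longleftrightarrow> finite_simple_graph G \<and> connected_graph G \<and> (\<nexists>vs. graph_cycle G vs)"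

definition leafless :: "'v sgraph \<Rightarrow> bool" where
  "leafless G \<longleftrightarrow> (\<forall>v\<in>gverts G. valency G v \<noteq> 1)"

definition is_subgraph :: "'v sgraph \<Rightarrow> 'v sgraph \<Rightarrow> bool" where
  "is_subgraph H G \<longleftrightarrow> gverts H \<subseteq> gverts G \<and> gedges H \<subseteq> gedges G \<and>
     (\<forall>e\<in>gedges H. e \<subseteq> gverts H)"


section \<open>Bunches of grapes\<close>

text \<open>The \<open>i\<close>-th grape at the stem vertex \<open>v\<close> is the triangle on
  \<open>Stem v\<close>, \<open>Tip v i False\<close> and \<open>Tip v i True\<close>.\<close>

datatype 'v grape_vertex = Stem 'v | Tip 'v nat bool

definition grapes_graph :: "'v sgraph \<Rightarrow> ('v \<Rightarrow> nat) \<Rightarrow> 'v grape_vertex sgraph" where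
  "grapes_graph T l =
     \<lparr> gverts = Stem ` gverts T \<union> {Tip v i b | v i b. v \<in> gverts T \<and> i < l v},
       gedges = (\<lambda>e. Stem ` e) ` gedges T
         \<union> {{Stem v, Tip v i b} | v i b. v \<in> gverts T \<and> i < l v}
         \<union> {{Tip v i False, Tip v i True} | v i. v \<in> gverts T \<and> i < l v} \<rparr>"

definition bunch_of_grapes :: "'v sgraph \<Rightarrow> ('v \<Rightarrow> nat) \<Rightarrow> bool" where
  "bunch_of_grapes T l \<longleftrightarrow>
     finite_tree T \<and> (\<forall>v\<in>gverts T. valency T v = 2 \<longrightarrow> 1 \<le> l v)"

definition normal_graph :: "'v sgraph \<Rightarrow> bool" where
  "normal_graph G \<longleftrightarrow>
     (\<exists>vs ws. graph_cycle G vs \<and> graph_cycle G ws \<and> set vs \<inter> set ws = {}) \<and> leafless G"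


section \<open>The square complex of unordered pairs of disjoint cells\<close>

text \<open>A closed cell of a graph is encoded by its set of vertices, a cell of a square complex
  by the unordered pair \<open>{\<sigma>, \<tau>}\<close> of its two factors, and a (sub)complex by its set of cells.\<close>

definition graph_cells :: "'v sgraph \<Rightarrow> 'v set set" where
  "graph_cells G = (\<lambda>v. {v}) ` gverts G \<union> gedges G"

definition UD2 :: "'v sgraph \<Rightarrow> 'v set set set" where
  "UD2 G = {{\<sigma>, \<tau>} | \<sigma> \<tau>. \<sigma> \<in> graph_cells G \<and> \<tau> \<in> graph_cells G \<and> \<sigma> \<inter> \<tau> = {}}"

definition face_of_cell :: "'v set set \<Rightarrow> 'v set set \<Rightarrow> bool" where
  "face_of_cell c d \<longleftrightarrow> (\<exists>\<sigma> \<tau> \<sigma>' \<tau>'. c = {\<sigma>, \<tau>} \<and> d = {\<sigma>', \<tau>'} \<and> \<sigma> \<subseteq> \<sigma>' \<and> \<tau> \<subseteq> \<tau>')"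

definition cell_dim :: "'v set set \<Rightarrow> nat" where
  "cell_dim c = (\<Sum>\<sigma>\<in>c. card \<sigma> - 1)"

definition product_subcomplex :: "'v sgraph \<Rightarrow> 'v sgraph \<Rightarrow> 'v set set set" where
  "product_subcomplex G1 G2 = {{\<sigma>, \<tau>} | \<sigma> \<tau>. \<sigma> \<in> graph_cells G1 \<and> \<tau> \<in> graph_cells G2}"

definition standard_product_subcomplexes :: "'v sgraph \<Rightarrow> 'v set set set set" where
  "standard_product_subcomplexes G = {product_subcomplex G1 G2 | G1 G2.
     is_subgraph G1 G \<and> connected_graph G1 \<and> leafless G1 \<and> gedges G1 \<noteq> {} \<and>
     is_subgraph G2 G \<and> connected_graph G2 \<and> leafless G2 \<and> gedges G2 \<noteq> {} \<and>
     gverts G1 \<inter> gverts G2 = {}}"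

definition maximal_product_subcomplexes :: "'v sgraph \<Rightarrow> 'v set set set set" where
  "maximal_product_subcomplexes G = {P \<in> standard_product_subcomplexes G.
     \<forall>Q\<in>standard_product_subcomplexes G. P \<subseteq> Q \<longrightarrow> P = Q}"

definition UP2 :: "'v sgraph \<Rightarrow> 'v set set set" where
  "UP2 G = \<Union>(maximal_product_subcomplexes G)"

text \<open>The link of a vertex \<open>p\<close> in \<open>K\<close>, as an abstract simplicial complex whose vertices are the
  edges of \<open>K\<close> at \<open>p\<close>: a cell \<open>c\<close> containing \<open>p\<close> contributes the simplex formed by the edges of
  \<open>c\<close> at \<open>p\<close> (for \<open>c = p\<close> this is the empty simplex).\<close>

definition link :: "'v set set set \<Rightarrow> 'v set set \<Rightarrow> 'v set set set set" where
  "link K p = {{e \<in> K. cell_dim e = 1 \<and> face_of_cell p e \<and> face_of_cell e c} | c.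
     c \<in> K \<and> face_of_cell p c}"

definition full_subcomplex :: "'a set set \<Rightarrow> 'a set set \<Rightarrow> bool" where
  "full_subcomplex L M \<longleftrightarrow> L \<subseteq> M \<and> (\<forall>s\<in>M. s \<subseteq> \<Union>L \<longrightarrow> s \<in> L)"

definition locally_convex :: "'v set set set \<Rightarrow> 'v set set set \<Rightarrow> bool" where
  "locally_convex K X \<longleftrightarrow> K \<subseteq> X \<and>
     (\<forall>p\<in>K. cell_dim p = 0 \<longrightarrow> full_subcomplex (link K p) (link X p))"


section \<open>Geometric realizations and the unordered configuration space\<close>

text \<open>A point of a graph is given by its barycentric coordinates.\<close>

definition realize_cell :: "'v set \<Rightarrow> ('v \<Rightarrow> real) set" where
  "realize_cell \<sigma> = {f. (\<forall>v. 0 \<le> f v) \<and> (\<forall>v. v \<notin> \<sigma> \<longrightarrow> f v = 0) \<and> (\<Sum>v\<in>\<sigma>. f v) = 1}"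

definition realize_graph :: "'v sgraph \<Rightarrow> ('v \<Rightarrow> real) topology" where
  "realize_graph G = top_of_set (\<Union>\<sigma>\<in>graph_cells G. realize_cell \<sigma>)"

definition quotient_topology :: "'a topology \<Rightarrow> ('a \<Rightarrow> 'b) \<Rightarrow> 'b topology" where
  "quotient_topology X f =
     topology (\<lambda>U. U \<subseteq> f ` topspace X \<and> openin X {x \<in> topspace X. f x \<in> U})"

lemma openin_quotient_topology:
  "openin (quotient_topology X f) U \<longleftrightarrow>
     U \<subseteq> f ` topspace X \<and> openin X {x \<in> topspace X. f x \<in> U}"
proof -
  have "istopology (\<lambda>U. U \<subseteq> f ` topspace X \<and> openin X {x \<in> topspace X. f x \<in> U})"
    unfolding istopology_def
  proof (intro conjI allI impI)
    fix S T
    assume S: "S \<subseteq> f ` topspace X \<and> openin X {x \<in> topspace X. f x \<in> S}"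
      and T: "T \<subseteq> f ` topspace X \<and> openin X {x \<in> topspace X. f x \<in> T}"
    have "{x \<in> topspace X. f x \<in> S \<inter> T} =
        {x \<in> topspace X. f x \<in> S} \<inter> {x \<in> topspace X. f x \<in> T}" by auto
    then show "openin X {x \<in> topspace X. f x \<in> S \<inter> T}" using S T by (simp add: openin_Int)
    show "S \<inter> T \<subseteq> f ` topspace X" using S by auto
  next
    fix \<K> assume K: "\<forall>K\<in>\<K>. K \<subseteq> f ` topspace X \<and> openin X {x \<in> topspace X. f x \<in> K}"
    have "{x \<in> topspace X. f x \<in> \<Union>\<K>} = (\<Union>K\<in>\<K>. {x \<in> topspace X. f x \<in> K})" by auto
    then show "openin X {x \<in> topspace X. f x \<in> \<Union>\<K>}" using K by auto
    show "\<Union>\<K> \<subseteq> f ` topspace X" using K by auto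
  qed
  then show ?thesis by (simp add: quotient_topology_def topology_inverse')
qed

lemma quotient_map_quotient_topology: "quotient_map X (quotient_topology X f) f"
proof -
  have "{x \<in> topspace X. f x \<in> f ` topspace X} = topspace X" by auto
  then have "openin (quotient_topology X f) (f ` topspace X)"
    by (simp add: openin_quotient_topology)
  then have "topspace (quotient_topology X f) = f ` topspace X"
    by (metis openin_quotient_topology openin_subset openin_topspace subset_antisym)
  then show ?thesis by (simp add: quotient_map_def openin_quotient_topology)
qed

definition unordered_config2 :: "'a topology \<Rightarrow> 'a set topology" where
  "unordered_config2 X =
     quotient_topology (subtopology (prod_topology X X) {(x, y). x \<noteq> y}) (\<lambda>(x, y). {x, y})"

definition realize_square_cell :: "'v set set \<Rightarrow> ('v \<Rightarrow> real) set set" where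
  "realize_square_cell c =
     {{x, y} | x y \<sigma> \<tau>. c = {\<sigma>, \<tau>} \<and> x \<in> realize_cell \<sigma> \<and> y \<in> realize_cell \<tau>}"

text \<open>A subcomplex of \<open>UD2 G\<close> is realized inside the unordered configuration space of \<open>G\<close>.\<close>

definition realize_subcomplex :: "'v sgraph \<Rightarrow> 'v set set set \<Rightarrow> ('v \<Rightarrow> real) set topology" where
  "realize_subcomplex G K =
     subtopology (unordered_config2 (realize_graph G)) (\<Union>c\<in>K. realize_square_cell c)"


section \<open>Fundamental groups\<close>

definition loops_at :: "'a topology \<Rightarrow> 'a \<Rightarrow> (real \<Rightarrow> 'a) set" where
  "loops_at X p = {g. pathin X g \<and> g 0 = p \<and> g 1 = p}"

definition loop_homotopy :: "'a topology \<Rightarrow> 'a \<Rightarrow> ((real \<Rightarrow> 'a) \<times> (real \<Rightarrow> 'a)) set" where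
  "loop_homotopy X p = {(f, g). f \<in> loops_at X p \<and> g \<in> loops_at X p \<and>
     homotopic_with (\<lambda>h. h 0 = p \<and> h 1 = p) (top_of_set {0..1}) X f g}"

text \<open>The library's \<open>(+++)\<close> requires a type class topology on the range.\<close>

definition concat_loop :: "(real \<Rightarrow> 'a) \<Rightarrow> (real \<Rightarrow> 'a) \<Rightarrow> real \<Rightarrow> 'a" where
  "concat_loop f g = (\<lambda>t. if t \<le> 1/2 then f (2 * t) else g (2 * t - 1))"

definition fundamental_group :: "'a topology \<Rightarrow> 'a \<Rightarrow> (real \<Rightarrow> 'a) set monoid" where
  "fundamental_group X p =
     \<lparr> carrier = loops_at X p // loop_homotopy X p,
       mult = (\<lambda>A B. \<Union>f\<in>A. \<Union>g\<in>B. loop_homotopy X p `` {concat_loop f g}),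
       one = loop_homotopy X p `` {\<lambda>_. p} \<rparr>"

definition braid_group2 :: "'v sgraph \<Rightarrow> ('v \<Rightarrow> real) set \<Rightarrow> (real \<Rightarrow> ('v \<Rightarrow> real) set) set monoid"
  where "braid_group2 G p = fundamental_group (unordered_config2 (realize_graph G)) p"


section \<open>Free groups and free products\<close>

text \<open>The monoid presented by the alphabet \<open>A\<close> and the relations \<open>l = r\<close> for \<open>(l, r) \<in> R\<close>:
  words modulo the congruence generated by \<open>R\<close>.\<close>

definition word_step :: "'a set \<Rightarrow> ('a list \<times> 'a list) set \<Rightarrow> ('a list \<times> 'a list) set" where
  "word_step A R = {(u @ l @ v, u @ r @ v) | u v l r. u \<in> lists A \<and> v \<in> lists A \<and> (l, r) \<in> R}"

definition word_cong :: "'a set \<Rightarrow> ('a list \<times> 'a list) set \<Rightarrow> ('a list \<times> 'a list) set" where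
  "word_cong A R = Restr ((word_step A R \<union> (word_step A R)\<inverse>)\<^sup>*) (lists A)"

definition presented_monoid :: "'a set \<Rightarrow> ('a list \<times> 'a list) set \<Rightarrow> 'a list set monoid" where
  "presented_monoid A R =
     \<lparr> carrier = lists A // word_cong A R,
       mult = (\<lambda>X Y. \<Union>x\<in>X. \<Union>y\<in>Y. word_cong A R `` {x @ y}),
       one = word_cong A R `` {[]} \<rparr>"

text \<open>The letter \<open>(s, True)\<close> is the generator \<open>s\<close>, and \<open>(s, False)\<close> its inverse.\<close>

definition free_group :: "'a set \<Rightarrow> ('a \<times> bool) list set monoid" where
  "free_group S = presented_monoid (S \<times> UNIV) {([(s, b), (s, \<not> b)], []) | s b. s \<in> S}"

definition free_product ::
    "('a, 'c) monoid_scheme \<Rightarrow> ('b, 'd) monoid_scheme \<Rightarrow> ('a + 'b) list set monoid" where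
  "free_product G H = presented_monoid (carrier G <+> carrier H)
     ({([Inl x, Inl y], [Inl (x \<otimes>\<^bsub>G\<^esub> y)]) | x y. x \<in> carrier G \<and> y \<in> carrier G}
      \<union> {([Inr x, Inr y], [Inr (x \<otimes>\<^bsub>H\<^esub> y)]) | x y. x \<in> carrier H \<and> y \<in> carrier H}
      \<union> {([Inl \<one>\<^bsub>G\<^esub>], []), ([Inr \<one>\<^bsub>H\<^esub>], [])})"

end

theory Submission
  imports Defs
begin

text \<open>Both groups in the splitting are computed by one device. Write an unordered configuration of two
  points as \<open>{x, y}\<close> with barycentric coordinates \<open>x\<close>, \<open>y\<close>, and record the two sets of vertices \<open>v\<close> with
  \<open>y v < x v\<close> and with \<open>x v < y v\<close>. These sets are the factors of a cell of the discrete square complex,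
  and they can only grow under small changes of the configuration, as the cells do in open stars. Hence
  a labelling of the edges of the complex by elements of a group \<open>H\<close> that is trivial around every cell
  (a \<open>cell_cocycle\<close>) has a monodromy along every path of the configuration space itself, and not only
  along edge paths. In the other direction any path can be pushed, star by star, to the vertices. This
  gives the universal property of the fundamental group: homomorphisms to \<open>H\<close> correspond to the cell
  cocycles that vanish on a spanning tree (\<open>edge_class_hom_exists\<close>, \<open>edge_class_hom_unique\<close>). It holds
  for the whole configuration space with the complex \<open>UD2\<close>, and for the realization of any subcomplex,
  in particular \<open>UP2\<close>.

  It remains to compare cocycles on \<open>UD2\<close> and on \<open>UP2\<close>, which is a finite combinatorial matter. Let every
  vertex of the graph have as its stem the vertex of the tree at which it sits. A cell with factors
  \<open>\<sigma>\<close>, \<open>\<tau>\<close> lies in \<open>UP2\<close> iff \<open>\<sigma>\<close> and \<open>\<tau>\<close> have no common stem (\<open>UP2_\<Gamma>\<close>): a leafless connected subgraph that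
  contains a vertex of a grape contains its stem, and conversely the stems of \<open>\<sigma>\<close> and \<open>\<tau>\<close> can be separated
  by cutting the tree into two connected parts, over which the graph is leafless. Local convexity is
  read off from this. The cells outside \<open>UP2\<close> form one cluster for each stem vertex \<open>v\<close>: here both
  factors have the stem \<open>v\<close> in common. In a cluster every vertex is joined to \<open>UP2\<close> by a tree of moves, and
  every further move either belongs to a list of generators or is the fourth side of a square whose
  other sides are known (\<open>cluster_determined\<close>). Conversely, arbitrary labels on the generators extend a
  cocycle on \<open>UP2\<close> to one on \<open>UD2\<close> (locale \<open>cocycle_extension\<close>). So a normalized cocycle on \<open>UD2\<close> is a
  normalized cocycle on \<open>UP2\<close> together with a free choice of labels for the generators, and this is the
  universal property of the free product with a free group on the generators. Each vertex with a grape
  contributes a generator, and normality provides two such vertices.\<close>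

section \<open>Homotopies of paths\<close>

definition path_homotopic :: "'a topology \<Rightarrow> (real \<Rightarrow> 'a) \<Rightarrow> (real \<Rightarrow> 'a) \<Rightarrow> bool" where
  "path_homotopic X f g \<longleftrightarrow>
     homotopic_with (\<lambda>h. h 0 = f 0 \<and> h 1 = f 1) (top_of_set {0..1}) X f g"

definition reverse_path :: "(real \<Rightarrow> 'a) \<Rightarrow> real \<Rightarrow> 'a" where
  "reverse_path f = (\<lambda>t. f (1 - t))"

lemma path_homotopic_refl [simp]: "path_homotopic X f f \<longleftrightarrow> pathin X f"
  by (auto simp: path_homotopic_def pathin_def)

lemma path_homotopic_ends:
  assumes "path_homotopic X f g"
  shows "g 0 = f 0" "g 1 = f 1" "pathin X f" "pathin X g"
  using homotopic_with_imp_property[OF assms[unfolded path_homotopic_def]]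
    homotopic_with_imp_continuous_maps[OF assms[unfolded path_homotopic_def]]
  by (auto simp: pathin_def)

lemma path_homotopic_sym: "path_homotopic X f g \<Longrightarrow> path_homotopic X g f"
  by (frule path_homotopic_ends(1), frule path_homotopic_ends(2))
     (simp add: path_homotopic_def homotopic_with_symD)

lemma path_homotopic_trans [trans]:
  assumes "path_homotopic X f g" "path_homotopic X g h"
  shows "path_homotopic X f h"
  using assms path_homotopic_ends(1,2)[OF assms(1)]
  by (auto simp: path_homotopic_def intro: homotopic_with_trans)

lemma path_homotopic_iff:
  "path_homotopic X f g \<longleftrightarrow>
     (\<exists>h. continuous_map (top_of_set ({0..1::real} \<times> {0..1::real})) X h \<and>
        (\<forall>t\<in>{0..1}. h (0, t) = f t) \<and> (\<forall>t\<in>{0..1}. h (1, t) = g t) \<and>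
        (\<forall>s\<in>{0..1}. h (s, 0) = f 0 \<and> h (s, 1) = f 1))"
  unfolding path_homotopic_def
  by (subst homotopic_with) (auto simp: prod_topology_subtopology_eu)

lemma path_homotopic_eq:
  assumes "pathin X f" "\<And>t. \<lbrakk>0 \<le> t; t \<le> 1\<rbrakk> \<Longrightarrow> f t = g t"
  shows "path_homotopic X f g"
  unfolding path_homotopic_def
  by (rule homotopic_with_equal) (use assms in \<open>auto simp: pathin_def\<close>)

lemma pathin_concat:
  assumes f: "pathin X f" and g: "pathin X g" and "f 1 = g 0"
  shows "pathin X (concat_loop f g)"
  unfolding pathin_def concat_loop_def
proof (rule continuous_map_cases_le)
  have "continuous_map (top_of_set {0..1/2}) X (f \<circ> (\<lambda>t. 2 * t))"
    by (rule continuous_map_compose[OF _ f[unfolded pathin_def]])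
      (auto intro!: continuous_intros)
  moreover have "{0..1} \<inter> {x \<in> topspace (top_of_set {0..1}). x \<le> 1/2} = {0..1/2::real}" by auto
  ultimately show "continuous_map (subtopology (top_of_set {0..1}) {x \<in> topspace (top_of_set {0..1}). x \<le> 1/2}) X
     (\<lambda>t. f (2 * t))"
    by (simp only: subtopology_subtopology o_def)
  have "continuous_map (top_of_set {1/2..1}) X (g \<circ> (\<lambda>t. 2 * t - 1))"
    by (rule continuous_map_compose[OF _ g[unfolded pathin_def]])
      (auto intro!: continuous_intros)
  moreover have "{0..1} \<inter> {x \<in> topspace (top_of_set {0..1}). 1/2 \<le> x} = {1/2..1::real}" by auto
  ultimately show "continuous_map (subtopology (top_of_set {0..1}) {x \<in> topspace (top_of_set {0..1}). 1/2 \<le> x}) X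
     (\<lambda>t. g (2 * t - 1))"
    by (simp only: subtopology_subtopology o_def)
qed (use assms in \<open>auto simp: mult.commute\<close>)

text \<open>Any two paths with the same ends in a convex parameter domain are homotopic by the straight line
  homotopy. All the homotopies below are instances: only the parameter paths have to be found.\<close>

lemma path_homotopic_convex:
  fixes D :: "'d::real_normed_vector set"
  assumes "convex D" and F: "continuous_map (top_of_set D) X F"
    and "continuous_on {0..1} \<phi>" "continuous_on {0..1} \<psi>"
    and D: "\<And>t. \<lbrakk>0 \<le> t; t \<le> 1\<rbrakk> \<Longrightarrow> \<phi> t \<in> D" "\<And>t. \<lbrakk>0 \<le> t; t \<le> 1\<rbrakk> \<Longrightarrow> \<psi> t \<in> D"
    and "\<phi> 0 = \<psi> 0" "\<phi> 1 = \<psi> 1"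
  shows "path_homotopic X (\<lambda>t. F (\<phi> t)) (\<lambda>t. F (\<psi> t))"
proof -
  let ?k = "\<lambda>(s, t). (1 - s) *\<^sub>R \<phi> t + s *\<^sub>R \<psi> t"
  have "continuous_map (top_of_set ({0..1::real} \<times> {0..1::real})) (top_of_set D) ?k"
    using assms(3,4) D convexD_alt[OF assms(1)]
    by (auto simp: case_prod_unfold image_subset_iff
        intro!: continuous_intros continuous_on_compose2[of "{0..1}" \<phi>] continuous_on_compose2[of "{0..1}" \<psi>])
  then have "continuous_map (top_of_set ({0..1::real} \<times> {0..1::real})) X (F \<circ> ?k)"
    by (rule continuous_map_compose) (rule F)
  then show ?thesis
    unfolding path_homotopic_iff
    by (intro exI[of _ "F \<circ> ?k"]) (use assms in \<open>auto simp: algebra_simps simp flip: scaleR_add_left\<close>)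
qed

lemma path_homotopic_concat:
  assumes "path_homotopic X f f'" "path_homotopic X g g'" "f 1 = g 0"
  shows "path_homotopic X (concat_loop f g) (concat_loop f' g')"
proof -
  obtain h where h: "continuous_map (top_of_set ({0..1::real} \<times> {0..1::real})) X h"
        "\<And>t. t\<in>{0..1} \<Longrightarrow> h (0, t) = f t" "\<And>t. t\<in>{0..1} \<Longrightarrow> h (1, t) = f' t"
        "\<And>s. s\<in>{0..1} \<Longrightarrow> h (s, 0) = f 0 \<and> h (s, 1) = f 1"
    using assms(1) unfolding path_homotopic_iff by blast
  obtain k where k: "continuous_map (top_of_set ({0..1::real} \<times> {0..1::real})) X k"
        "\<And>t. t\<in>{0..1} \<Longrightarrow> k (0, t) = g t" "\<And>t. t\<in>{0..1} \<Longrightarrow> k (1, t) = g' t"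
        "\<And>s. s\<in>{0..1} \<Longrightarrow> k (s, 0) = g 0 \<and> k (s, 1) = g 1"
    using assms(2) unfolding path_homotopic_iff by blast
  let ?m = "\<lambda>p. if snd p \<le> 1/2 then h (fst p, 2 * snd p) else k (fst p, 2 * snd p - 1)"
  let ?S = "{0..1} \<times> {0..1} :: (real \<times> real) set"
  have "continuous_map (top_of_set ?S) X ?m"
  proof (rule continuous_map_cases_le)
    have "continuous_map (top_of_set ({0..1} \<times> {0..1/2})) X (h \<circ> (\<lambda>p. (fst p, 2 * snd p)))"
      by (rule continuous_map_compose[OF _ h(1)]) (auto intro!: continuous_intros)
    moreover have "?S \<inter> {x \<in> topspace (top_of_set ?S). snd x \<le> 1/2} = {0..1} \<times> {0..1/2}" by auto
    ultimately show "continuous_map (subtopology (top_of_set ?S) {x \<in> topspace (top_of_set ?S). snd x \<le> 1/2}) X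
        (\<lambda>p. h (fst p, 2 * snd p))"
      by (simp only: subtopology_subtopology o_def)
    have "continuous_map (top_of_set ({0..1} \<times> {1/2..1})) X (k \<circ> (\<lambda>p. (fst p, 2 * snd p - 1)))"
      by (rule continuous_map_compose[OF _ k(1)]) (auto intro!: continuous_intros)
    moreover have "?S \<inter> {x \<in> topspace (top_of_set ?S). 1/2 \<le> snd x} = {0..1} \<times> {1/2..1}" by auto
    ultimately show "continuous_map (subtopology (top_of_set ?S) {x \<in> topspace (top_of_set ?S). 1/2 \<le> snd x}) X
        (\<lambda>p. k (fst p, 2 * snd p - 1))"
      by (simp only: subtopology_subtopology o_def)
  next
    fix p :: "real \<times> real" assume p: "p \<in> topspace (top_of_set ?S)" "snd p = 1/2"
    then have "2 * snd p = 1" by simp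
    then show "h (fst p, 2 * snd p) = k (fst p, 2 * snd p - 1)"
      unfolding \<open>2 * snd p = 1\<close> using p h(4) k(4) assms(3) by (auto simp: mem_Times_iff)
  qed (auto intro!: continuous_intros)
  then show ?thesis
    unfolding path_homotopic_iff
    by (intro exI[of _ ?m]) (auto simp: concat_loop_def h(2-4) k(2-4))
qed

lemma pathin_reverse: "pathin X f \<Longrightarrow> pathin X (reverse_path f)"
  unfolding pathin_def reverse_path_def
  by (rule continuous_map_compose[of _ "top_of_set {0..1}" "\<lambda>t. 1 - t" X f, unfolded o_def])
    (auto intro!: continuous_intros)

lemma reverse_path_simps [simp]:
  "reverse_path f 0 = f 1" "reverse_path f 1 = f 0" "reverse_path (reverse_path f) = f"
  by (auto simp: reverse_path_def)

lemma concat_loop_simps [simp]: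
  "concat_loop f g 0 = f 0" "concat_loop f g 1 = g 1"
  by (auto simp: concat_loop_def)

lemma path_homotopic_reparam:
  assumes "pathin X f" "continuous_on {0..1} \<phi>" "continuous_on {0..1} \<psi>"
    and "\<And>t. \<lbrakk>0 \<le> t; t \<le> 1\<rbrakk> \<Longrightarrow> 0 \<le> \<phi> t \<and> \<phi> t \<le> 1"
    and "\<And>t. \<lbrakk>0 \<le> t; t \<le> 1\<rbrakk> \<Longrightarrow> 0 \<le> \<psi> t \<and> \<psi> t \<le> 1"
    and "\<phi> 0 = \<psi> 0" "\<phi> 1 = \<psi> 1"
  shows "path_homotopic X (\<lambda>t. f (\<phi> t)) (\<lambda>t. f (\<psi> t))"
  by (rule path_homotopic_convex[where D = "{0..1}"]) (use assms in \<open>auto simp: pathin_def\<close>)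

lemma concat_assoc:
  assumes "pathin X f" "pathin X g" "pathin X h" "f 1 = g 0" "g 1 = h 0"
  shows "path_homotopic X (concat_loop (concat_loop f g) h) (concat_loop f (concat_loop g h))"
proof -
  define \<phi> :: "real \<Rightarrow> real" where
    "\<phi> = (\<lambda>t. min (2 * t) (min (t + 1/4) (t / 2 + 1/2)))"
  have "concat_loop (concat_loop f g) h t = concat_loop f (concat_loop g h) (\<phi> t)" if "0 \<le> t" "t \<le> 1" for t
  proof -
    consider "t \<le> 1/4" | "1/4 < t" "t \<le> 1/2" | "1/2 < t" by linarith
    then show ?thesis
    proof cases
      case 1
      then have "\<phi> t = 2 * t" by (simp add: \<phi>_def min_def)
      then show ?thesis using 1 by (simp add: concat_loop_def)
    next
      case 2
      then have "\<phi> t = t + 1/4" by (simp add: \<phi>_def min_def)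
      moreover have "2 * (2 * (t + 1/4) - 1) = 2 * (2 * t) - 1" by simp
      ultimately show ?thesis using 2 by (simp add: concat_loop_def)
    next
      case 3
      then have "\<phi> t = t / 2 + 1/2" by (simp add: \<phi>_def min_def)
      moreover have "2 * (2 * (t / 2 + 1/2) - 1) - 1 = 2 * t - 1" by simp
      ultimately show ?thesis using 3 by (simp add: concat_loop_def)
    qed
  qed
  then have "path_homotopic X (concat_loop (concat_loop f g) h) (\<lambda>t. concat_loop f (concat_loop g h) (\<phi> t))"
    by (intro path_homotopic_eq pathin_concat) (use assms in auto)
  also have "path_homotopic X (\<lambda>t. concat_loop f (concat_loop g h) (\<phi> t)) (\<lambda>t. concat_loop f (concat_loop g h) t)"
    by (rule path_homotopic_reparam) 
       (use assms in \<open>auto simp: \<phi>_def min_le_iff_disj intro!: pathin_concat continuous_intros\<close>)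
  finally show ?thesis .
qed

lemma concat_const_left:
  assumes "pathin X f" "a = f 0"
  shows "path_homotopic X (concat_loop (\<lambda>_. a) f) f"
proof -
  have "concat_loop (\<lambda>_. a) f t = f (max 0 (2 * t - 1))" for t
    using assms by (cases "t \<le> 1/2") (simp_all add: concat_loop_def max.absorb1 max.absorb2)
  then have "concat_loop (\<lambda>_. a) f = (\<lambda>t. f (max 0 (2 * t - 1)))" by blast
  moreover have "path_homotopic X (\<lambda>t. f (max 0 (2 * t - 1))) (\<lambda>t. f t)"
    by (rule path_homotopic_reparam) (use assms in \<open>auto intro!: continuous_intros\<close>)
  ultimately show ?thesis by simp
qed

lemma concat_reverse:
  assumes "pathin X f" "a = f 0"
  shows "path_homotopic X (concat_loop f (reverse_path f)) (\<lambda>_. a)"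
proof -
  have "concat_loop f (reverse_path f) t = f (min (2 * t) (2 - 2 * t))" for t
    by (auto simp: concat_loop_def min_def reverse_path_def algebra_simps)
  then have "concat_loop f (reverse_path f) = (\<lambda>t. f (min (2 * t) (2 - 2 * t)))" by blast
  moreover have "path_homotopic X (\<lambda>t. f (min (2 * t) (2 - 2 * t))) (\<lambda>t. f 0)"
    by (rule path_homotopic_reparam) (use assms in \<open>auto intro!: continuous_intros\<close>)
  ultimately show ?thesis using assms by simp
qed

lemma concat_reverse':
  assumes "pathin X f" "a = f 1"
  shows "path_homotopic X (concat_loop (reverse_path f) f) (\<lambda>_. a)"
  using concat_reverse[OF pathin_reverse[OF assms(1)], of a] assms by simp

lemma path_homotopic_square:
  assumes H: "continuous_map (top_of_set ({0..1::real} \<times> {0..1::real})) X H"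
  shows "path_homotopic X (concat_loop (\<lambda>t. H (0, t)) (\<lambda>s. H (s, 1)))
           (concat_loop (\<lambda>s. H (s, 0)) (\<lambda>t. H (1, t)))"
proof -
  let ?a = "\<lambda>t. (max 0 (2 * t - 1), min 1 (2 * t)) :: real \<times> real"
  let ?b = "\<lambda>t. (min 1 (2 * t), max 0 (2 * t - 1)) :: real \<times> real"
  have "concat_loop (\<lambda>t. H (0, t)) (\<lambda>s. H (s, 1)) = (\<lambda>t. H (?a t))"
       "concat_loop (\<lambda>s. H (s, 0)) (\<lambda>t. H (1, t)) = (\<lambda>t. H (?b t))"
    unfolding concat_loop_def
    by (rule ext; rename_tac t; case_tac "t \<le> 1/2";
        simp add: max.absorb1 max.absorb2 min.absorb1 min.absorb2)+
  moreover have "path_homotopic X (\<lambda>t. H (?a t)) (\<lambda>t. H (?b t))"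
    by (rule path_homotopic_convex[OF _ H])
       (auto intro!: continuous_intros convex_Times)
  ultimately show ?thesis by simp
qed

lemma path_homotopic_triangle:
  assumes H: "continuous_map (top_of_set {p. 0 \<le> fst p \<and> 0 \<le> snd p \<and> fst p + snd p \<le> (1::real)}) X H"
  shows "path_homotopic X (concat_loop (\<lambda>t. H (t, 0)) (\<lambda>t. H (1 - t, t))) (\<lambda>t. H (0, t))"
proof -
  let ?a = "\<lambda>t. (min (2 * t) (2 - 2 * t), max 0 (2 * t - 1)) :: real \<times> real"
  have c: "convex {p. 0 \<le> fst p \<and> 0 \<le> snd p \<and> fst p + snd p \<le> (1::real)}"
    unfolding convex_def
  proof (intro ballI allI impI)
    fix p q :: "real \<times> real" and u v :: real
    assume "p \<in> {p. 0 \<le> fst p \<and> 0 \<le> snd p \<and> fst p + snd p \<le> 1}"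
      "q \<in> {p. 0 \<le> fst p \<and> 0 \<le> snd p \<and> fst p + snd p \<le> 1}" "0 \<le> u" "0 \<le> v" "u + v = 1"
    then show "u *\<^sub>R p + v *\<^sub>R q \<in> {p. 0 \<le> fst p \<and> 0 \<le> snd p \<and> fst p + snd p \<le> 1}"
      using mult_left_mono[of "fst p + snd p" 1 u] mult_left_mono[of "fst q + snd q" 1 v]
      by (simp add: algebra_simps)
  qed
  have "concat_loop (\<lambda>t. H (t, 0)) (\<lambda>t. H (1 - t, t)) = (\<lambda>t. H (?a t))"
    unfolding concat_loop_def
    by (rule ext; rename_tac t; case_tac "t \<le> 1/2";
        simp add: max.absorb1 max.absorb2 min.absorb1 min.absorb2)
  moreover have "path_homotopic X (\<lambda>t. H (?a t)) (\<lambda>t. H (0, t))"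
  proof (rule path_homotopic_convex[OF c H])
    show "continuous_on {0..1} ?a" "continuous_on {0..1} (\<lambda>t. (0, t) :: real \<times> real)"
      by (intro continuous_intros)+
  qed (auto simp: max_def min_def)
  ultimately show ?thesis by simp
qed

section \<open>The fundamental group\<close>

definition loop_class :: "'a topology \<Rightarrow> 'a \<Rightarrow> (real \<Rightarrow> 'a) \<Rightarrow> (real \<Rightarrow> 'a) set" where
  "loop_class X p f = loop_homotopy X p `` {f}"

lemma loop_homotopy_iff:
  "(f, g) \<in> loop_homotopy X p \<longleftrightarrow> f \<in> loops_at X p \<and> path_homotopic X f g"
  using path_homotopic_ends[of X f g]
  by (auto simp: loop_homotopy_def path_homotopic_def loops_at_def)

lemma equiv_loop_homotopy: "equiv (loops_at X p) (loop_homotopy X p)"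
proof (rule equivI)
  show "loop_homotopy X p \<subseteq> loops_at X p \<times> loops_at X p" by (auto simp: loop_homotopy_def)
  show "refl_on (loops_at X p) (loop_homotopy X p)"
    by (auto simp: refl_on_def loop_homotopy_iff loops_at_def)
  show "sym (loop_homotopy X p)"
    by (auto simp: sym_def loop_homotopy_iff loops_at_def
        intro: path_homotopic_sym dest: path_homotopic_ends)
  show "trans (loop_homotopy X p)"
    by (auto simp: trans_def loop_homotopy_iff intro: path_homotopic_trans)
qed

lemma loop_class_eq_iff:
  assumes "f \<in> loops_at X p" "g \<in> loops_at X p"
  shows "loop_class X p f = loop_class X p g \<longleftrightarrow> path_homotopic X f g"
  unfolding loop_class_def
  using eq_equiv_class_iff[OF equiv_loop_homotopy assms] assms(1) by (simp add: loop_homotopy_iff)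

lemma loop_class_eqI:
  assumes "f \<in> loops_at X p" "path_homotopic X f g"
  shows "loop_class X p f = loop_class X p g"
proof -
  have "g \<in> loops_at X p" using assms path_homotopic_ends[OF assms(2)] by (auto simp: loops_at_def)
  with assms show ?thesis by (simp add: loop_class_eq_iff)
qed

lemma carrier_fundamental_group:
  "carrier (fundamental_group X p) = loop_class X p ` loops_at X p"
  by (auto simp: fundamental_group_def quotient_def loop_class_def)

lemma loop_class_in_carrier [simp]:
  "f \<in> loops_at X p \<Longrightarrow> loop_class X p f \<in> carrier (fundamental_group X p)"
  by (simp add: carrier_fundamental_group)

lemma one_fundamental_group: "\<one>\<^bsub>fundamental_group X p\<^esub> = loop_class X p (\<lambda>_. p)"
  by (simp add: fundamental_group_def loop_class_def)

lemma concat_in_loops_at: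
  "f \<in> loops_at X p \<Longrightarrow> g \<in> loops_at X p \<Longrightarrow> concat_loop f g \<in> loops_at X p"
  by (auto simp: loops_at_def intro: pathin_concat)

lemma mult_fundamental_group:
  assumes "f \<in> loops_at X p" "g \<in> loops_at X p"
  shows "loop_class X p f \<otimes>\<^bsub>fundamental_group X p\<^esub> loop_class X p g = loop_class X p (concat_loop f g)"
proof -
  have "congruent2 (loop_homotopy X p) (loop_homotopy X p) (\<lambda>f g. loop_class X p (concat_loop f g))"
  proof (rule congruent2I')
    fix f f' g g' assume "(f, f') \<in> loop_homotopy X p" "(g, g') \<in> loop_homotopy X p"
    then show "loop_class X p (concat_loop f g) = loop_class X p (concat_loop f' g')"
      by (intro loop_class_eqI path_homotopic_concat concat_in_loops_at)
         (auto simp: loop_homotopy_iff loops_at_def)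
  qed
  from UN_equiv_class2[OF equiv_loop_homotopy equiv_loop_homotopy this assms]
  show ?thesis by (simp add: fundamental_group_def loop_class_def)
qed

lemma group_fundamental_group:
  assumes p: "p \<in> topspace X"
  shows "group (fundamental_group X p)"
proof (rule groupI)
  have c: "(\<lambda>_. p) \<in> loops_at X p" using p by (simp add: loops_at_def)
  show "\<one>\<^bsub>fundamental_group X p\<^esub> \<in> carrier (fundamental_group X p)"
    by (simp add: one_fundamental_group c)
  fix x assume "x \<in> carrier (fundamental_group X p)"
  then obtain f where f: "f \<in> loops_at X p" "x = loop_class X p f" by (auto simp: carrier_fundamental_group)
  show "\<one>\<^bsub>fundamental_group X p\<^esub> \<otimes>\<^bsub>fundamental_group X p\<^esub> x = x"
    using f c by (auto simp: one_fundamental_group mult_fundamental_group loops_at_def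
        intro!: loop_class_eqI pathin_concat concat_const_left)
  have "reverse_path f \<in> loops_at X p" using f by (auto simp: loops_at_def intro: pathin_reverse)
  moreover have "loop_class X p (reverse_path f) \<otimes>\<^bsub>fundamental_group X p\<^esub> x = \<one>\<^bsub>fundamental_group X p\<^esub>"
    using f calculation by (auto simp: one_fundamental_group mult_fundamental_group loops_at_def
        intro!: loop_class_eqI pathin_concat concat_reverse')
  ultimately show "\<exists>y\<in>carrier (fundamental_group X p). y \<otimes>\<^bsub>fundamental_group X p\<^esub> x = \<one>\<^bsub>fundamental_group X p\<^esub>"
    by auto
  fix y assume "y \<in> carrier (fundamental_group X p)"
  then obtain g where g: "g \<in> loops_at X p" "y = loop_class X p g" by (auto simp: carrier_fundamental_group)
  show "x \<otimes>\<^bsub>fundamental_group X p\<^esub> y \<in> carrier (fundamental_group X p)"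
    using f g by (simp add: mult_fundamental_group concat_in_loops_at)
  fix z assume "z \<in> carrier (fundamental_group X p)"
  then obtain h where h: "h \<in> loops_at X p" "z = loop_class X p h" by (auto simp: carrier_fundamental_group)
  show "x \<otimes>\<^bsub>fundamental_group X p\<^esub> y \<otimes>\<^bsub>fundamental_group X p\<^esub> z
      = x \<otimes>\<^bsub>fundamental_group X p\<^esub> (y \<otimes>\<^bsub>fundamental_group X p\<^esub> z)"
    using f g h by (simp add: mult_fundamental_group concat_in_loops_at)
      (auto simp: loops_at_def intro!: loop_class_eqI pathin_concat concat_assoc)
qed

section \<open>Monodromy of local cocycles\<close>

text \<open>A replacement for covering spaces. Each point \<open>z\<close> has an open neighbourhood \<open>W z\<close>, and \<open>\<theta> z z'\<close> is the
  change of a group valued, locally defined potential from \<open>z\<close> to \<open>z' \<in> W z\<close>. The relation is asymmetric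
  (\<open>z' \<in> W z\<close> does not give \<open>z \<in> W z'\<close>), which suits open stars of cells of different dimensions.\<close>

locale local_cocycle = group G for G (structure) +
  fixes X :: "'x topology" and W :: "'x \<Rightarrow> 'x set" and \<theta> :: "'x \<Rightarrow> 'x \<Rightarrow> 'a"
  assumes open_W: "z \<in> topspace X \<Longrightarrow> openin X (W z)"
    and in_W: "z \<in> topspace X \<Longrightarrow> z \<in> W z"
    and theta_closed: "\<lbrakk>z \<in> topspace X; z' \<in> W z\<rbrakk> \<Longrightarrow> \<theta> z z' \<in> carrier G"
    and theta_cocycle: "\<lbrakk>z \<in> topspace X; z' \<in> W z; z'' \<in> W z; z'' \<in> W z'\<rbrakk>
        \<Longrightarrow> \<theta> z z' \<otimes> \<theta> z' z'' = \<theta> z z''"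
begin

text \<open>A potential along \<open>\<gamma>\<close>: near each \<open>t\<close> its increments from \<open>t\<close> are those prescribed by \<open>\<theta>\<close>.\<close>

definition lift :: "'d::topological_space set \<Rightarrow> ('d \<Rightarrow> 'x) \<Rightarrow> ('d \<Rightarrow> 'a) \<Rightarrow> bool" where
  "lift D \<gamma> a \<longleftrightarrow> (\<forall>t\<in>D. \<gamma> t \<in> topspace X \<and> a t \<in> carrier G \<and>
     (\<exists>U. open U \<and> t \<in> U \<and> (\<forall>t'\<in>U \<inter> D. \<gamma> t' \<in> W (\<gamma> t) \<and> inv (a t) \<otimes> a t' = \<theta> (\<gamma> t) (\<gamma> t'))))"

lemma lift_closed: "lift D \<gamma> a \<Longrightarrow> t \<in> D \<Longrightarrow> a t \<in> carrier G"
  and lift_topspace: "lift D \<gamma> a \<Longrightarrow> t \<in> D \<Longrightarrow> \<gamma> t \<in> topspace X"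
  unfolding lift_def by blast+

text \<open>The quotient of two lifts is locally constant, hence constant on a connected domain.\<close>

lemma lift_unique:
  assumes "lift D \<gamma> a" "lift D \<gamma> b" "connected D" "s \<in> D" "t \<in> D"
  shows "a s \<otimes> inv (b s) = a t \<otimes> inv (b t)"
proof (rule connected_local_const[OF assms(3-5)], rule ballI)
  fix t assume t: "t \<in> D"
  obtain U where U: "open U" "t \<in> U"
    "\<forall>t'\<in>U \<inter> D. \<gamma> t' \<in> W (\<gamma> t) \<and> inv (a t) \<otimes> a t' = \<theta> (\<gamma> t) (\<gamma> t')"
    using assms(1) t unfolding lift_def by blast
  obtain V where V: "open V" "t \<in> V"
    "\<forall>t'\<in>V \<inter> D. \<gamma> t' \<in> W (\<gamma> t) \<and> inv (b t) \<otimes> b t' = \<theta> (\<gamma> t) (\<gamma> t')"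
    using assms(2) t unfolding lift_def by blast
  have ab: "a t \<in> carrier G" "b t \<in> carrier G" "\<gamma> t \<in> topspace X"
    using lift_closed[OF assms(1) t] lift_closed[OF assms(2) t] lift_topspace[OF assms(1) t] by auto
  have "a t \<otimes> inv (b t) = a t' \<otimes> inv (b t')" if "t' \<in> U" "t' \<in> V" "t' \<in> D" for t'
  proof -
    have c: "a t' \<in> carrier G" "b t' \<in> carrier G"
      using lift_closed[OF assms(1)] lift_closed[OF assms(2)] that by auto
    have "inv (a t) \<otimes> a t' = inv (b t) \<otimes> b t'"
      using U(3) V(3) that by simp
    then have "a t' = a t \<otimes> (inv (b t) \<otimes> b t')"
      using ab c inv_solve_left[of "inv (b t) \<otimes> b t'" "a t" "a t'"] by simp
    then have "a t' \<otimes> inv (b t') = a t \<otimes> inv (b t)"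
      using ab c by (simp add: m_assoc)
    then show ?thesis by simp
  qed
  then show "\<forall>\<^sub>F t' in at t within D. a t \<otimes> inv (b t) = a t' \<otimes> inv (b t')"
    unfolding eventually_at_topological using U(1,2) V(1,2)
    by (intro exI[of _ "U \<inter> V"]) auto
qed

lemma lift_scale:
  assumes "lift D \<gamma> a" "c \<in> carrier G"
  shows "lift D \<gamma> (\<lambda>t. c \<otimes> a t)"
  unfolding lift_def
proof (intro ballI conjI)
  fix t assume t: "t \<in> D"
  then show "\<gamma> t \<in> topspace X" "c \<otimes> a t \<in> carrier G" using assms by (auto intro: lift_closed lift_topspace)
  obtain U where U: "open U" "t \<in> U"
    "\<forall>t'\<in>U \<inter> D. \<gamma> t' \<in> W (\<gamma> t) \<and> inv (a t) \<otimes> a t' = \<theta> (\<gamma> t) (\<gamma> t')"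
    using assms(1) t unfolding lift_def by blast
  have "inv (c \<otimes> a t) \<otimes> (c \<otimes> a t') = inv (a t) \<otimes> a t'" if "t' \<in> D" for t'
  proof -
    have "a t \<in> carrier G" "a t' \<in> carrier G" using lift_closed[OF assms(1)] t that by auto
    then show ?thesis using assms(2) by (simp add: inv_mult_group m_assoc flip: m_assoc[of "inv c" c])
  qed
  then show "\<exists>U. open U \<and> t \<in> U \<and>
      (\<forall>t'\<in>U \<inter> D. \<gamma> t' \<in> W (\<gamma> t) \<and> inv (c \<otimes> a t) \<otimes> (c \<otimes> a t') = \<theta> (\<gamma> t) (\<gamma> t'))"
    using U by (intro exI[of _ U]) auto
qed

lemma lift_subset:
  assumes "lift D \<gamma> a" "D' \<subseteq> D"
  shows "lift D' \<gamma> a"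
  unfolding lift_def
proof (intro ballI conjI)
  fix t assume "t \<in> D'"
  then have t: "t \<in> D" using assms(2) by auto
  show "\<gamma> t \<in> topspace X" "a t \<in> carrier G"
    using assms(1) t by (auto intro: lift_closed lift_topspace)
  obtain U where "open U" "t \<in> U"
    "\<forall>t'\<in>U \<inter> D. \<gamma> t' \<in> W (\<gamma> t) \<and> inv (a t) \<otimes> a t' = \<theta> (\<gamma> t) (\<gamma> t')"
    using assms(1) t unfolding lift_def by blast
  then show "\<exists>U. open U \<and> t \<in> U \<and>
      (\<forall>t'\<in>U \<inter> D'. \<gamma> t' \<in> W (\<gamma> t) \<and> inv (a t) \<otimes> a t' = \<theta> (\<gamma> t) (\<gamma> t'))"
    using assms(2) by (intro exI[of _ U]) auto
qed

lemma lift_cong: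
  assumes "lift D \<gamma> a" "\<And>t. t \<in> D \<Longrightarrow> \<gamma>' t = \<gamma> t"
  shows "lift D \<gamma>' a"
  unfolding lift_def
proof (intro ballI conjI)
  fix t assume t: "t \<in> D"
  then show "\<gamma>' t \<in> topspace X" "a t \<in> carrier G" using assms by (auto intro: lift_closed lift_topspace)
  obtain U where "open U" "t \<in> U"
    "\<forall>t'\<in>U \<inter> D. \<gamma> t' \<in> W (\<gamma> t) \<and> inv (a t) \<otimes> a t' = \<theta> (\<gamma> t) (\<gamma> t')"
    using assms(1) t unfolding lift_def by blast
  then show "\<exists>U. open U \<and> t \<in> U \<and> (\<forall>t'\<in>U \<inter> D. \<gamma>' t' \<in> W (\<gamma>' t) \<and> inv (a t) \<otimes> a t' = \<theta> (\<gamma>' t) (\<gamma>' t'))"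
    using assms(2) t by (intro exI[of _ U]) simp
qed

lemma lift_compose:
  assumes "lift D \<gamma> a" "continuous_on D' \<phi>" "\<phi> ` D' \<subseteq> D"
  shows "lift D' (\<lambda>t. \<gamma> (\<phi> t)) (\<lambda>t. a (\<phi> t))"
  unfolding lift_def
proof (intro ballI conjI)
  fix t assume t: "t \<in> D'"
  then have t': "\<phi> t \<in> D" using assms(3) by auto
  then show "\<gamma> (\<phi> t) \<in> topspace X" "a (\<phi> t) \<in> carrier G" using assms(1) by (auto intro: lift_closed lift_topspace)
  obtain U where U: "open U" "\<phi> t \<in> U"
    "\<forall>t'\<in>U \<inter> D. \<gamma> t' \<in> W (\<gamma> (\<phi> t)) \<and> inv (a (\<phi> t)) \<otimes> a t' = \<theta> (\<gamma> (\<phi> t)) (\<gamma> t')"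
    using assms(1) t' unfolding lift_def by blast
  obtain V where V: "open V" "t \<in> V" "\<forall>y\<in>D'. y \<in> V \<longrightarrow> \<phi> y \<in> U"
    using assms(2) U(1,2) t unfolding continuous_on_topological by metis
  have "\<gamma> (\<phi> s) \<in> W (\<gamma> (\<phi> t)) \<and> inv (a (\<phi> t)) \<otimes> a (\<phi> s) = \<theta> (\<gamma> (\<phi> t)) (\<gamma> (\<phi> s))"
    if "s \<in> V" "s \<in> D'" for s
    using U(3) V(3) that assms(3) by blast
  then show "\<exists>U. open U \<and> t \<in> U \<and> (\<forall>t'\<in>U \<inter> D'. \<gamma> (\<phi> t') \<in> W (\<gamma> (\<phi> t)) \<and>
      inv (a (\<phi> t)) \<otimes> a (\<phi> t') = \<theta> (\<gamma> (\<phi> t)) (\<gamma> (\<phi> t')))"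
    using V by blast
qed

lemma lift_local:
  assumes \<gamma>: "continuous_map (top_of_set D) X \<gamma>" and t0: "t0 \<in> D"
  obtains U where "open U" "t0 \<in> U" "lift (D \<inter> U) \<gamma> (\<lambda>t. \<theta> (\<gamma> t0) (\<gamma> t))"
proof -
  have top: "\<gamma> t \<in> topspace X" if "t \<in> D" for t using \<gamma> that by (auto simp: continuous_map)
  have "\<exists>U. open U \<and> {s \<in> D. \<gamma> s \<in> W (\<gamma> t)} = D \<inter> U" if "t \<in> D" for t
    using openin_continuous_map_preimage[OF \<gamma> open_W[OF top[OF that]]]
    by (auto simp: openin_open)
  then obtain U where U: "\<And>t. t \<in> D \<Longrightarrow> open (U t)"
      "\<And>t. t \<in> D \<Longrightarrow> {s \<in> D. \<gamma> s \<in> W (\<gamma> t)} = D \<inter> U t" by metis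
  have UW: "\<gamma> s \<in> W (\<gamma> t)" if "t \<in> D" "s \<in> D" "s \<in> U t" for s t using U(2) that by blast
  have self: "t \<in> U t" if "t \<in> D" for t using U(2)[OF that] in_W[OF top[OF that]] that by blast
  have "lift (D \<inter> U t0) \<gamma> (\<lambda>t. \<theta> (\<gamma> t0) (\<gamma> t))"
    unfolding lift_def
  proof (intro ballI conjI)
    fix t assume "t \<in> D \<inter> U t0"
    then have t: "t \<in> D" "t \<in> U t0" by auto
    show "\<gamma> t \<in> topspace X" by (rule top[OF t(1)])
    show "\<theta> (\<gamma> t0) (\<gamma> t) \<in> carrier G"
      by (rule theta_closed[OF top[OF t0] UW[OF t0 t]])
    have "\<gamma> t' \<in> W (\<gamma> t) \<and> inv (\<theta> (\<gamma> t0) (\<gamma> t)) \<otimes> \<theta> (\<gamma> t0) (\<gamma> t') = \<theta> (\<gamma> t) (\<gamma> t')"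
      if t': "t' \<in> U t \<inter> (D \<inter> U t0)" for t'
    proof -
      have W: "\<gamma> t' \<in> W (\<gamma> t)" "\<gamma> t' \<in> W (\<gamma> t0)" using t' UW t(1) t0 by auto
      have "\<theta> (\<gamma> t0) (\<gamma> t) \<otimes> \<theta> (\<gamma> t) (\<gamma> t') = \<theta> (\<gamma> t0) (\<gamma> t')"
        by (rule theta_cocycle[OF top[OF t0] UW[OF t0 t] W(2,1)])
      then show ?thesis
        using W theta_closed[OF top[OF t0] UW[OF t0 t]] theta_closed[OF top[OF t(1)] W(1)]
          theta_closed[OF top[OF t0] W(2)] inv_solve_left[of "\<theta> (\<gamma> t) (\<gamma> t')" "\<theta> (\<gamma> t0) (\<gamma> t)" "\<theta> (\<gamma> t0) (\<gamma> t')"] by simp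
    qed
    then show "\<exists>V. open V \<and> t \<in> V \<and> (\<forall>t'\<in>V \<inter> (D \<inter> U t0). \<gamma> t' \<in> W (\<gamma> t) \<and>
          inv (\<theta> (\<gamma> t0) (\<gamma> t)) \<otimes> \<theta> (\<gamma> t0) (\<gamma> t') = \<theta> (\<gamma> t) (\<gamma> t'))"
      using U(1)[OF t(1)] self[OF t(1)] by blast
  qed
  then show thesis using that U(1) self t0 by blast
qed

lemma lift_Un:
  assumes "closed D1" "closed D2" "lift D1 \<gamma> a1" "lift D2 \<gamma> a2" "\<And>t. t \<in> D1 \<inter> D2 \<Longrightarrow> a1 t = a2 t"
  shows "lift (D1 \<union> D2) \<gamma> (\<lambda>t. if t \<in> D1 then a1 t else a2 t)"
proof -
  let ?a = "\<lambda>t. if t \<in> D1 then a1 t else a2 t"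
  \<comment> \<open>Near \<open>t\<close> only the pieces containing \<open>t\<close> matter, because the other piece is closed.\<close>
  have loc: "\<exists>U. open U \<and> t \<in> U \<and> (\<forall>t'\<in>U \<inter> C. \<gamma> t' \<in> W (\<gamma> t) \<and> inv (?a t) \<otimes> ?a t' = \<theta> (\<gamma> t) (\<gamma> t'))"
    if "C = D1 \<and> b = a1 \<or> C = D2 \<and> b = a2" "t \<in> D1 \<union> D2" for t C b
  proof (cases "t \<in> C")
    case True
    have "lift C \<gamma> b" using that assms(3,4) by auto
    then obtain U where "open U" "t \<in> U"
      "\<forall>t'\<in>U \<inter> C. \<gamma> t' \<in> W (\<gamma> t) \<and> inv (b t) \<otimes> b t' = \<theta> (\<gamma> t) (\<gamma> t')"
      using True unfolding lift_def by blast
    moreover have "?a s = b s" if "s \<in> C" for s using that \<open>C = D1 \<and> b = a1 \<or> C = D2 \<and> b = a2\<close> assms(5)[of s] by auto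
    ultimately show ?thesis using True by (intro exI[of _ U]) auto
  next
    case False
    then show ?thesis using that assms(1,2) by (intro exI[of _ "- C"]) (auto simp: open_Compl)
  qed
  show ?thesis
    unfolding lift_def
  proof (intro ballI conjI)
    fix t assume t: "t \<in> D1 \<union> D2"
    then show "\<gamma> t \<in> topspace X" "?a t \<in> carrier G"
      using assms(3,4) by (auto intro: lift_closed lift_topspace)
    obtain U where U: "open U" "t \<in> U" "\<forall>t'\<in>U \<inter> D1. \<gamma> t' \<in> W (\<gamma> t) \<and> inv (?a t) \<otimes> ?a t' = \<theta> (\<gamma> t) (\<gamma> t')"
      using loc[of D1 a1 t, OF disjI1[OF conjI[OF refl refl]] t] by (elim exE conjE)
    obtain V where V: "open V" "t \<in> V" "\<forall>t'\<in>V \<inter> D2. \<gamma> t' \<in> W (\<gamma> t) \<and> inv (?a t) \<otimes> ?a t' = \<theta> (\<gamma> t) (\<gamma> t')"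
      using loc[of D2 a2 t, OF disjI2[OF conjI[OF refl refl]] t] by (elim exE conjE)
    have "\<forall>t'\<in>(U \<inter> V) \<inter> (D1 \<union> D2). \<gamma> t' \<in> W (\<gamma> t) \<and> inv (?a t) \<otimes> ?a t' = \<theta> (\<gamma> t) (\<gamma> t')"
    proof
      fix t' assume t': "t' \<in> U \<inter> V \<inter> (D1 \<union> D2)"
      show "\<gamma> t' \<in> W (\<gamma> t) \<and> inv (?a t) \<otimes> ?a t' = \<theta> (\<gamma> t) (\<gamma> t')"
      proof (cases "t' \<in> D1")
        case True
        then show ?thesis using t' bspec[OF U(3), of t'] by blast
      next
        case False
        then show ?thesis using t' bspec[OF V(3), of t'] by blast
      qed
    qed
    with U(1,2) V(1,2) show "\<exists>U. open U \<and> t \<in> U \<and> (\<forall>t'\<in>U \<inter> (D1 \<union> D2). \<gamma> t' \<in> W (\<gamma> t) \<and> inv (?a t) \<otimes> ?a t' = \<theta> (\<gamma> t) (\<gamma> t'))"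
      by (intro exI[of _ "U \<inter> V"] conjI open_Int IntI)
  qed
qed

text \<open>Lifts on two closed pieces with connected intersection differ there by a constant, so one of them can
  be translated to match the other.\<close>

lemma lift_glue:
  assumes "closed D1" "closed D2" "connected (D1 \<inter> D2)" "lift D1 \<gamma> a1" "lift D2 \<gamma> a2"
  shows "\<exists>a. lift (D1 \<union> D2) \<gamma> a"
proof (cases "D1 \<inter> D2 = {}")
  case True
  then show ?thesis using lift_Un[OF assms(1,2,4,5)] by blast
next
  case False
  then obtain p where p: "p \<in> D1 \<inter> D2" by blast
  define c where "c = a1 p \<otimes> inv (a2 p)"
  have car: "a1 t \<in> carrier G" "a2 t \<in> carrier G" if "t \<in> D1 \<inter> D2" for t
    using assms(4,5) that by (auto intro: lift_closed lift_topspace)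
  have c: "c \<in> carrier G" using car[OF p] by (simp add: c_def)
  have "a1 t = c \<otimes> a2 t" if t: "t \<in> D1 \<inter> D2" for t
  proof -
    have "a1 t \<otimes> inv (a2 t) = c"
      unfolding c_def
      by (rule lift_unique[OF lift_subset[OF assms(4)] lift_subset[OF assms(5)] assms(3) t p]) auto
    then show ?thesis using car[OF t] c inv_solve_right[of c "a1 t" "a2 t"] by simp
  qed
  then show ?thesis using lift_Un[OF assms(1,2,4) lift_scale[OF assms(5) c]] by blast
qed

text \<open>Lifts exist locally, and they are glued by bisection: first along a thin column, then column by column.
  On the unit square this yields both the lifting of paths and the homotopy invariance of monodromy.\<close>

lemma lift_exists_square:
  assumes \<gamma>: "continuous_map (top_of_set ({0..1::real} \<times> {0..1::real})) X \<gamma>"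
  shows "\<exists>a. lift ({0..1::real} \<times> {0..1::real}) \<gamma> a"
proof -
  define box where "box s d b c = ({0..1} \<inter> {s - d..s + d}) \<times> ({0..1} \<inter> {b..c})" for s d b c :: real
  have closed_box: "closed (box s d b c)" for s d b c by (auto simp: box_def intro!: closed_Times)
  have conn: "connected ((A \<inter> B) \<times> (C \<inter> E))" if "convex A" "convex B" "convex C" "convex E" for A B C E :: "real set"
    using that by (intro convex_connected convex_Times convex_Int)
  have column: "\<exists>d>0. \<exists>a. lift (box s d 0 1) \<gamma> a" if s: "s \<in> {0..1}" for s
  proof -
    show ?thesis
    proof (rule Bolzano[where P = "\<lambda>b c. \<exists>d>0. \<exists>a. lift (box s d b c) \<gamma> a", OF zero_le_one])
      fix a b c :: real
      assume trans: "\<exists>d>0. \<exists>l. lift (box s d a b) \<gamma> l" "\<exists>d>0. \<exists>l. lift (box s d b c) \<gamma> l" "a \<le> b" "b \<le> c"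
      then obtain d1 d2 l1 l2 where l: "d1 > 0" "d2 > 0" "lift (box s d1 a b) \<gamma> l1" "lift (box s d2 b c) \<gamma> l2"
        by blast
      let ?d = "min d1 d2"
      have "lift (box s ?d a b) \<gamma> l1" "lift (box s ?d b c) \<gamma> l2"
        by (auto intro!: lift_subset[OF l(3)] lift_subset[OF l(4)] simp: box_def)
      moreover have "box s ?d a b \<inter> box s ?d b c = ({0..1} \<inter> {s - ?d..s + ?d}) \<times> ({0..1} \<inter> {b})"
        using trans by (auto simp: box_def)
      moreover have "connected (({0..1} \<inter> {s - ?d..s + ?d}) \<times> ({0..1} \<inter> {b}))"
        by (rule conn) auto
      moreover have "box s ?d a b \<union> box s ?d b c = box s ?d a c"
        using trans by (auto simp: box_def)
      ultimately show "\<exists>d>0. \<exists>l. lift (box s d a c) \<gamma> l"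
        using lift_glue[OF closed_box closed_box, of s ?d a b s ?d b c] l(1,2)
        by (intro exI[of _ ?d]) auto
    next
      fix t :: real assume local: "0 \<le> t" "t \<le> 1"
      then have "(s, t) \<in> {0..1} \<times> {0..1}" using s by auto
      from lift_local[OF \<gamma> this] obtain U where U: "open U" "(s, t) \<in> U"
        "lift (({0..1} \<times> {0..1}) \<inter> U) \<gamma> (\<lambda>t'. \<theta> (\<gamma> (s, t)) (\<gamma> t'))" by blast
      obtain A B where AB: "open A" "open B" "s \<in> A" "t \<in> B" "A \<times> B \<subseteq> U"
        using open_prod_elim[OF U(1,2)] by (metis mem_Sigma_iff)
      obtain e1 where e1: "e1 > 0" "cball s e1 \<subseteq> A" using AB open_contains_cball by blast
      obtain e2 where e2: "e2 > 0" "cball t e2 \<subseteq> B" using AB open_contains_cball by blast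
      have "lift (box s e1 a b) \<gamma> (\<lambda>t'. \<theta> (\<gamma> (s, t)) (\<gamma> t'))" if "a \<le> t" "t \<le> b" "b - a < e2" for a b
      proof (rule lift_subset[OF U(3)])
        have "x \<in> A \<and> y \<in> B" if "(x, y) \<in> box s e1 a b" for x y
          using that \<open>a \<le> t\<close> \<open>t \<le> b\<close> \<open>b - a < e2\<close> e1(2) e2(2)
          by (auto simp: box_def subset_eq dist_real_def abs_if)
        then show "box s e1 a b \<subseteq> {0..1} \<times> {0..1} \<inter> U" using AB(5) by (auto simp: box_def)
      qed
      then show "\<exists>d>0. \<forall>a b. a \<le> t \<and> t \<le> b \<and> b - a < d \<longrightarrow> (\<exists>d>0. \<exists>l. lift (box s d a b) \<gamma> l)"
        using e1(1) e2(1) by blast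
    qed
  qed
  have "\<exists>a. lift (({0..1} \<inter> {0..1}) \<times> {0..1}) \<gamma> a"
  proof (rule Bolzano[where P = "\<lambda>b c. \<exists>a. lift (({0..1} \<inter> {b..c}) \<times> {0..1}) \<gamma> a", OF zero_le_one])
    fix a b c :: real
    assume trans: "\<exists>l. lift (({0..1} \<inter> {a..b}) \<times> {0..1}) \<gamma> l"
      "\<exists>l. lift (({0..1} \<inter> {b..c}) \<times> {0..1}) \<gamma> l" "a \<le> b" "b \<le> c"
    then obtain l1 l2 where l: "lift (({0..1} \<inter> {a..b}) \<times> {0..1}) \<gamma> l1"
        "lift (({0..1} \<inter> {b..c}) \<times> {0..1}) \<gamma> l2" by blast
    have "({0..1} \<inter> {a..b}) \<times> {0..1} \<inter> ({0..1} \<inter> {b..c}) \<times> {0..1} = ({0..1} \<inter> {b}) \<times> ({0..1} \<inter> {0..1::real})"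
      using trans by auto
    then have "connected (({0..1} \<inter> {a..b}) \<times> {0..1::real} \<inter> ({0..1} \<inter> {b..c}) \<times> {0..1})"
      using conn[of "{0..1}" "{b}" "{0..1}" "{0..1}"] by auto
    moreover have "({0..1} \<inter> {a..b}) \<times> {0..1} \<union> ({0..1} \<inter> {b..c}) \<times> {0..1} = ({0..1} \<inter> {a..c}) \<times> {0..1::real}"
      using trans by auto
    ultimately show "\<exists>l. lift (({0..1} \<inter> {a..c}) \<times> {0..1}) \<gamma> l"
      using lift_glue[OF _ _ _ l] by (auto simp: closed_Times)
  next
    fix s :: real assume local: "0 \<le> s" "s \<le> 1"
    then obtain d a where d: "d > 0" "lift (box s d 0 1) \<gamma> a" using column[of s] by auto
    have "lift (({0..1} \<inter> {b..c}) \<times> {0..1}) \<gamma> a" if "b \<le> s" "s \<le> c" "c - b < d" for b c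
      by (rule lift_subset[OF d(2)]) (use that in \<open>auto simp: box_def\<close>)
    then show "\<exists>d>0. \<forall>b c. b \<le> s \<and> s \<le> c \<and> c - b < d \<longrightarrow> (\<exists>l. lift (({0..1} \<inter> {b..c}) \<times> {0..1}) \<gamma> l)"
      using d(1) by blast
  qed
  then show ?thesis by simp
qed

lemma lift_exists_path:
  assumes "pathin X \<gamma>"
  shows "\<exists>a. lift {0..1} \<gamma> a"
proof -
  have "continuous_map (top_of_set ({0..1::real} \<times> {0..1::real})) X (\<gamma> \<circ> snd)"
    by (rule continuous_map_compose[OF _ assms[unfolded pathin_def]]) (auto intro!: continuous_intros)
  from lift_exists_square[OF this] obtain a where *: "lift ({0..1::real} \<times> {0..1::real}) (\<lambda>p. \<gamma> (snd p)) a"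
    by (auto simp: o_def)
  have "lift {0..1} (\<lambda>t. \<gamma> (snd (0::real, t))) (\<lambda>t. a (0, t))"
    by (rule lift_compose[OF *]) (auto intro!: continuous_intros)
  then show ?thesis by auto
qed

definition monodromy :: "(real \<Rightarrow> 'x) \<Rightarrow> 'a" where
  "monodromy \<gamma> = (THE g. \<exists>a. lift {0..1} \<gamma> a \<and> g = inv (a 0) \<otimes> a 1)"

lemma monodromy_eq:
  assumes "lift {0..1} \<gamma> a"
  shows "monodromy \<gamma> = inv (a 0) \<otimes> a 1"
  unfolding monodromy_def
proof (rule the_equality)
  show "\<exists>b. lift {0..1} \<gamma> b \<and> inv (a 0) \<otimes> a 1 = inv (b 0) \<otimes> b 1" using assms by blast
  fix g assume "\<exists>b. lift {0..1} \<gamma> b \<and> g = inv (b 0) \<otimes> b 1"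
  then obtain b where b: "lift {0..1} \<gamma> b" "g = inv (b 0) \<otimes> b 1" by blast
  have car: "a 0 \<in> carrier G" "b 0 \<in> carrier G" "a 1 \<in> carrier G" "b 1 \<in> carrier G"
    using assms b(1) by (auto intro: lift_closed lift_topspace)
  have eq: "a 0 \<otimes> inv (b 0) = a 1 \<otimes> inv (b 1)"
    by (rule lift_unique[OF assms b(1)]) auto
  have "a 1 = a 0 \<otimes> inv (b 0) \<otimes> b 1"
    using eq car inv_solve_right[of "a 0 \<otimes> inv (b 0)" "a 1" "b 1"] by simp
  then show "g = inv (a 0) \<otimes> a 1"
    using car b(2) by (simp add: m_assoc[symmetric])
qed

lemma monodromy_closed: "pathin X \<gamma> \<Longrightarrow> monodromy \<gamma> \<in> carrier G"
proof -
  assume "pathin X \<gamma>"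
  then obtain a where a: "lift {0..1} \<gamma> a" using lift_exists_path by blast
  show ?thesis
    unfolding monodromy_eq[OF a] using lift_closed[OF a, of 0] lift_closed[OF a, of 1] by simp
qed

lemma monodromy_concat:
  assumes "pathin X f" "pathin X g" "f 1 = g 0"
  shows "monodromy (concat_loop f g) = monodromy f \<otimes> monodromy g"
proof -
  obtain a where a: "lift {0..1} (concat_loop f g) a"
    using lift_exists_path[OF pathin_concat[OF assms]] by blast
  have car: "a 0 \<in> carrier G" "a (1/2) \<in> carrier G" "a 1 \<in> carrier G" using a by (auto intro: lift_closed lift_topspace)
  have cancel: "a (1/2) \<otimes> (inv (a (1/2)) \<otimes> a 1) = a 1"
    using car by (simp flip: m_assoc)
  have "lift {0..1} (\<lambda>t. concat_loop f g (t / 2)) (\<lambda>t. a (t / 2))"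
    by (rule lift_compose[OF a]) (auto intro!: continuous_intros)
  then have f: "lift {0..1} f (\<lambda>t. a (t / 2))"
    by (rule lift_cong) (simp add: concat_loop_def)
  have "lift {0..1} (\<lambda>t. concat_loop f g ((t + 1) / 2)) (\<lambda>t. a ((t + 1) / 2))"
    by (rule lift_compose[OF a]) (auto intro!: continuous_intros)
  moreover have "g t = concat_loop f g ((t + 1) / 2)" if "t \<in> {0..1}" for t
  proof -
    have "2 * ((t + 1) / 2) - 1 = t" by (simp add: field_simps)
    then show ?thesis using assms(3) that by (cases "t = 0") (simp_all add: concat_loop_def)
  qed
  ultimately have g: "lift {0..1} g (\<lambda>t. a ((t + 1) / 2))"
    by (rule lift_cong)
  show ?thesis
    using car cancel by (simp add: monodromy_eq[OF a] monodromy_eq[OF f] monodromy_eq[OF g] m_assoc)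
qed

text \<open>A lift over the homotopy restricts to lifts of both paths, and it is constant along the two sides where
  the homotopy does not move.\<close>

lemma monodromy_homotopic:
  assumes "path_homotopic X f g"
  shows "monodromy f = monodromy g"
proof -
  obtain h where h: "continuous_map (top_of_set ({0..1::real} \<times> {0..1::real})) X h"
        "\<And>t. t\<in>{0..1} \<Longrightarrow> h (0, t) = f t" "\<And>t. t\<in>{0..1} \<Longrightarrow> h (1, t) = g t"
        "\<And>s. s\<in>{0..1} \<Longrightarrow> h (s, 0) = f 0 \<and> h (s, 1) = f 1"
    using assms unfolding path_homotopic_iff by blast
  obtain a where a: "lift ({0..1} \<times> {0..1}) h a" using lift_exists_square[OF h(1)] by blast
  have car: "a (0, 0) \<in> carrier G" using a by (auto intro: lift_closed lift_topspace)
  have f: "lift {0..1} f (\<lambda>t. a (0, t))"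
    by (rule lift_cong[OF lift_compose[OF a]]) (auto simp: h(2) intro!: continuous_intros)
  have g: "lift {0..1} g (\<lambda>t. a (1, t))"
    by (rule lift_cong[OF lift_compose[OF a]]) (auto simp: h(3) intro!: continuous_intros)
  have "a (0, t) = a (1, t)" if t: "t = 0 \<or> t = 1" for t
  proof -
    obtain p where p: "\<And>s. s \<in> {0..1} \<Longrightarrow> h (s, t) = p" "p \<in> topspace X"
      using h(4) t path_homotopic_ends[OF assms]
      by (metis path_finish_in_topspace path_start_in_topspace)
    have "\<theta> p p \<otimes> \<theta> p p = \<theta> p p" using p in_W theta_cocycle by auto
    then have one: "\<theta> p p = \<one>" using p in_W theta_closed by auto
    have "lift {0..1} (\<lambda>s. h (s, t)) (\<lambda>s. a (s, t))"
      by (rule lift_compose[OF a]) (use t in \<open>auto intro!: continuous_intros\<close>)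
    then have 1: "lift {0..1} (\<lambda>s. p) (\<lambda>s. a (s, t))"
      by (rule lift_cong) (simp add: p)
    have 2: "lift {0..1::real} (\<lambda>s. p) (\<lambda>s. \<one>)"
      using one p in_W by (auto simp: lift_def intro: exI[of _ UNIV])
    show ?thesis
      using lift_unique[OF 1 2, of 0 1] lift_closed[OF 1, of 0] lift_closed[OF 1, of 1] by simp
  qed
  then show ?thesis by (simp add: monodromy_eq[OF f] monodromy_eq[OF g])
qed

lemma monodromy_const: "p \<in> topspace X \<Longrightarrow> monodromy (\<lambda>_. p) = \<one>"
  using monodromy_concat[of "\<lambda>_. p" "\<lambda>_. p"] monodromy_closed[of "\<lambda>_. p"]
  by (auto simp: concat_loop_def)

lemma monodromy_reverse:
  assumes "pathin X f"
  shows "monodromy (reverse_path f) = inv (monodromy f)"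
proof -
  have "f 0 \<in> topspace X" using assms path_start_in_topspace by blast
  then have "monodromy (reverse_path f) \<otimes> monodromy f = \<one>"
    using monodromy_homotopic[OF concat_reverse'[OF assms refl]] monodromy_const[of "f 1"]
      path_finish_in_topspace[OF assms] monodromy_concat[OF pathin_reverse[OF assms] assms] by simp
  then show ?thesis
    by (metis assms inv_equality monodromy_closed pathin_reverse)
qed

definition monodromy_hom :: "'x \<Rightarrow> (real \<Rightarrow> 'x) set \<Rightarrow> 'a" where
  "monodromy_hom p A = monodromy (SOME f. f \<in> loops_at X p \<and> A = loop_class X p f)"

lemma monodromy_hom_class:
  assumes "f \<in> loops_at X p"
  shows "monodromy_hom p (loop_class X p f) = monodromy f"
proof -
  let ?g = "SOME g. g \<in> loops_at X p \<and> loop_class X p f = loop_class X p g"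
  have g: "?g \<in> loops_at X p \<and> loop_class X p f = loop_class X p ?g"
    by (rule someI[of _ f]) (use assms in auto)
  have "path_homotopic X f ?g"
    using loop_class_eq_iff[OF assms, of ?g] g by simp
  from monodromy_homotopic[OF this] show ?thesis
    by (simp add: monodromy_hom_def)
qed

lemma monodromy_hom: "monodromy_hom p \<in> hom (fundamental_group X p) G"
proof (rule homI)
  fix A assume "A \<in> carrier (fundamental_group X p)"
  then obtain f where f: "f \<in> loops_at X p" "A = loop_class X p f" by (auto simp: carrier_fundamental_group)
  then show "monodromy_hom p A \<in> carrier G"
    using monodromy_closed[of f] by (simp add: monodromy_hom_class) (simp add: loops_at_def)
  fix B assume "B \<in> carrier (fundamental_group X p)"
  then obtain g where g: "g \<in> loops_at X p" "B = loop_class X p g" by (auto simp: carrier_fundamental_group)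
  have "monodromy (concat_loop f g) = monodromy f \<otimes> monodromy g"
    by (rule monodromy_concat) (use f g in \<open>auto simp: loops_at_def\<close>)
  then show "monodromy_hom p (A \<otimes>\<^bsub>fundamental_group X p\<^esub> B) = monodromy_hom p A \<otimes> monodromy_hom p B"
    using f g by (simp add: mult_fundamental_group monodromy_hom_class concat_in_loops_at)
qed

end

section \<open>The unordered configuration space of a graph\<close>

definition realize_points :: "'v sgraph \<Rightarrow> ('v \<Rightarrow> real) set" where
  "realize_points G = (\<Union>\<sigma>\<in>graph_cells G. realize_cell \<sigma>)"

definition ordered_pairs :: "'v sgraph \<Rightarrow> (('v \<Rightarrow> real) \<times> ('v \<Rightarrow> real)) set" where
  "ordered_pairs G = {(x, y). x \<in> realize_points G \<and> y \<in> realize_points G \<and> x \<noteq> y}"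

abbreviation UC :: "'v sgraph \<Rightarrow> ('v \<Rightarrow> real) set topology" where
  "UC G \<equiv> unordered_config2 (realize_graph G)"

lemma UC_eq: "UC G = quotient_topology (top_of_set (ordered_pairs G)) (\<lambda>(x, y). {x, y})"
proof -
  have "subtopology (prod_topology (realize_graph G) (realize_graph G)) {(x, y). x \<noteq> y}
      = top_of_set (ordered_pairs G)"
    unfolding realize_graph_def realize_points_def[symmetric]
    by (auto simp: prod_topology_subtopology_eu subtopology_subtopology ordered_pairs_def
        intro!: arg_cong[of _ _ top_of_set])
  then show ?thesis by (simp add: unordered_config2_def)
qed

lemma quotient_map_UC: "quotient_map (top_of_set (ordered_pairs G)) (UC G) (\<lambda>(x, y). {x, y})"
  unfolding UC_eq by (rule quotient_map_quotient_topology)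

lemma topspace_UC: "topspace (UC G) = (\<lambda>(x, y). {x, y}) ` ordered_pairs G"
  using quotient_imp_surjective_map[OF quotient_map_UC] by (metis topspace_euclidean_subtopology)

lemma in_topspace_UC:
  "{x, y} \<in> topspace (UC G) \<longleftrightarrow> x \<in> realize_points G \<and> y \<in> realize_points G \<and> x \<noteq> y"
  unfolding topspace_UC ordered_pairs_def by (auto simp: doubleton_eq_iff image_iff)

lemma topspace_UC_cases:
  assumes "z \<in> topspace (UC G)"
  obtains x y where "z = {x, y}" "x \<in> realize_points G" "y \<in> realize_points G" "x \<noteq> y"
  using assms unfolding topspace_UC ordered_pairs_def by auto

lemma continuous_map_into_UC:
  assumes "\<And>v. continuous_on D (\<lambda>t. x t v)" "\<And>v. continuous_on D (\<lambda>t. y t v)"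
    and "\<And>t. t \<in> D \<Longrightarrow> {x t, y t} \<in> topspace (UC G)"
  shows "continuous_map (top_of_set D) (UC G) (\<lambda>t. {x t, y t})"
proof -
  have "continuous_map (top_of_set D) (top_of_set (ordered_pairs G)) (\<lambda>t. (x t, y t))"
    using assms
    by (auto simp: in_topspace_UC ordered_pairs_def intro!: continuous_on_Pair continuous_on_coordinatewise_then_product)
  from continuous_map_compose[OF this quotient_imp_continuous_map[OF quotient_map_UC]]
  show ?thesis by (simp add: o_def)
qed

lemma openin_UC:
  "openin (UC G) S \<longleftrightarrow> S \<subseteq> topspace (UC G) \<and>
     (\<exists>T. open T \<and> {(x, y) \<in> ordered_pairs G. {x, y} \<in> S} = ordered_pairs G \<inter> T)"
proof -
  have "{p \<in> ordered_pairs G. (case p of (x, y) \<Rightarrow> {x, y}) \<in> S} = {(x, y) \<in> ordered_pairs G. {x, y} \<in> S}"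
    by auto
  then show ?thesis
    unfolding topspace_UC unfolding UC_eq openin_quotient_topology by (simp add: openin_open)
qed

lemma continuous_on_fst_coord: "continuous_on UNIV (\<lambda>p :: ('v \<Rightarrow> real) \<times> ('v \<Rightarrow> real). fst p v)"
  by (rule continuous_on_product_then_coordinatewise) (intro continuous_intros)

lemma continuous_on_snd_coord: "continuous_on UNIV (\<lambda>p :: ('v \<Rightarrow> real) \<times> ('v \<Rightarrow> real). snd p v)"
  by (rule continuous_on_product_then_coordinatewise) (intro continuous_intros)

text \<open>For points of disjoint simplices this is the support of \<open>x\<close>. For a general pair of distinct points of the
  graph, which may lie on a common edge, it still picks a face of the simplex of \<open>x\<close>, and the faces picked
  by \<open>(x, y)\<close> and \<open>(y, x)\<close> are disjoint.\<close>

definition pos :: "('v \<Rightarrow> real) \<Rightarrow> ('v \<Rightarrow> real) \<Rightarrow> 'v set" where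
  "pos x y = {v. y v < x v}"

lemma ex_doubleton_iff: "(\<exists>x y. {a, b} = {x, y} \<and> P x y) \<longleftrightarrow> P a b \<or> P b a"
  by (auto simp: doubleton_eq_iff)

text \<open>A strict inequality between coordinates is an open condition, so the neighbourhoods that are defined below by
  the growth of \<open>pos\<close> are open.\<close>

lemma openin_UC_pos:
  assumes "finite A" "finite B"
  shows "openin (UC G) {z \<in> topspace (UC G). \<exists>x y. z = {x, y} \<and> A \<subseteq> pos x y \<and> B \<subseteq> pos y x}"
    (is "openin _ ?S")
proof -
  let ?T = "{p :: ('a \<Rightarrow> real) \<times> ('a \<Rightarrow> real). A \<subseteq> pos (fst p) (snd p) \<and> B \<subseteq> pos (snd p) (fst p)}"
  let ?T' = "{p :: ('a \<Rightarrow> real) \<times> ('a \<Rightarrow> real). B \<subseteq> pos (fst p) (snd p) \<and> A \<subseteq> pos (snd p) (fst p)}"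
  have *: "open {p :: ('a \<Rightarrow> real) \<times> ('a \<Rightarrow> real). A \<subseteq> pos (fst p) (snd p) \<and> B \<subseteq> pos (snd p) (fst p)}"
    if "finite A" "finite B" for A B
  proof -
    have "{p :: ('a \<Rightarrow> real) \<times> ('a \<Rightarrow> real). A \<subseteq> pos (fst p) (snd p) \<and> B \<subseteq> pos (snd p) (fst p)}
       = (\<Inter>v\<in>A. {p. snd p v < fst p v}) \<inter> (\<Inter>v\<in>B. {p. fst p v < snd p v})"
      by (auto simp: pos_def)
    then show ?thesis
      using that by (auto intro!: open_INT open_Int open_Collect_less continuous_on_fst_coord continuous_on_snd_coord)
  qed
  have "{(x, y) \<in> ordered_pairs G. {x, y} \<in> ?S} = ordered_pairs G \<inter> (?T \<union> ?T')"
    unfolding mem_Collect_eq ex_doubleton_iff by (auto simp: in_topspace_UC ordered_pairs_def)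
  moreover have "open (?T \<union> ?T')" using * assms by (auto intro!: open_Un)
  ultimately show ?thesis unfolding openin_UC by blast
qed

text \<open>The local sections of the double covering by ordered pairs: where \<open>u\<close> is a vertex at which one of the two
  points dominates, that point is put first.\<close>

definition order_at :: "'v \<Rightarrow> ('v \<Rightarrow> real) set \<Rightarrow> ('v \<Rightarrow> real) \<times> ('v \<Rightarrow> real)" where
  "order_at u z = (SOME p. z = {fst p, snd p} \<and> u \<in> pos (fst p) (snd p))"

lemma order_at_eq: "u \<in> pos x y \<Longrightarrow> order_at u {x, y} = (x, y)"
  unfolding order_at_def by (rule some_equality) (auto simp: pos_def doubleton_eq_iff)

lemma continuous_map_order_at:
  "continuous_map (subtopology (UC G) {z. \<exists>x y. z = {x, y} \<and> u \<in> pos x y}) euclidean (order_at u)"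
  unfolding continuous_map_def
proof (intro conjI allI impI)
  fix T :: "(('a \<Rightarrow> real) \<times> ('a \<Rightarrow> real)) set" assume "openin euclidean T"
  then have T: "open T" by simp
  let ?R = "{p :: ('a \<Rightarrow> real) \<times> ('a \<Rightarrow> real). u \<in> pos (fst p) (snd p)}"
  have R: "open ?R"
    unfolding pos_def by (auto intro!: open_Collect_less continuous_on_fst_coord continuous_on_snd_coord)
  let ?S = "{z \<in> topspace (UC G). \<exists>x y. z = {x, y} \<and> u \<in> pos x y \<and> (x, y) \<in> T}"
  have sw: "open (prod.swap -` (T \<inter> ?R))"
    by (rule open_vimage[OF open_Int[OF T R]])
       (simp add: prod.swap_def continuous_on_Pair continuous_on_fst continuous_on_snd continuous_on_id)
  have "{(x, y) \<in> ordered_pairs G. {x, y} \<in> ?S} = ordered_pairs G \<inter> ((T \<inter> ?R) \<union> prod.swap -` (T \<inter> ?R))"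
    unfolding mem_Collect_eq ex_doubleton_iff by (auto simp: in_topspace_UC ordered_pairs_def)
  then have "openin (UC G) ?S"
    unfolding openin_UC using open_Un[OF open_Int[OF T R] sw] by blast
  moreover have "{z \<in> topspace (subtopology (UC G) {z. \<exists>x y. z = {x, y} \<and> u \<in> pos x y}). order_at u z \<in> T}
     = ?S \<inter> {z. \<exists>x y. z = {x, y} \<and> u \<in> pos x y}" (is "?L = ?R")
  proof (intro subset_antisym subsetI)
    fix z assume "z \<in> ?L"
    then obtain x y where z: "z \<in> topspace (UC G)" "z = {x, y}" "u \<in> pos x y" "order_at u z \<in> T" by auto
    then have "(x, y) \<in> T" by (simp add: order_at_eq)
    then show "z \<in> ?R" using z by blast
  next
    fix z assume "z \<in> ?R"
    then obtain x y where z: "z \<in> topspace (UC G)" "z = {x, y}" "u \<in> pos x y" "(x, y) \<in> T" by auto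
    then have "order_at u z \<in> T" by (simp add: order_at_eq)
    then show "z \<in> ?L" using z by auto
  qed
  ultimately show "openin (subtopology (UC G) {z. \<exists>x y. z = {x, y} \<and> u \<in> pos x y})
     {z \<in> topspace (subtopology (UC G) {z. \<exists>x y. z = {x, y} \<and> u \<in> pos x y}). order_at u z \<in> T}"
    by (simp add: openin_subtopology_Int)
qed auto

definition vertex_point :: "'v \<Rightarrow> 'v \<Rightarrow> real" where
  "vertex_point u = (\<lambda>v. if v = u then 1 else 0)"

definition mix :: "real \<Rightarrow> ('v \<Rightarrow> real) \<Rightarrow> ('v \<Rightarrow> real) \<Rightarrow> 'v \<Rightarrow> real" where
  "mix t f g = (\<lambda>v. (1 - t) * f v + t * g v)"

lemma mix_0 [simp]: "mix 0 f g = f" and mix_1 [simp]: "mix 1 f g = g" and mix_same [simp]: "mix t f f = f"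
  by (auto simp: mix_def algebra_simps)

lemma vertex_point_in_realize_cell:
  "finite \<sigma> \<Longrightarrow> u \<in> \<sigma> \<Longrightarrow> vertex_point u \<in> realize_cell \<sigma>"
  by (auto simp: realize_cell_def vertex_point_def)

lemma mix_in_realize_cell:
  assumes "f \<in> realize_cell \<sigma>" "g \<in> realize_cell \<sigma>" "0 \<le> t" "t \<le> 1"
  shows "mix t f g \<in> realize_cell \<sigma>"
  using assms by (auto simp: realize_cell_def mix_def sum.distrib simp flip: sum_distrib_left)

lemma realize_cell_mono:
  assumes "finite \<tau>" "\<sigma> \<subseteq> \<tau>"
  shows "realize_cell \<sigma> \<subseteq> realize_cell \<tau>"
proof
  fix f assume f: "f \<in> realize_cell \<sigma>"
  then have "(\<Sum>v\<in>\<tau>. f v) = (\<Sum>v\<in>\<sigma>. f v)"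
    by (intro sum.mono_neutral_right) (use assms in \<open>auto simp: realize_cell_def\<close>)
  then show "f \<in> realize_cell \<tau>" using f assms by (auto simp: realize_cell_def)
qed

lemma pos_subset_cell: "x \<in> realize_cell \<sigma> \<Longrightarrow> y \<in> realize_cell \<tau> \<Longrightarrow> pos x y \<subseteq> \<sigma>"
proof
  fix v assume x: "x \<in> realize_cell \<sigma>" and y: "y \<in> realize_cell \<tau>" and v: "v \<in> pos x y"
  have "0 \<le> y v" using y by (simp add: realize_cell_def)
  then have "x v \<noteq> 0" using v by (simp add: pos_def)
  then show "v \<in> \<sigma>" using x by (auto simp: realize_cell_def)
qed

lemma sum_realize_cell:
  assumes "x \<in> realize_cell \<sigma>" "\<sigma> \<subseteq> A" "finite A"
  shows "(\<Sum>v\<in>A. x v) = 1"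
  using realize_cell_mono[OF assms(3,2)] assms(1) by (auto simp: realize_cell_def)

text \<open>The coordinates of both points add up to one, so neither point can dominate the other everywhere.\<close>

lemma pos_nonempty:
  assumes "x \<in> realize_cell \<sigma>" "y \<in> realize_cell \<tau>" "finite \<sigma>" "finite \<tau>" "x \<noteq> y"
  shows "pos x y \<noteq> {}"
proof
  assume e: "pos x y = {}"
  have le: "x v \<le> y v" for v using e not_less unfolding pos_def by blast
  have "(\<Sum>v\<in>\<sigma> \<union> \<tau>. y v - x v) = 0"
    using sum_realize_cell[OF assms(1), of "\<sigma> \<union> \<tau>"] sum_realize_cell[OF assms(2), of "\<sigma> \<union> \<tau>"] assms(3,4)
    by (simp add: sum_subtractf)
  then have "\<forall>v\<in>\<sigma> \<union> \<tau>. y v - x v = 0"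
    using sum_nonneg_eq_0_iff[of "\<sigma> \<union> \<tau>" "\<lambda>v. y v - x v"] le assms(3,4) by (simp add: le)
  moreover have "x v = y v" if "v \<notin> \<sigma> \<union> \<tau>" for v using assms(1,2) that by (auto simp: realize_cell_def)
  ultimately have "x = y" by (intro ext) (metis eq_iff_diff_eq_0)
  with assms(5) show False by simp
qed

lemma disjoint_cells_distinct:
  assumes "x \<in> realize_cell \<sigma>" "y \<in> realize_cell \<tau>" "\<sigma> \<inter> \<tau> = {}"
  shows "x \<noteq> y"
proof
  assume "x = y"
  then have "\<forall>v\<in>\<sigma>. x v = 0" using assms by (auto simp: realize_cell_def)
  then show False using assms(1) by (simp add: realize_cell_def)
qed

lemma finite_graph_cell:
  assumes "finite_simple_graph G" "\<sigma> \<in> graph_cells G"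
  shows "finite \<sigma>" "\<sigma> \<noteq> {}"
proof -
  consider v where "\<sigma> = {v}" | "card \<sigma> = 2"
    using assms by (auto simp: graph_cells_def finite_simple_graph_def)
  then show "finite \<sigma>" "\<sigma> \<noteq> {}"
    by (cases; auto intro: card_ge_0_finite)+
qed

section \<open>Cell cocycles\<close>

text \<open>Labels \<open>g p q\<close> for passing from the corner \<open>p\<close> to the corner \<open>q\<close> of a common cell, along an edge or a
  diagonal, whose products depend only on the end points inside each cell. Corners are ordered pairs, so
  the invariance under exchange of the two points is part of the notion.\<close>

definition cell_cocycle :: "('g, 'm) monoid_scheme \<Rightarrow> 'v set set set \<Rightarrow> ('v \<times> 'v \<Rightarrow> 'v \<times> 'v \<Rightarrow> 'g) \<Rightarrow> bool" where
  "cell_cocycle H K g \<longleftrightarrow> (\<forall>\<sigma> \<tau>. {\<sigma>, \<tau>} \<in> K \<longrightarrow> (\<forall>u\<in>\<sigma>. \<forall>w\<in>\<tau>. \<forall>u'\<in>\<sigma>. \<forall>w'\<in>\<tau>.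
     g (u, w) (u', w') \<in> carrier H \<and> g (w, u) (w', u') = g (u, w) (u', w') \<and>
     (\<forall>u''\<in>\<sigma>. \<forall>w''\<in>\<tau>. g (u, w) (u', w') \<otimes>\<^bsub>H\<^esub> g (u', w') (u'', w'') = g (u, w) (u'', w''))))"

lemma cell_cocycleD:
  assumes "cell_cocycle H K g" "{\<sigma>, \<tau>} \<in> K" "u \<in> \<sigma>" "w \<in> \<tau>" "u' \<in> \<sigma>" "w' \<in> \<tau>"
  shows "g (u, w) (u', w') \<in> carrier H" "g (w, u) (w', u') = g (u, w) (u', w')"
    "u'' \<in> \<sigma> \<Longrightarrow> w'' \<in> \<tau> \<Longrightarrow> g (u, w) (u', w') \<otimes>\<^bsub>H\<^esub> g (u', w') (u'', w'') = g (u, w) (u'', w'')"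
  using assms unfolding cell_cocycle_def by blast+

lemma cell_cocycle_refl:
  assumes "group H" "cell_cocycle H K g" "{\<sigma>, \<tau>} \<in> K" "u \<in> \<sigma>" "w \<in> \<tau>"
  shows "g (u, w) (u, w) = \<one>\<^bsub>H\<^esub>"
proof -
  interpret H: group H by fact
  show ?thesis
    using cell_cocycleD(1)[OF assms(2-5,4,5)] cell_cocycleD(3)[OF assms(2-5,4,5,4,5)]
    by (simp add: H.r_cancel_one)
qed

text \<open>What the spaces of configurations have in common with the realizations of subcomplexes. The complex \<open>K\<close>
  carries the faces that \<open>pos\<close> singles out, and the space is closed under pushing a configuration in a
  straight line towards those faces. The space need not be the union of the realized cells of \<open>K\<close>: it may
  contain configurations of two points on one edge.\<close>

locale configuration_model =
  fixes G :: "'v sgraph" and \<Omega> :: "('v \<Rightarrow> real) set set" and K :: "'v set set set"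
  assumes finite_graph: "finite_simple_graph G"
    and \<Omega>_subset: "\<Omega> \<subseteq> topspace (UC G)"
    and carrier_cell: "{x, y} \<in> \<Omega> \<Longrightarrow> \<exists>\<sigma> \<tau>. {\<sigma>, \<tau>} \<in> K \<and> pos x y \<subseteq> \<sigma> \<and> pos y x \<subseteq> \<tau>"
    and push: "\<lbrakk>{x, y} \<in> \<Omega>; x' \<in> realize_cell A; finite A; A \<subseteq> pos x y;
        y' \<in> realize_cell B; finite B; B \<subseteq> pos y x; 0 \<le> t; t \<le> 1\<rbrakk>
        \<Longrightarrow> {mix t x x', mix t y y'} \<in> \<Omega>"
    and cell_subset: "\<lbrakk>{\<sigma>, \<tau>} \<in> K; x \<in> realize_cell \<sigma>; y \<in> realize_cell \<tau>\<rbrakk> \<Longrightarrow> {x, y} \<in> \<Omega>"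
    and cells: "{\<sigma>, \<tau>} \<in> K \<Longrightarrow> finite \<sigma> \<and> finite \<tau> \<and> \<sigma> \<inter> \<tau> = {}"
begin

abbreviation X :: "('v \<Rightarrow> real) set topology" where "X \<equiv> subtopology (UC G) \<Omega>"

lemma topspace_X [simp]: "topspace X = \<Omega>"
  using \<Omega>_subset by (auto simp: topspace_subtopology)

definition dominates :: "('v \<Rightarrow> real) \<times> ('v \<Rightarrow> real) \<Rightarrow> ('v \<Rightarrow> real) \<times> ('v \<Rightarrow> real) \<Rightarrow> bool" where
  "dominates p q \<longleftrightarrow> pos (fst p) (snd p) \<subseteq> pos (fst q) (snd q) \<and> pos (snd p) (fst p) \<subseteq> pos (snd q) (fst q)"

lemma dominates_swap: "dominates (y, x) (y', x') \<longleftrightarrow> dominates (x, y) (x', y')"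
  by (auto simp: dominates_def)

lemma dominates_trans: "dominates p q \<Longrightarrow> dominates q r \<Longrightarrow> dominates p r"
  by (auto simp: dominates_def)

lemma realize_pointsE:
  assumes "x \<in> realize_points G"
  obtains \<sigma> where "\<sigma> \<in> graph_cells G" "x \<in> realize_cell \<sigma>" "finite \<sigma>"
  using assms finite_graph_cell[OF finite_graph] by (auto simp: realize_points_def)

lemma pos_nonempty_\<Omega>: "{x, y} \<in> \<Omega> \<Longrightarrow> pos x y \<noteq> {}"
proof -
  assume "{x, y} \<in> \<Omega>"
  then have "x \<in> realize_points G" "y \<in> realize_points G" "x \<noteq> y"
    using \<Omega>_subset in_topspace_UC[of x y G] by auto
  then show ?thesis by (metis pos_nonempty realize_pointsE)
qed

lemma finite_pos_\<Omega>: "{x, y} \<in> \<Omega> \<Longrightarrow> finite (pos x y)"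
  by (meson carrier_cell cells finite_subset)

lemma not_dominates_both:
  assumes "{x, y} \<in> \<Omega>" "dominates (x, y) (x', y')" "dominates (x, y) (y', x')"
  shows False
proof -
  obtain v where "v \<in> pos x y" using pos_nonempty_\<Omega>[OF assms(1)] by blast
  then have "v \<in> pos x' y'" "v \<in> pos y' x'" using assms(2,3) by (auto simp: dominates_def)
  then show False by (auto simp: pos_def)
qed

definition top_vertex :: "('v \<Rightarrow> real) \<Rightarrow> ('v \<Rightarrow> real) \<Rightarrow> 'v" where
  "top_vertex x y = (SOME v. v \<in> pos x y)"

lemma top_vertex: "{x, y} \<in> \<Omega> \<Longrightarrow> top_vertex x y \<in> pos x y"
  unfolding top_vertex_def using pos_nonempty_\<Omega> by (simp add: some_in_eq)

lemma top_vertex': "{x, y} \<in> \<Omega> \<Longrightarrow> top_vertex y x \<in> pos y x"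
  using top_vertex[of y x] by (simp add: insert_commute)

text \<open>The open star of \<open>z\<close>: the configurations whose two faces contain those of \<open>z\<close>.\<close>

definition nbhd :: "('v \<Rightarrow> real) set \<Rightarrow> ('v \<Rightarrow> real) set set" where
  "nbhd z = {z' \<in> \<Omega>. \<exists>x y x' y'. z = {x, y} \<and> z' = {x', y'} \<and> dominates (x, y) (x', y')}"

lemma nbhd_cases:
  assumes "z' \<in> nbhd {x, y}"
  obtains x' y' where "z' = {x', y'}" "z' \<in> \<Omega>" "dominates (x, y) (x', y')"
proof -
  obtain a b a' b' where "z' \<in> \<Omega>" "{x, y} = {a, b}" "z' = {a', b'}" "dominates (a, b) (a', b')"
    using assms unfolding nbhd_def by blast
  moreover from this(2) have "a = x \<and> b = y \<or> a = y \<and> b = x" by (auto simp: doubleton_eq_iff)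
  ultimately show thesis using that[of a' b'] that[of b' a'] dominates_swap[of x y b' a']
    by (auto simp: insert_commute)
qed

lemma openin_nbhd:
  assumes "z \<in> \<Omega>"
  shows "openin X (nbhd z)"
proof -
  obtain x y where z: "z = {x, y}" using assms \<Omega>_subset topspace_UC_cases by blast
  have "finite (pos x y)" "finite (pos y x)"
    using assms z finite_pos_\<Omega>[of x y] finite_pos_\<Omega>[of y x] by (auto simp: insert_commute)
  from openin_UC_pos[OF this, of G]
  have "openin X ({z' \<in> topspace (UC G). \<exists>x' y'. z' = {x', y'} \<and> pos x y \<subseteq> pos x' y' \<and> pos y x \<subseteq> pos y' x'} \<inter> \<Omega>)"
    by (simp add: openin_subtopology_Int)
  moreover have "nbhd z \<subseteq> {z' \<in> topspace (UC G). \<exists>x' y'. z' = {x', y'} \<and> pos x y \<subseteq> pos x' y' \<and> pos y x \<subseteq> pos y' x'} \<inter> \<Omega>"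
  proof
    fix z' assume "z' \<in> nbhd z"
    then show "z' \<in> {z' \<in> topspace (UC G). \<exists>x' y'. z' = {x', y'} \<and> pos x y \<subseteq> pos x' y' \<and> pos y x \<subseteq> pos y' x'} \<inter> \<Omega>"
      unfolding z by (rule nbhd_cases) (use \<Omega>_subset in \<open>auto simp: dominates_def\<close>)
  qed
  moreover have "{z' \<in> topspace (UC G). \<exists>x' y'. z' = {x', y'} \<and> pos x y \<subseteq> pos x' y' \<and> pos y x \<subseteq> pos y' x'} \<inter> \<Omega> \<subseteq> nbhd z"
  proof
    fix z' assume z': "z' \<in> {z' \<in> topspace (UC G). \<exists>x' y'. z' = {x', y'} \<and> pos x y \<subseteq> pos x' y' \<and> pos y x \<subseteq> pos y' x'} \<inter> \<Omega>"
    then obtain x' y' where "z' = {x', y'}" "pos x y \<subseteq> pos x' y'" "pos y x \<subseteq> pos y' x'" by auto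
    then have "z' = {x', y'}" "dominates (x, y) (x', y')" by (auto simp: dominates_def)
    then show "z' \<in> nbhd z" using z' unfolding nbhd_def z by blast
  qed
  ultimately show ?thesis by (metis (no_types, lifting) subset_antisym)
qed

lemma in_nbhd: "z \<in> \<Omega> \<Longrightarrow> z \<in> nbhd z"
proof -
  assume z: "z \<in> \<Omega>"
  then obtain x y where "z = {x, y}" using \<Omega>_subset topspace_UC_cases by blast
  moreover have "dominates (x, y) (x, y)" by (simp add: dominates_def)
  ultimately show ?thesis using z unfolding nbhd_def by blast
qed

text \<open>Every configuration is represented by a chosen vertex of its cell, and the transition in the star of \<open>z\<close> is
  the label between the chosen vertices; both of them belong to the larger cell.\<close>

definition transition :: "('v \<times> 'v \<Rightarrow> 'v \<times> 'v \<Rightarrow> 'g) \<Rightarrow> ('v \<Rightarrow> real) set \<Rightarrow> ('v \<Rightarrow> real) set \<Rightarrow> 'g" where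
  "transition g z z' = (SOME r. \<exists>x y x' y'. z = {x, y} \<and> z' = {x', y'} \<and> dominates (x, y) (x', y') \<and>
     r = g (top_vertex x y, top_vertex y x) (top_vertex x' y', top_vertex y' x'))"

lemma dominates_cell:
  assumes "{x', y'} \<in> \<Omega>" "{x, y} \<in> \<Omega>" "dominates (x, y) (x', y')"
  obtains \<sigma> \<tau> where "{\<sigma>, \<tau>} \<in> K" "pos x' y' \<subseteq> \<sigma>" "pos y' x' \<subseteq> \<tau>"
    "top_vertex x y \<in> \<sigma>" "top_vertex y x \<in> \<tau>" "top_vertex x' y' \<in> \<sigma>" "top_vertex y' x' \<in> \<tau>"
proof -
  obtain \<sigma> \<tau> where c: "{\<sigma>, \<tau>} \<in> K" "pos x' y' \<subseteq> \<sigma>" "pos y' x' \<subseteq> \<tau>"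
    using carrier_cell[OF assms(1)] by blast
  have "pos x y \<subseteq> \<sigma>" "pos y x \<subseteq> \<tau>" using assms(3) c by (auto simp: dominates_def)
  then show thesis
    using that[OF c] c top_vertex[OF assms(1)] top_vertex'[OF assms(1)]
      top_vertex[OF assms(2)] top_vertex'[OF assms(2)] by blast
qed

lemma transition_eq:
  assumes g: "cell_cocycle H K g" and "{x, y} \<in> \<Omega>" "{x', y'} \<in> \<Omega>" "dominates (x, y) (x', y')"
  shows "transition g {x, y} {x', y'}
       = g (top_vertex x y, top_vertex y x) (top_vertex x' y', top_vertex y' x')"
  unfolding transition_def
proof (rule some_equality)
  fix r assume "\<exists>a b a' b'. {x, y} = {a, b} \<and> {x', y'} = {a', b'} \<and> dominates (a, b) (a', b') \<and>
     r = g (top_vertex a b, top_vertex b a) (top_vertex a' b', top_vertex b' a')"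
  then obtain a b a' b' where ab: "{x, y} = {a, b}" "{x', y'} = {a', b'}" "dominates (a, b) (a', b')"
     "r = g (top_vertex a b, top_vertex b a) (top_vertex a' b', top_vertex b' a')" by blast
  obtain \<sigma> \<tau> where c: "{\<sigma>, \<tau>} \<in> K" "pos x' y' \<subseteq> \<sigma>" "pos y' x' \<subseteq> \<tau>"
    "top_vertex x y \<in> \<sigma>" "top_vertex y x \<in> \<tau>" "top_vertex x' y' \<in> \<sigma>" "top_vertex y' x' \<in> \<tau>"
    by (rule dominates_cell[OF assms(3,2,4)])
  have "(a, b, a', b') = (x, y, x', y') \<or> (a, b, a', b') = (y, x, y', x')"
  proof -
    have 1: "a = x \<and> b = y \<or> a = y \<and> b = x" "a' = x' \<and> b' = y' \<or> a' = y' \<and> b' = x'"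
      using ab(1,2) by (auto simp: doubleton_eq_iff)
    have 2: "\<not> dominates (x, y) (y', x')" using assms(4) not_dominates_both[OF assms(2)] by blast
    then have "\<not> dominates (y, x) (x', y')" using dominates_swap by blast
    with 1 2 ab(3) show ?thesis by auto
  qed
  then show "r = g (top_vertex x y, top_vertex y x) (top_vertex x' y', top_vertex y' x')"
    using ab(4) cell_cocycleD(2)[OF g c(1,4-7)] by auto
qed (use assms in blast)

lemma local_cocycle_transition:
  assumes "group H" and g: "cell_cocycle H K g"
  shows "local_cocycle H X nbhd (transition g)"
proof -
  interpret H: group H by fact
  show ?thesis
  proof unfold_locales
    fix z assume "z \<in> topspace X"
    then have z: "z \<in> \<Omega>" by simp
    then show "openin X (nbhd z)" "z \<in> nbhd z" by (simp_all add: openin_nbhd in_nbhd)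
    obtain x y where xy: "z = {x, y}" using z \<Omega>_subset topspace_UC_cases by blast
    fix z' assume "z' \<in> nbhd z"
    then obtain x' y' where xy': "z' = {x', y'}" "z' \<in> \<Omega>" "dominates (x, y) (x', y')"
      unfolding xy by (rule nbhd_cases)
    have t1: "transition g z z' = g (top_vertex x y, top_vertex y x) (top_vertex x' y', top_vertex y' x')"
      unfolding xy xy'(1) by (rule transition_eq[OF g]) (use z xy xy' in auto)
    show "transition g z z' \<in> carrier H"
    proof -
      have "{x', y'} \<in> \<Omega>" "{x, y} \<in> \<Omega>" using z xy xy' by auto
      then obtain \<sigma> \<tau> where c: "{\<sigma>, \<tau>} \<in> K" "pos x' y' \<subseteq> \<sigma>" "pos y' x' \<subseteq> \<tau>"
        "top_vertex x y \<in> \<sigma>" "top_vertex y x \<in> \<tau>" "top_vertex x' y' \<in> \<sigma>" "top_vertex y' x' \<in> \<tau>"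
        using xy'(3) by (rule dominates_cell)
      show ?thesis unfolding t1 by (rule cell_cocycleD(1)[OF g c(1,4-7)])
    qed
    fix z'' assume zz: "z'' \<in> nbhd z" "z'' \<in> nbhd z'"
    obtain x'' y'' where xy'': "z'' = {x'', y''}" "z'' \<in> \<Omega>" "dominates (x, y) (x'', y'')"
      using zz(1) unfolding xy by (rule nbhd_cases)
    have d': "dominates (x', y') (x'', y'')"
    proof (rule ccontr)
      assume "\<not> dominates (x', y') (x'', y'')"
      moreover obtain a b where "z'' = {a, b}" "dominates (x', y') (a, b)"
        using zz(2) unfolding xy'(1) by (rule nbhd_cases)
      ultimately have "dominates (x', y') (y'', x'')" using xy''(1) by (auto simp: doubleton_eq_iff)
      then have "dominates (x, y) (y'', x'')" using xy'(3) dominates_trans by blast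
      then show False using not_dominates_both xy''(3) z xy by blast
    qed
    have t2: "transition g z z'' = g (top_vertex x y, top_vertex y x) (top_vertex x'' y'', top_vertex y'' x'')"
      unfolding xy xy''(1) by (rule transition_eq[OF g]) (use z xy xy'' in auto)
    have t3: "transition g z' z'' = g (top_vertex x' y', top_vertex y' x') (top_vertex x'' y'', top_vertex y'' x'')"
      unfolding xy'(1) xy''(1) by (rule transition_eq[OF g]) (use d' xy' xy'' in auto)
    obtain \<sigma> \<tau> where c: "{\<sigma>, \<tau>} \<in> K" "pos x'' y'' \<subseteq> \<sigma>" "pos y'' x'' \<subseteq> \<tau>"
      using carrier_cell xy''(1,2) by blast
    have m: "top_vertex x y \<in> pos x'' y''" "top_vertex y x \<in> pos y'' x''"
      "top_vertex x' y' \<in> pos x'' y''" "top_vertex y' x' \<in> pos y'' x''"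
      "top_vertex x'' y'' \<in> pos x'' y''" "top_vertex y'' x'' \<in> pos y'' x''"
    proof -
      have "{x, y} \<in> \<Omega>" "{x', y'} \<in> \<Omega>" "{x'', y''} \<in> \<Omega>" using z xy xy' xy'' by auto
      then show "top_vertex x y \<in> pos x'' y''" "top_vertex y x \<in> pos y'' x''"
        "top_vertex x' y' \<in> pos x'' y''" "top_vertex y' x' \<in> pos y'' x''"
        "top_vertex x'' y'' \<in> pos x'' y''" "top_vertex y'' x'' \<in> pos y'' x''"
        using top_vertex[of x y] top_vertex'[of x y] top_vertex[of x' y'] top_vertex'[of x' y']
          top_vertex[of x'' y''] top_vertex'[of x'' y''] xy''(3) d' by (auto simp: dominates_def)
    qed
    show "transition g z z' \<otimes>\<^bsub>H\<^esub> transition g z' z'' = transition g z z''"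
      unfolding t1 t2 t3
      by (rule cell_cocycleD(3)[OF g c(1)]; rule subsetD[OF c(2)] subsetD[OF c(3)]; rule m)
  qed
qed

definition seg :: "('v \<Rightarrow> real) \<times> ('v \<Rightarrow> real) \<Rightarrow> ('v \<Rightarrow> real) \<times> ('v \<Rightarrow> real) \<Rightarrow> real \<Rightarrow> ('v \<Rightarrow> real) set" where
  "seg p q = (\<lambda>t. {mix t (fst p) (fst q), mix t (snd p) (snd q)})"

abbreviation vp :: "'v \<times> 'v \<Rightarrow> ('v \<Rightarrow> real) \<times> ('v \<Rightarrow> real)" where
  "vp p \<equiv> (vertex_point (fst p), vertex_point (snd p))"

lemma seg_0 [simp]: "seg p q 0 = {fst p, snd p}" and seg_1 [simp]: "seg p q 1 = {fst q, snd q}"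
  by (auto simp: seg_def)

lemma seg_swap: "seg (y, x) (y', x') = seg (x, y) (x', y')"
  by (auto simp: seg_def)

lemma continuous_map_into_X:
  assumes "\<And>v. continuous_on D (\<lambda>t. x t v)" "\<And>v. continuous_on D (\<lambda>t. y t v)"
    and "\<And>t. t \<in> D \<Longrightarrow> {x t, y t} \<in> \<Omega>"
  shows "continuous_map (top_of_set D) X (\<lambda>t. {x t, y t})"
  using assms \<Omega>_subset
  by (auto simp: continuous_map_in_subtopology intro!: continuous_map_into_UC)

lemma pathin_seg:
  assumes "\<And>t. 0 \<le> t \<Longrightarrow> t \<le> 1 \<Longrightarrow> seg p q t \<in> \<Omega>"
  shows "pathin X (seg p q)"
  unfolding pathin_def seg_def
  by (rule continuous_map_into_X) (use assms in \<open>auto simp: mix_def seg_def intro!: continuous_intros\<close>)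

lemma seg_triangle:
  assumes "\<And>a b. \<lbrakk>0 \<le> a; 0 \<le> b; a + b \<le> 1\<rbrakk> \<Longrightarrow>
      {\<lambda>v. (1 - a - b) * fst p v + a * fst q v + b * fst r v,
       \<lambda>v. (1 - a - b) * snd p v + a * snd q v + b * snd r v} \<in> \<Omega>"
  shows "path_homotopic X (concat_loop (seg p q) (seg q r)) (seg p r)"
proof -
  let ?H = "\<lambda>c. {\<lambda>v. (1 - fst c - snd c) * fst p v + fst c * fst q v + snd c * fst r v,
       \<lambda>v. (1 - fst c - snd c) * snd p v + fst c * snd q v + snd c * snd r v}"
  have "continuous_map (top_of_set {p. 0 \<le> fst p \<and> 0 \<le> snd p \<and> fst p + snd p \<le> (1::real)}) X ?H"
    by (rule continuous_map_into_X) (use assms in \<open>auto intro!: continuous_intros\<close>)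
  from path_homotopic_triangle[OF this] show ?thesis
    by (simp add: seg_def mix_def)
qed

end

section \<open>Edge classes in the fundamental group\<close>

lemma inj_vertex_point: "vertex_point u = vertex_point v \<longleftrightarrow> u = v"
  by (auto simp: vertex_point_def fun_eq_iff split: if_splits)

lemma pos_vertex_point: "u \<noteq> w \<Longrightarrow> pos (vertex_point u) (vertex_point w) = {u}"
  by (auto simp: pos_def vertex_point_def split: if_splits)

context configuration_model
begin

text \<open>The move from the parent \<open>{v', s}\<close> to \<open>{v, s}\<close> in the tree with root \<open>b\<close> and parent function \<open>par\<close>.\<close>

definition tree_edge :: "'v set \<Rightarrow> ('v set \<Rightarrow> 'v set) \<Rightarrow> 'v \<Rightarrow> 'v \<Rightarrow> 'v \<Rightarrow> bool" where
  "tree_edge b par v' v s \<longleftrightarrow> {{v}, {s}} \<in> K \<and> {{v'}, {s}} \<in> K \<and> {{v', v}, {s}} \<in> K \<and> v' \<noteq> v \<and>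
     {v, s} \<noteq> b \<and> par {v, s} = {v', s}"

lemma tree_edge_unique:
  assumes "tree_edge b par v' v s" "tree_edge b par u' u r" "{v, s} = {u, r}"
  shows "u' = v' \<and> u = v \<and> r = s"
  using assms cells[of "{v}" "{s}"] cells[of "{v'}" "{s}"] cells[of "{u}" "{r}"] cells[of "{u'}" "{r}"]
  by (auto simp: tree_edge_def doubleton_eq_iff)

lemma pathin_seg_cell:
  assumes "{\<sigma>, \<tau>} \<in> K" "u \<in> \<sigma>" "w \<in> \<tau>" "u' \<in> \<sigma>" "w' \<in> \<tau>"
  shows "pathin X (seg (vp (u, w)) (vp (u', w')))"
proof (rule pathin_seg)
  fix t :: real assume "0 \<le> t" "t \<le> 1"
  then show "seg (vp (u, w)) (vp (u', w')) t \<in> \<Omega>"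
    unfolding seg_def
    by (intro cell_subset[OF assms(1)] mix_in_realize_cell)
       (use assms cells[OF assms(1)] in \<open>auto intro: vertex_point_in_realize_cell\<close>)
qed

lemma pathin_tree_edge:
  "tree_edge b par v' v s \<Longrightarrow> pathin X (seg (vp (v', s)) (vp (v, s)))"
  by (rule pathin_seg_cell[of "{v', v}" "{s}"]) (auto simp: tree_edge_def)

end

text \<open>A spanning tree of the vertices of \<open>K\<close>; the rank decreases towards the root.\<close>

locale rooted_model = configuration_model G \<Omega> K
  for G :: "'v sgraph" and \<Omega> :: "('v \<Rightarrow> real) set set" and K :: "'v set set set" +
  fixes b :: "'v set" and par :: "'v set \<Rightarrow> 'v set" and rank :: "'v set \<Rightarrow> nat"
    and x0 :: "('v \<Rightarrow> real) set"
  assumes faces: "\<lbrakk>{\<sigma>, \<tau>} \<in> K; u \<in> \<sigma>; w \<in> \<tau>\<rbrakk> \<Longrightarrow> {{u}, {w}} \<in> K"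
    and root: "\<exists>u w. b = {u, w} \<and> {{u}, {w}} \<in> K"
    and parent: "\<lbrakk>{{u}, {w}} \<in> K; {u, w} \<noteq> b\<rbrakk> \<Longrightarrow>
        \<exists>v' v s. {u, w} = {v, s} \<and> tree_edge b par v' v s \<and> rank {v', s} < rank {v, s}"
    and base: "x0 \<in> \<Omega>"
begin

definition point :: "'v set \<Rightarrow> ('v \<Rightarrow> real) set" where
  "point p = vertex_point ` p"

lemma point_simp [simp]: "point {u, w} = {vertex_point u, vertex_point w}"
  by (simp add: point_def)

lemma point_in_\<Omega>: "{{u}, {w}} \<in> K \<Longrightarrow> point {u, w} \<in> \<Omega>"
  by (auto intro: cell_subset vertex_point_in_realize_cell)

lemma connected_to_root: "{{u}, {w}} \<in> K \<Longrightarrow> path_component_of X (point {u, w}) (point b)"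
proof (induction "rank {u, w}" arbitrary: u w rule: less_induct)
  case less
  show ?case
  proof (cases "{u, w} = b")
    case True
    then show ?thesis using point_in_\<Omega>[OF less.prems] \<Omega>_subset by (auto simp: path_component_of_refl)
  next
    case False
    then obtain v' v s where e: "{u, w} = {v, s}" "tree_edge b par v' v s" "rank {v', s} < rank {v, s}"
      using parent less.prems by blast
    have "path_component_of X (point {v', s}) (point {v, s})"
      unfolding path_component_of_def
      by (intro exI[of _ "seg (vp (v', s)) (vp (v, s))"]) (use e(2) pathin_tree_edge in auto)
    moreover have "path_component_of X (point {v', s}) (point b)"
      by (rule less.hyps) (use e in \<open>auto simp: tree_edge_def\<close>)
    ultimately show ?thesis
      unfolding e(1) by (meson path_component_of_sym path_component_of_trans)
  qed
qed

text \<open>The straight path from a configuration to its chosen vertex, for either order of the two points.\<close>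

definition approach :: "('v \<Rightarrow> real) set \<Rightarrow> real \<Rightarrow> ('v \<Rightarrow> real) set" where
  "approach z = (SOME f. \<exists>x y. z = {x, y} \<and> f = seg (x, y) (vp (top_vertex x y, top_vertex y x)))"

lemma approach_eq: "approach {x, y} = seg (x, y) (vp (top_vertex x y, top_vertex y x))"
  unfolding approach_def
  by (rule some_equality) (auto simp: doubleton_eq_iff intro: seg_swap)

lemma pathin_push:
  assumes "{x, y} \<in> \<Omega>" "u \<in> pos x y" "w \<in> pos y x"
  shows "pathin X (seg (x, y) (vp (u, w)))"
proof (rule pathin_seg)
  fix t :: real assume "0 \<le> t" "t \<le> 1"
  then show "seg (x, y) (vp (u, w)) t \<in> \<Omega>"
    unfolding seg_def fst_conv snd_conv
    by (intro push[OF assms(1), of _ "{u}" _ "{w}"]) (use assms in \<open>auto intro: vertex_point_in_realize_cell\<close>)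
qed

lemma pathin_approach: "{x, y} \<in> \<Omega> \<Longrightarrow> pathin X (approach {x, y})"
  unfolding approach_eq by (intro pathin_push top_vertex top_vertex')

lemma top_vertices_in_K: "{x, y} \<in> \<Omega> \<Longrightarrow> {{top_vertex x y}, {top_vertex y x}} \<in> K"
  by (meson carrier_cell faces subsetD top_vertex top_vertex')

lemma connected_\<Omega>:
  assumes "z \<in> \<Omega>"
  shows "path_component_of X z (point b)"
proof -
  obtain x y where z: "z = {x, y}" using assms \<Omega>_subset topspace_UC_cases by blast
  have "path_component_of X z (point {top_vertex x y, top_vertex y x})"
    unfolding path_component_of_def z
    by (intro exI[of _ "approach {x, y}"]) (use assms z pathin_approach in \<open>auto simp: approach_eq\<close>)
  then show ?thesis
    by (rule path_component_of_trans[OF _ connected_to_root[OF top_vertices_in_K]]) (use assms z in simp)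
qed

text \<open>Paths from the base point to all points, which follow the spanning tree on vertices, so that tree
  edges become trivial in the fundamental group.\<close>

lemma base_paths:
  "\<exists>\<kappa>. (\<forall>z\<in>\<Omega>. pathin X (\<kappa> z) \<and> \<kappa> z 0 = x0 \<and> \<kappa> z 1 = z) \<and>
     (\<forall>v' v s. tree_edge b par v' v s \<longrightarrow>
        \<kappa> (point {v, s}) = concat_loop (\<kappa> (point {v', s})) (seg (vp (v', s)) (vp (v, s))))"
proof -
  have "\<forall>z\<in>\<Omega>. \<exists>f. pathin X f \<and> f 0 = x0 \<and> f 1 = z"
  proof
    fix z assume "z \<in> \<Omega>"
    then have "path_component_of X x0 z"
      by (rule path_component_of_trans[OF connected_\<Omega>[OF base] path_component_of_sym[OF connected_\<Omega>]])
    then show "\<exists>f. pathin X f \<and> f 0 = x0 \<and> f 1 = z" unfolding path_component_of_def .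
  qed
  from bchoice[OF this] obtain k where k: "\<And>z. z \<in> \<Omega> \<Longrightarrow> pathin X (k z) \<and> k z 0 = x0 \<and> k z 1 = z"
    by blast
  define edge where "edge p = (SOME f. \<exists>v' v s. p = {v, s} \<and> tree_edge b par v' v s \<and>
      f = seg (vp (v', s)) (vp (v, s)))" for p
  have edge: "edge {v, s} = seg (vp (v', s)) (vp (v, s))" if "tree_edge b par v' v s" for v' v s
    unfolding edge_def
  proof (rule some_equality)
    show "\<exists>u' u r. {v, s} = {u, r} \<and> tree_edge b par u' u r \<and>
        seg (vp (v', s)) (vp (v, s)) = seg (vp (u', r)) (vp (u, r))"
      using that by blast
    fix f assume "\<exists>u' u r. {v, s} = {u, r} \<and> tree_edge b par u' u r \<and> f = seg (vp (u', r)) (vp (u, r))"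
    then obtain u' u r where "{v, s} = {u, r}" "tree_edge b par u' u r" "f = seg (vp (u', r)) (vp (u, r))"
      by (elim exE conjE)
    then show "f = seg (vp (v', s)) (vp (v, s))" using tree_edge_unique[OF that, of u' u r] by simp
  qed
  \<comment> \<open>Recursion along the tree towards the root.\<close>
  define F where "F f p = (if p = b then k (point b) else concat_loop (f (par p)) (edge p))" for f p
  define h where "h = wfrec (inv_image less_than rank) F"
  have h_b: "h b = k (point b)"
    unfolding h_def by (subst wfrec[OF wf_inv_image[OF wf_less_than]]) (simp add: F_def)
  have h: "h {v, s} = concat_loop (h {v', s}) (seg (vp (v', s)) (vp (v, s)))" if e: "tree_edge b par v' v s" for v' v s
  proof -
    have K: "{{v}, {s}} \<in> K" and ne: "{v, s} \<noteq> b" and par: "par {v, s} = {v', s}"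
      using e by (auto simp: tree_edge_def)
    obtain u' u r where u: "{v, s} = {u, r}" "tree_edge b par u' u r" "rank {u', r} < rank {u, r}"
      using parent[OF K ne] by (elim exE conjE)
    then have "rank {v', s} < rank {v, s}" using tree_edge_unique[OF e u(2,1)] by simp
    then show ?thesis
      unfolding h_def by (subst wfrec[OF wf_inv_image[OF wf_less_than]]) (simp add: F_def ne par edge[OF e] cut_apply)
  qed
  have h_path: "pathin X (h {u, w}) \<and> h {u, w} 0 = x0 \<and> h {u, w} 1 = point {u, w}" if "{{u}, {w}} \<in> K" for u w
    using that
  proof (induction "rank {u, w}" arbitrary: u w rule: less_induct)
    case less
    show ?case
    proof (cases "{u, w} = b")
      case True
      then show ?thesis using k[OF point_in_\<Omega>[OF less.prems]] h_b by simp
    next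
      case False
      then obtain v' v s where e: "{u, w} = {v, s}" "tree_edge b par v' v s" "rank {v', s} < rank {v, s}"
        using parent less.prems by blast
      have K': "{{v'}, {s}} \<in> K" using e(2) by (simp add: tree_edge_def)
      have "rank {v', s} < rank {u, w}" using e(1,3) by simp
      from less.hyps[OF this K']
      have "pathin X (h {v', s})" "h {v', s} 0 = x0" "h {v', s} 1 = point {v', s}" by blast+
      then have "pathin X (h {v, s}) \<and> h {v, s} 0 = x0 \<and> h {v, s} 1 = point {v, s}"
        using pathin_concat[OF _ pathin_tree_edge[OF e(2)], of "h {v', s}"] by (simp add: h[OF e(2)])
      then show ?thesis by (simp only: e(1))
    qed
  qed
  define verts where "verts z = {v. vertex_point v \<in> z}" for z :: "('v \<Rightarrow> real) set"
  have verts: "verts (point {u, w}) = {u, w}" for u w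
    by (auto simp: verts_def inj_vertex_point)
  define \<kappa> where "\<kappa> z = (if \<exists>u w. z = point {u, w} \<and> {{u}, {w}} \<in> K then h (verts z) else k z)" for z
  have \<kappa>: "\<kappa> (point {u, w}) = h {u, w}" if "{{u}, {w}} \<in> K" for u w
  proof -
    have "\<exists>u' w'. point {u, w} = point {u', w'} \<and> {{u'}, {w'}} \<in> K" using that by blast
    then show ?thesis by (simp only: \<kappa>_def if_True verts)
  qed
  show ?thesis
  proof (intro exI[of _ \<kappa>] conjI ballI allI impI)
    fix z assume z: "z \<in> \<Omega>"
    have "pathin X (\<kappa> z) \<and> \<kappa> z 0 = x0 \<and> \<kappa> z 1 = z"
    proof (cases "\<exists>u w. z = point {u, w} \<and> {{u}, {w}} \<in> K")
      case True
      then obtain u w where "z = point {u, w}" "{{u}, {w}} \<in> K" by blast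
      then show ?thesis using \<kappa>[of u w] h_path[of u w] by simp
    next
      case False
      then have "\<kappa> z = k z" by (simp only: \<kappa>_def if_False)
      then show ?thesis using k[OF z] by simp
    qed
    then show "pathin X (\<kappa> z)" "\<kappa> z 0 = x0" "\<kappa> z 1 = z" by auto
  next
    fix v' v s assume e: "tree_edge b par v' v s"
    then show "\<kappa> (point {v, s}) = concat_loop (\<kappa> (point {v', s})) (seg (vp (v', s)) (vp (v, s)))"
      using \<kappa>[of v s] \<kappa>[of v' s] h[OF e] by (auto simp: tree_edge_def)
  qed
qed

definition base_path :: "('v \<Rightarrow> real) set \<Rightarrow> real \<Rightarrow> ('v \<Rightarrow> real) set" where
  "base_path = (SOME k. (\<forall>z\<in>\<Omega>. pathin X (k z) \<and> k z 0 = x0 \<and> k z 1 = z) \<and>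
     (\<forall>v' v s. tree_edge b par v' v s \<longrightarrow>
        k (point {v, s}) = concat_loop (k (point {v', s})) (seg (vp (v', s)) (vp (v, s)))))"

lemma base_path: "z \<in> \<Omega> \<Longrightarrow> pathin X (base_path z)" "z \<in> \<Omega> \<Longrightarrow> base_path z 0 = x0" "z \<in> \<Omega> \<Longrightarrow> base_path z 1 = z"
    "tree_edge b par v' v s \<Longrightarrow>
        base_path {vertex_point v, vertex_point s} = concat_loop (base_path (point {v', s})) (seg (vp (v', s)) (vp (v, s)))"
  using someI_ex[OF base_paths, folded base_path_def] by auto

abbreviation loop_group :: "(real \<Rightarrow> ('v \<Rightarrow> real) set) set monoid" ("\<pi>\<^sub>1") where
  "\<pi>\<^sub>1 \<equiv> fundamental_group X x0"

sublocale pi1: group \<pi>\<^sub>1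
  by (rule group_fundamental_group) (use base \<Omega>_subset in auto)

text \<open>The loop that goes along the base path to the start of \<open>f\<close>, then along \<open>f\<close>, and back from its end. This is
  multiplicative for all composable paths, not only for loops.\<close>

definition path_class :: "(real \<Rightarrow> ('v \<Rightarrow> real) set) \<Rightarrow> (real \<Rightarrow> ('v \<Rightarrow> real) set) set" where
  "path_class f = loop_class X x0 (concat_loop (concat_loop (base_path (f 0)) f) (reverse_path (base_path (f 1))))"

lemma ends_in_\<Omega>: "pathin X f \<Longrightarrow> f 0 \<in> \<Omega>" "pathin X f \<Longrightarrow> f 1 \<in> \<Omega>"
  using path_start_in_topspace[of X f] path_finish_in_topspace[of X f] by auto

lemma path_class_loop:
  assumes "pathin X f"
  shows "concat_loop (concat_loop (base_path (f 0)) f) (reverse_path (base_path (f 1))) \<in> loops_at X x0"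
  using assms ends_in_\<Omega>[OF assms] base_path
  by (auto simp: loops_at_def intro!: pathin_concat pathin_reverse)

lemma path_class_closed: "pathin X f \<Longrightarrow> path_class f \<in> carrier \<pi>\<^sub>1"
  unfolding path_class_def by (rule loop_class_in_carrier[OF path_class_loop])

lemma path_class_homotopic:
  assumes "path_homotopic X f g"
  shows "path_class f = path_class g"
proof -
  note e = path_homotopic_ends[OF assms]
  show ?thesis
    unfolding path_class_def e(1,2)
    by (rule loop_class_eqI[OF path_class_loop[OF e(3)]], intro path_homotopic_concat)
       (use assms ends_in_\<Omega>[OF e(3)] base_path e in \<open>auto intro: pathin_reverse\<close>)
qed

lemma path_class_concat:
  assumes f: "pathin X f" and g: "pathin X g" and "f 1 = g 0"
  shows "path_class (concat_loop f g) = path_class f \<otimes>\<^bsub>\<pi>\<^sub>1\<^esub> path_class g"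
proof -
  let ?k = "base_path (f 0)" and ?m = "base_path (g 0)" and ?n = "base_path (g 1)"
  let ?m' = "reverse_path ?m" and ?n' = "reverse_path ?n"
  note [simp] = base_path(2,3) assms(3)
  have \<Omega>: "f 0 \<in> \<Omega>" "g 0 \<in> \<Omega>" "g 1 \<in> \<Omega>" using ends_in_\<Omega> f g by auto
  note [simp] = \<Omega>
  have [simp]: "pathin X ?k" "pathin X ?m" "pathin X ?n" "pathin X ?m'" "pathin X ?n'" "pathin X f" "pathin X g"
    using base_path \<Omega> f g by (auto intro: pathin_reverse)
  note [simp] = pathin_concat
  let ?A = "concat_loop ?k f"
  have "path_homotopic X (concat_loop (concat_loop ?A ?m') (concat_loop (concat_loop ?m g) ?n'))
      (concat_loop ?A (concat_loop ?m' (concat_loop (concat_loop ?m g) ?n')))"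
    by (rule concat_assoc) auto
  also have "path_homotopic X \<dots> (concat_loop ?A (concat_loop ?m' (concat_loop ?m (concat_loop g ?n'))))"
    by (intro path_homotopic_concat concat_assoc) auto
  also have "path_homotopic X \<dots> (concat_loop ?A (concat_loop (concat_loop ?m' ?m) (concat_loop g ?n')))"
    by (intro path_homotopic_concat path_homotopic_sym[OF concat_assoc]) auto
  also have "path_homotopic X \<dots> (concat_loop ?A (concat_loop (\<lambda>_. g 0) (concat_loop g ?n')))"
    by (intro path_homotopic_concat concat_reverse') auto
  also have "path_homotopic X \<dots> (concat_loop ?A (concat_loop g ?n'))"
    by (intro path_homotopic_concat concat_const_left) auto
  also have "path_homotopic X \<dots> (concat_loop (concat_loop ?A g) ?n')"
    by (rule path_homotopic_sym[OF concat_assoc]) auto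
  also have "path_homotopic X \<dots> (concat_loop (concat_loop ?k (concat_loop f g)) ?n')"
    by (intro path_homotopic_concat concat_assoc) auto
  finally have hom: "path_homotopic X (concat_loop (concat_loop ?A ?m') (concat_loop (concat_loop ?m g) ?n'))
      (concat_loop (concat_loop ?k (concat_loop f g)) ?n')" .
  have l: "concat_loop ?A ?m' \<in> loops_at X x0" "concat_loop (concat_loop ?m g) ?n' \<in> loops_at X x0"
    using path_class_loop[OF f] path_class_loop[OF g] by auto
  show ?thesis
    using loop_class_eqI[OF concat_in_loops_at[OF l] hom] mult_fundamental_group[OF l]
    by (simp add: path_class_def)
qed

lemma path_class_const:
  assumes "z \<in> \<Omega>"
  shows "path_class (\<lambda>_. z) = \<one>\<^bsub>\<pi>\<^sub>1\<^esub>"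
proof -
  have p: "pathin X (\<lambda>_. z)" using assms \<Omega>_subset by auto
  have "concat_loop (\<lambda>_. z) (\<lambda>_. z) = (\<lambda>_::real. z)" by (auto simp: concat_loop_def)
  then show ?thesis
    using path_class_concat[OF p p refl] path_class_closed[OF p] pi1.r_cancel_one' by force
qed

lemma path_class_tree_edge:
  assumes e: "tree_edge b par v' v s"
  shows "path_class (seg (vp (v', s)) (vp (v, s))) = \<one>\<^bsub>\<pi>\<^sub>1\<^esub>"
proof -
  have *: "{vertex_point v, vertex_point s} \<in> \<Omega>" using e point_in_\<Omega>[of v s] by (auto simp: tree_edge_def)
  have "path_class (seg (vp (v', s)) (vp (v, s))) = loop_class X x0
      (concat_loop (base_path {vertex_point v, vertex_point s}) (reverse_path (base_path {vertex_point v, vertex_point s})))"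
    by (simp add: path_class_def base_path(4)[OF e])
  also have "\<dots> = \<one>\<^bsub>\<pi>\<^sub>1\<^esub>"
    unfolding one_fundamental_group
    by (rule loop_class_eqI)
      (use base_path(1-3)[OF *] in \<open>auto simp: loops_at_def intro!: pathin_concat pathin_reverse concat_reverse\<close>)
  finally show ?thesis .
qed

definition edge_class :: "'v \<times> 'v \<Rightarrow> 'v \<times> 'v \<Rightarrow> (real \<Rightarrow> ('v \<Rightarrow> real) set) set" where
  "edge_class p q = path_class (seg (vp p) (vp q))"

lemma cell_cocycle_edge_class: "cell_cocycle \<pi>\<^sub>1 K edge_class"
  unfolding cell_cocycle_def edge_class_def
proof (intro allI impI ballI conjI)
  fix \<sigma> \<tau> u w u' w' assume c: "{\<sigma>, \<tau>} \<in> K" "u \<in> \<sigma>" "w \<in> \<tau>" "u' \<in> \<sigma>" "w' \<in> \<tau>"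
  note fin = cells[OF c(1)]
  show "path_class (seg (vp (u, w)) (vp (u', w'))) \<in> carrier \<pi>\<^sub>1"
    by (rule path_class_closed[OF pathin_seg_cell[OF c]])
  show "path_class (seg (vp (w, u)) (vp (w', u'))) = path_class (seg (vp (u, w)) (vp (u', w')))"
    by (simp add: seg_swap[of "vertex_point u"])
  fix u'' w'' assume c': "u'' \<in> \<sigma>" "w'' \<in> \<tau>"
  have comb: "(\<lambda>v. (1 - a - b) * x v + a * y v + b * z v) \<in> realize_cell \<rho>"
    if "0 \<le> a" "0 \<le> b" "a + b \<le> 1" "x \<in> realize_cell \<rho>" "y \<in> realize_cell \<rho>" "z \<in> realize_cell \<rho>"
    for a b :: real and x y z :: "'v \<Rightarrow> real" and \<rho>
    using that by (auto simp: realize_cell_def sum.distrib simp flip: sum_distrib_left)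
  have "path_homotopic X (concat_loop (seg (vp (u, w)) (vp (u', w'))) (seg (vp (u', w')) (vp (u'', w''))))
      (seg (vp (u, w)) (vp (u'', w'')))"
    by (rule seg_triangle, rule cell_subset[OF c(1)]; rule comb)
       (use c c' fin in \<open>auto intro: vertex_point_in_realize_cell\<close>)
  from path_class_homotopic[OF this]
  show "path_class (seg (vp (u, w)) (vp (u', w'))) \<otimes>\<^bsub>\<pi>\<^sub>1\<^esub> path_class (seg (vp (u', w')) (vp (u'', w'')))
      = path_class (seg (vp (u, w)) (vp (u'', w'')))"
    by (subst (asm) path_class_concat) (use c c' in \<open>auto intro: pathin_seg_cell[OF c(1), simplified]\<close>)
qed

end

section \<open>Homomorphisms with prescribed values on edges\<close>

context rooted_model
begin

definition tree_normalized :: "('g, 'm) monoid_scheme \<Rightarrow> ('v \<times> 'v \<Rightarrow> 'v \<times> 'v \<Rightarrow> 'g) \<Rightarrow> bool" where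
  "tree_normalized H g \<longleftrightarrow> (\<forall>v' v s. tree_edge b par v' v s \<longrightarrow> g (v', s) (v, s) = \<one>\<^bsub>H\<^esub>)"

lemma tree_normalized_edge_class: "tree_normalized \<pi>\<^sub>1 edge_class"
  using path_class_tree_edge by (simp add: tree_normalized_def edge_class_def)

lemma top_vertex_vertex_point: "u \<noteq> w \<Longrightarrow> top_vertex (vertex_point u) (vertex_point w) = u"
  by (simp add: top_vertex_def pos_vertex_point)

lemma nbhd_within_cell:
  assumes c: "{\<sigma>, \<tau>} \<in> K" and "x \<in> realize_cell \<sigma>" "y \<in> realize_cell \<tau>" "x' \<in> realize_cell \<sigma>" "y' \<in> realize_cell \<tau>"
    and n: "{x', y'} \<in> nbhd {x, y}"
  shows "dominates (x, y) (x', y')"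
proof (rule ccontr)
  assume "\<not> dominates (x, y) (x', y')"
  moreover obtain a b where "{x', y'} = {a, b}" "dominates (x, y) (a, b)" using n by (rule nbhd_cases)
  ultimately have "dominates (x, y) (y', x')" by (auto simp: doubleton_eq_iff)
  then have "pos x y \<subseteq> pos y' x'" by (simp add: dominates_def)
  moreover have "pos y' x' \<subseteq> \<tau>" "pos x y \<subseteq> \<sigma>" using pos_subset_cell assms by blast+
  ultimately have "pos x y = {}" using cells[OF c] by blast
  then show False using pos_nonempty_\<Omega>[OF cell_subset[OF c assms(2,3)]] by blast
qed

text \<open>Along a straight segment inside one cell the chosen vertices stay in that cell, so the cocycle itself,
  evaluated at the chosen vertices, is a lift.\<close>

lemma monodromy_seg:
  assumes H: "group H" and g: "cell_cocycle H K g"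
    and c: "{\<sigma>, \<tau>} \<in> K" "u \<in> \<sigma>" "w \<in> \<tau>" "u' \<in> \<sigma>" "w' \<in> \<tau>"
  shows "local_cocycle.monodromy H X nbhd (transition g) (seg (vp (u, w)) (vp (u', w'))) = g (u, w) (u', w')"
proof -
  interpret H: group H by fact
  interpret L: local_cocycle H X nbhd "transition g" by (rule local_cocycle_transition[OF H g])
  let ?x = "\<lambda>t. mix t (vertex_point u) (vertex_point u')" and ?y = "\<lambda>t. mix t (vertex_point w) (vertex_point w')"
  let ?f = "seg (vp (u, w)) (vp (u', w'))"
  let ?m = "\<lambda>t. (top_vertex (?x t) (?y t), top_vertex (?y t) (?x t))"
  have f: "?f = (\<lambda>t. {?x t, ?y t})" by (simp add: seg_def)
  have xy: "?x t \<in> realize_cell \<sigma>" "?y t \<in> realize_cell \<tau>" if "t \<in> {0..1}" for t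
    using that c cells[OF c(1)] by (auto intro!: mix_in_realize_cell vertex_point_in_realize_cell)
  have in\<Omega>: "{?x t, ?y t} \<in> \<Omega>" if "t \<in> {0..1}" for t
    using cell_subset[OF c(1) xy[OF that]] .
  have f\<Omega>: "?f t \<in> \<Omega>" if "t \<in> {0..1}" for t
    unfolding f by (rule in\<Omega>[OF that])
  have m: "top_vertex (?x t) (?y t) \<in> \<sigma>" "top_vertex (?y t) (?x t) \<in> \<tau>" if "t \<in> {0..1}" for t
    using top_vertex[OF in\<Omega>[OF that]] top_vertex'[OF in\<Omega>[OF that]]
      pos_subset_cell[OF xy[OF that]] pos_subset_cell[OF xy(2)[OF that] xy(1)[OF that]] by auto
  have "L.lift {0..1} ?f (\<lambda>t. g (u, w) (?m t))"
    unfolding L.lift_def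
  proof (intro ballI conjI)
    fix t :: real assume t: "t \<in> {0..1}"
    show "?f t \<in> topspace X" unfolding topspace_X f by (rule in\<Omega>[OF t])
    show car: "g (u, w) (?m t) \<in> carrier H" by (rule cell_cocycleD(1)[OF g c(1-3) m[OF t]])
    have "openin (top_of_set {0..1}) {r \<in> {0..1}. ?f r \<in> nbhd (?f t)}"
      using openin_continuous_map_preimage[OF pathin_seg_cell[OF c, unfolded pathin_def] openin_nbhd, of "?f t"]
        f\<Omega>[OF t] by simp
    then obtain U where U: "open U" "{r \<in> {0..1}. ?f r \<in> nbhd (?f t)} = {0..1} \<inter> U"
      unfolding openin_open by blast
    have "t \<in> U" using U(2) in_nbhd[OF f\<Omega>[OF t]] t by blast
    moreover have "?f t' \<in> nbhd (?f t) \<and> inv\<^bsub>H\<^esub> (g (u, w) (?m t)) \<otimes>\<^bsub>H\<^esub> g (u, w) (?m t') = transition g (?f t) (?f t')"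
      if t': "t' \<in> U \<inter> {0..1}" for t'
    proof -
      have t01: "t' \<in> {0..1}" using t' by auto
      have n: "?f t' \<in> nbhd (?f t)" using U(2) t' by blast
      have d: "dominates (?x t, ?y t) (?x t', ?y t')"
        by (rule nbhd_within_cell[OF c(1) xy[OF t] xy[OF t01]]) (use n in \<open>simp only: f\<close>)
      have tr: "transition g (?f t) (?f t') = g (?m t) (?m t')"
        unfolding f by (rule transition_eq[OF g in\<Omega>[OF t] in\<Omega>[OF t01] d])
      have "g (u, w) (?m t) \<otimes>\<^bsub>H\<^esub> g (?m t) (?m t') = g (u, w) (?m t')"
        by (rule cell_cocycleD(3)[OF g c(1-3) m[OF t] m[OF t01]])
      then have "g (?m t) (?m t') = inv\<^bsub>H\<^esub> (g (u, w) (?m t)) \<otimes>\<^bsub>H\<^esub> g (u, w) (?m t')"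
        using H.inv_solve_left[OF cell_cocycleD(1)[OF g c(1) m[OF t] m[OF t01]] car
            cell_cocycleD(1)[OF g c(1-3) m[OF t01]]] by simp
      then show ?thesis using n tr by simp
    qed
    ultimately show "\<exists>U. open U \<and> t \<in> U \<and> (\<forall>t'\<in>U \<inter> {0..1}. ?f t' \<in> nbhd (?f t) \<and>
        inv\<^bsub>H\<^esub> (g (u, w) (?m t)) \<otimes>\<^bsub>H\<^esub> g (u, w) (?m t') = transition g (?f t) (?f t'))"
      using U(1) by blast
  qed
  from L.monodromy_eq[OF this]
  have "L.monodromy ?f = inv\<^bsub>H\<^esub> (g (u, w) (?m 0)) \<otimes>\<^bsub>H\<^esub> g (u, w) (?m 1)" .
  moreover have "u \<noteq> w" "w \<noteq> u" "u' \<noteq> w'" "w' \<noteq> u'" using c cells[OF c(1)] by auto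
  ultimately show ?thesis
    using cell_cocycle_refl[OF H g c(1-3)] cell_cocycleD(1)[OF g c]
    by (simp add: top_vertex_vertex_point)
qed

text \<open>Monodromy gives the homomorphism up to conjugation: on an edge it yields the label, multiplied by the
  monodromies of the two base paths. Since \<open>g\<close> vanishes on the tree, these monodromies agree for all vertices,
  and conjugating by their common value \<open>a\<close> removes them.\<close>

theorem edge_class_hom_exists:
  assumes H: "group H" and g: "cell_cocycle H K g" and n: "tree_normalized H g"
  shows "\<exists>\<Phi>\<in>hom \<pi>\<^sub>1 H. \<forall>\<sigma> \<tau>. {\<sigma>, \<tau>} \<in> K \<longrightarrow> (\<forall>u\<in>\<sigma>. \<forall>w\<in>\<tau>. \<forall>u'\<in>\<sigma>. \<forall>w'\<in>\<tau>.
      \<Phi> (edge_class (u, w) (u', w')) = g (u, w) (u', w'))"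
proof -
  interpret H: group H by fact
  interpret L: local_cocycle H X nbhd "transition g" by (rule local_cocycle_transition[OF H g])
  let ?M = "L.monodromy" and ?h = "L.monodromy_hom x0"
  have M: "?M (base_path z) \<in> carrier H" if "z \<in> \<Omega>" for z
    by (rule L.monodromy_closed[OF base_path(1)[OF that]])
  have h: "?h (path_class f) = ?M (base_path (f 0)) \<otimes>\<^bsub>H\<^esub> ?M f \<otimes>\<^bsub>H\<^esub> inv\<^bsub>H\<^esub> ?M (base_path (f 1))"
    if f: "pathin X f" for f
  proof -
    note e = ends_in_\<Omega>[OF f] and b = base_path(1-3)[OF ends_in_\<Omega>(1)[OF f]] base_path(1-3)[OF ends_in_\<Omega>(2)[OF f]]
    have 1: "pathin X (concat_loop (base_path (f 0)) f)" using b f by (intro pathin_concat) auto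
    show ?thesis
      unfolding path_class_def L.monodromy_hom_class[OF path_class_loop[OF f]]
      using L.monodromy_concat[OF 1 pathin_reverse[OF b(4)]] L.monodromy_concat[OF b(1) f]
        L.monodromy_reverse[OF b(4)] b by simp
  qed
  have he: "?h (edge_class (u, w) (u', w')) =
      ?M (base_path (point {u, w})) \<otimes>\<^bsub>H\<^esub> g (u, w) (u', w') \<otimes>\<^bsub>H\<^esub> inv\<^bsub>H\<^esub> ?M (base_path (point {u', w'}))"
    if c: "{\<sigma>, \<tau>} \<in> K" "u \<in> \<sigma>" "w \<in> \<tau>" "u' \<in> \<sigma>" "w' \<in> \<tau>" for \<sigma> \<tau> u w u' w'
    unfolding edge_class_def h[OF pathin_seg_cell[OF c]] monodromy_seg[OF H g c] by simp
  define a where "a = ?M (base_path (point b))"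
  have M_a: "?M (base_path (point {u, w})) = a" if "{{u}, {w}} \<in> K" for u w
    using that
  proof (induction "rank {u, w}" arbitrary: u w rule: less_induct)
    case less
    show ?case
    proof (cases "{u, w} = b")
      case True
      then show ?thesis by (simp only: a_def)
    next
      case False
      obtain v' v s where e: "{u, w} = {v, s}" "tree_edge b par v' v s" "rank {v', s} < rank {v, s}"
        using parent[OF less.prems False] by (elim exE conjE)
      have K: "{{v'}, {s}} \<in> K" "{{v}, {s}} \<in> K" "{{v', v}, {s}} \<in> K" using e(2) by (simp_all add: tree_edge_def)
      have "rank {v', s} < rank {u, w}" using e(1,3) by simp
      from less.hyps[OF this K(1)] have p: "?M (base_path (point {v', s})) = a" .
      have g1: "g (v', s) (v, s) = \<one>\<^bsub>H\<^esub>" using n e(2) by (simp add: tree_normalized_def)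
      have "?h (edge_class (v', s) (v, s)) = \<one>\<^bsub>H\<^esub>"
        using path_class_tree_edge[OF e(2)] hom_one[OF L.monodromy_hom pi1.is_group H]
        by (simp add: edge_class_def)
      then have "?M (base_path (point {v', s})) \<otimes>\<^bsub>H\<^esub> \<one>\<^bsub>H\<^esub> \<otimes>\<^bsub>H\<^esub> inv\<^bsub>H\<^esub> ?M (base_path (point {v, s})) = \<one>\<^bsub>H\<^esub>"
        using he[OF K(3), of v' s v s] g1 by simp
      moreover have "?M (base_path (point {v', s})) \<in> carrier H" "?M (base_path (point {v, s})) \<in> carrier H"
        using M point_in_\<Omega> K by blast+
      ultimately have "?M (base_path (point {v, s})) = a"
        using p H.inv_solve_right[of "\<one>\<^bsub>H\<^esub>" a "?M (base_path (point {v, s}))"] by simp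
      then show ?thesis by (simp only: e(1))
    qed
  qed
  have a: "a \<in> carrier H" unfolding a_def using M point_in_\<Omega> root by metis
  let ?\<Phi> = "\<lambda>A. inv\<^bsub>H\<^esub> a \<otimes>\<^bsub>H\<^esub> ?h A \<otimes>\<^bsub>H\<^esub> a"
  have hom: "?\<Phi> \<in> hom \<pi>\<^sub>1 H"
  proof (rule homI)
    fix A B assume A: "A \<in> carrier \<pi>\<^sub>1" "B \<in> carrier \<pi>\<^sub>1"
    then have 1: "?h A \<in> carrier H" "?h B \<in> carrier H" using L.monodromy_hom by (auto intro: hom_in_carrier)
    then show "?\<Phi> A \<in> carrier H" using a by simp
    have "a \<otimes>\<^bsub>H\<^esub> (inv\<^bsub>H\<^esub> a \<otimes>\<^bsub>H\<^esub> (?h B \<otimes>\<^bsub>H\<^esub> a)) = ?h B \<otimes>\<^bsub>H\<^esub> a"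
      using a 1 by (simp add: H.m_assoc[symmetric])
    then show "?\<Phi> (A \<otimes>\<^bsub>\<pi>\<^sub>1\<^esub> B) = ?\<Phi> A \<otimes>\<^bsub>H\<^esub> ?\<Phi> B"
      using a 1 A by (simp add: hom_mult[OF L.monodromy_hom] H.m_assoc)
  qed
  have "?\<Phi> (edge_class (u, w) (u', w')) = g (u, w) (u', w')"
    if c: "{\<sigma>, \<tau>} \<in> K" "u \<in> \<sigma>" "w \<in> \<tau>" "u' \<in> \<sigma>" "w' \<in> \<tau>" for \<sigma> \<tau> u w u' w'
  proof -
    have e: "?h (edge_class (u, w) (u', w')) = a \<otimes>\<^bsub>H\<^esub> g (u, w) (u', w') \<otimes>\<^bsub>H\<^esub> inv\<^bsub>H\<^esub> a"
      using he[OF c] M_a[OF faces[OF c(1-3)]] M_a[OF faces[OF c(1,4,5)]] by simp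
    have "inv\<^bsub>H\<^esub> a \<otimes>\<^bsub>H\<^esub> (a \<otimes>\<^bsub>H\<^esub> g (u, w) (u', w')) = g (u, w) (u', w')"
      using a cell_cocycleD(1)[OF g c] by (simp add: H.m_assoc[symmetric])
    then show ?thesis
      unfolding e using a cell_cocycleD(1)[OF g c] by (simp add: H.m_assoc)
  qed
  then show ?thesis using hom by (intro bexI[of _ ?\<Phi>]) blast
qed

end

section \<open>Edges generate the fundamental group\<close>

context rooted_model
begin

definition subpath :: "(real \<Rightarrow> ('v \<Rightarrow> real) set) \<Rightarrow> real \<Rightarrow> real \<Rightarrow> real \<Rightarrow> ('v \<Rightarrow> real) set" where
  "subpath f s t = (\<lambda>r. f ((1 - r) * s + r * t))"

lemma affine_mem: "s \<in> {0..1} \<Longrightarrow> t \<in> {0..1} \<Longrightarrow> r \<in> {0..1} \<Longrightarrow> (1 - r) * s + r * t \<in> {0..1::real}"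
  using convexD_alt[of "{0..1::real}" s t r] by simp

lemma pathin_subpath:
  assumes "pathin X f" "s \<in> {0..1}" "t \<in> {0..1}"
  shows "pathin X (subpath f s t)"
proof -
  have "continuous_map (top_of_set {0..1}) X (f \<circ> (\<lambda>r. (1 - r) * s + r * t))"
    by (rule continuous_map_compose[OF _ assms(1)[unfolded pathin_def]])
       (use affine_mem[OF assms(2,3)] in \<open>auto intro!: continuous_intros\<close>)
  then show ?thesis by (simp add: pathin_def subpath_def o_def)
qed

lemma path_class_subpath:
  assumes f: "pathin X f" and t: "s \<in> {0..1}" "t \<in> {0..1}" "t' \<in> {0..1}"
  shows "path_class (subpath f s t') = path_class (subpath f s t) \<otimes>\<^bsub>\<pi>\<^sub>1\<^esub> path_class (subpath f t t')"
proof -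
  let ?c = "\<lambda>r. (1 - min 1 (2 * r)) * s + (min 1 (2 * r) - max 0 (2 * r - 1)) * t + max 0 (2 * r - 1) * t'"
  have c: "?c r = (if r \<le> 1/2 then (1 - 2 * r) * s + (2 * r) * t else (1 - (2 * r - 1)) * t + (2 * r - 1) * t')" for r
    by (cases "r \<le> 1/2") (simp_all add: max.absorb1 max.absorb2 min.absorb1 min.absorb2)
  have "concat_loop (subpath f s t) (subpath f t t') = (\<lambda>r. f (?c r))"
    unfolding c by (rule ext) (simp add: concat_loop_def subpath_def)
  moreover have "path_homotopic X (\<lambda>r. f (?c r)) (\<lambda>r. f ((1 - r) * s + r * t'))"
  proof (rule path_homotopic_reparam[OF f])
    show "0 \<le> ?c r \<and> ?c r \<le> 1" if "0 \<le> r" "r \<le> 1" for r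
      unfolding c using affine_mem[OF t(1,2), of "2 * r"] affine_mem[OF t(2,3), of "2 * r - 1"] that by auto
    show "0 \<le> (1 - r) * s + r * t' \<and> (1 - r) * s + r * t' \<le> 1" if "0 \<le> r" "r \<le> 1" for r
      using affine_mem[OF t(1,3), of r] that by auto
  qed (auto intro!: continuous_intros)
  ultimately have "path_class (concat_loop (subpath f s t) (subpath f t t')) = path_class (subpath f s t')"
    using path_class_homotopic by (simp add: subpath_def)
  moreover have "subpath f s t 1 = subpath f t t' 0" by (simp add: subpath_def)
  ultimately show ?thesis
    using path_class_concat[OF pathin_subpath[OF f t(1,2)] pathin_subpath[OF f t(2,3)]] by simp
qed

text \<open>A path inside the star of \<open>{x, y}\<close> is pushed in straight lines to the chosen vertex of \<open>{x, y}\<close>; the square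
  swept out compares the ends. The sections \<open>order_at\<close> supply a continuous order of the two points.\<close>

lemma path_class_push:
  assumes f: "pathin X f" and n: "\<And>r. r \<in> {0..1} \<Longrightarrow> f r \<in> nbhd {x, y}" and "f 0 = {x, y}" "f 1 = {x', y'}"
    and \<Omega>: "{x, y} \<in> \<Omega>" and d: "dominates (x, y) (x', y')"
  shows "path_class f \<otimes>\<^bsub>\<pi>\<^sub>1\<^esub> path_class (seg (x', y') (vp (top_vertex x y, top_vertex y x))) = path_class (approach {x, y})"
proof -
  let ?u = "top_vertex x y" and ?w = "top_vertex y x"
  have u: "?u \<in> pos x y" "?w \<in> pos y x" using top_vertex[OF \<Omega>] top_vertex'[OF \<Omega>] .
  define q where "q r = order_at ?u (f r)" for r
  have q: "f r = {fst (q r), snd (q r)}" "dominates (x, y) (q r)" "f r \<in> \<Omega>" if r: "r \<in> {0..1}" for r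
  proof -
    obtain x1 y1 where ab: "f r = {x1, y1}" "f r \<in> \<Omega>" "dominates (x, y) (x1, y1)"
      using n[OF r] by (rule nbhd_cases)
    have "?u \<in> pos x1 y1" using ab(3) u(1) by (auto simp: dominates_def)
    then have "q r = (x1, y1)" unfolding q_def ab(1) by (rule order_at_eq)
    then show "f r = {fst (q r), snd (q r)}" "dominates (x, y) (q r)" "f r \<in> \<Omega>" using ab by simp_all
  qed
  have uo: "?u \<in> pos (fst (q r)) (snd (q r))" "?w \<in> pos (snd (q r)) (fst (q r))" if "r \<in> {0..1}" for r
    using q(2)[OF that] u by (auto simp: dominates_def)
  have "continuous_map (top_of_set {0..1}) (subtopology (UC G) {z. \<exists>x y. z = {x, y} \<and> ?u \<in> pos x y}) f"
  proof -
    have 1: "continuous_map (top_of_set {0..1}) (UC G) f"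
      using f unfolding pathin_def continuous_map_in_subtopology by blast
    have 2: "\<exists>x y. f r = {x, y} \<and> ?u \<in> pos x y" if "r \<in> {0..1}" for r
      using q(1)[OF that] uo(1)[OF that] by blast
    show ?thesis
      unfolding continuous_map_in_subtopology
      by (rule conjI[OF 1], rule Pi_I, rule CollectI, rule 2, simp)
  qed
  from continuous_map_compose[OF this continuous_map_order_at]
  have cont: "continuous_on {0..1} q" by (simp add: q_def[abs_def] comp_def)
  have cont': "continuous_on ({0..1::real} \<times> {0..1::real}) (\<lambda>p. fst (q (snd p)) v)"
    "continuous_on ({0..1::real} \<times> {0..1::real}) (\<lambda>p. snd (q (snd p)) v)" for v
  proof -
    have c: "continuous_on ({0..1} \<times> {0..1}) (\<lambda>p :: real \<times> real. q (snd p))"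
      by (rule continuous_on_compose2[OF cont]) (auto intro!: continuous_intros)
    show "continuous_on ({0..1} \<times> {0..1}) (\<lambda>p :: real \<times> real. fst (q (snd p)) v)"
      by (rule continuous_on_product_then_coordinatewise[OF continuous_on_fst[OF c]])
    show "continuous_on ({0..1} \<times> {0..1}) (\<lambda>p :: real \<times> real. snd (q (snd p)) v)"
      by (rule continuous_on_product_then_coordinatewise[OF continuous_on_snd[OF c]])
  qed
  let ?H = "\<lambda>p. {mix (fst p) (fst (q (snd p))) (vertex_point ?u), mix (fst p) (snd (q (snd p))) (vertex_point ?w)}"
  have H\<Omega>: "?H p \<in> \<Omega>" if "p \<in> {0..1} \<times> {0..1}" for p
  proof -
    have r: "snd p \<in> {0..1}" "0 \<le> fst p" "fst p \<le> 1" using that by auto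
    have "{fst (q (snd p)), snd (q (snd p))} \<in> \<Omega>" using q(1,3)[OF r(1)] by simp
    then show ?thesis
      by (rule push[where A = "{?u}" and B = "{?w}"])
         (use uo[OF r(1)] r in \<open>auto intro: vertex_point_in_realize_cell\<close>)
  qed
  have "continuous_map (top_of_set ({0..1::real} \<times> {0..1::real})) X ?H"
    by (rule continuous_map_into_X[OF _ _ H\<Omega>]) (auto simp: mix_def intro!: continuous_intros cont')
  from path_homotopic_square[OF this]
  have sq: "path_homotopic X (concat_loop (\<lambda>r. ?H (0, r)) (\<lambda>s. ?H (s, 1))) (concat_loop (\<lambda>s. ?H (s, 0)) (\<lambda>r. ?H (1, r)))" .
  have q01: "q 0 = (x, y)" "q 1 = (x', y')"
    unfolding q_def assms(3,4) using u d by (auto simp: dominates_def intro!: order_at_eq)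
  have H1: "(\<lambda>s. ?H (s, 1)) = seg (x', y') (vp (?u, ?w))" "(\<lambda>s. ?H (s, 0)) = approach {x, y}"
    "(\<lambda>r. ?H (1, r)) = (\<lambda>_. {vertex_point ?u, vertex_point ?w})"
    by (auto simp: q01 seg_def approach_eq)
  have "path_homotopic X f (\<lambda>r. ?H (0, r))"
    by (rule path_homotopic_eq[OF f]) (use q(1) in auto)
  then have H0: "path_class (\<lambda>r. ?H (0, r)) = path_class f" "pathin X (\<lambda>r. ?H (0, r))"
    by (rule path_class_homotopic[OF path_homotopic_sym], rule path_homotopic_ends(4))
  have "{x', y'} \<in> \<Omega>" using q(3)[of 1] assms(4) by simp
  then have p: "pathin X (seg (x', y') (vp (?u, ?w)))"
    by (rule pathin_push) (use d u in \<open>auto simp: dominates_def\<close>)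
  have v\<Omega>: "{vertex_point ?u, vertex_point ?w} \<in> \<Omega>" using point_in_\<Omega>[OF top_vertices_in_K[OF \<Omega>]] by simp
  have c: "pathin X (\<lambda>_. {vertex_point ?u, vertex_point ?w})" using v\<Omega> \<Omega>_subset by auto
  have "path_class (concat_loop (\<lambda>r. ?H (0, r)) (seg (x', y') (vp (?u, ?w)))) =
     path_class f \<otimes>\<^bsub>\<pi>\<^sub>1\<^esub> path_class (seg (x', y') (vp (?u, ?w)))"
    using path_class_concat[OF H0(2) p] H0(1) by (simp add: q01)
  moreover have "path_class (concat_loop (approach {x, y}) (\<lambda>_. {vertex_point ?u, vertex_point ?w})) =
      path_class (approach {x, y})"
    using path_class_concat[OF pathin_approach[OF \<Omega>] c] path_class_const[OF v\<Omega>]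
      path_class_closed[OF pathin_approach[OF \<Omega>]] by (simp add: approach_eq)
  ultimately show ?thesis
    using path_class_homotopic[OF sq] unfolding H1 by simp
qed

text \<open>The straight paths from one configuration to two vertices of its faces, together with the edge or diagonal between these
  vertices, bound a triangle.\<close>

lemma path_class_approach:
  assumes \<Omega>: "{x, y} \<in> \<Omega>" "{x', y'} \<in> \<Omega>" and d: "dominates (x, y) (x', y')"
  shows "path_class (approach {x', y'}) = path_class (seg (x', y') (vp (top_vertex x y, top_vertex y x))) \<otimes>\<^bsub>\<pi>\<^sub>1\<^esub>
     edge_class (top_vertex x y, top_vertex y x) (top_vertex x' y', top_vertex y' x')"
proof -
  let ?u = "top_vertex x y" and ?w = "top_vertex y x" and ?u' = "top_vertex x' y'" and ?w' = "top_vertex y' x'"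
  have m: "?u \<in> pos x' y'" "?w \<in> pos y' x'" "?u' \<in> pos x' y'" "?w' \<in> pos y' x'"
    using top_vertex[OF \<Omega>(1)] top_vertex'[OF \<Omega>(1)] top_vertex[OF \<Omega>(2)] top_vertex'[OF \<Omega>(2)] d
    unfolding dominates_def fst_conv snd_conv by blast+
  obtain \<sigma> \<tau> where c: "{\<sigma>, \<tau>} \<in> K" "?u \<in> \<sigma>" "?w \<in> \<tau>" "?u' \<in> \<sigma>" "?w' \<in> \<tau>"
    using carrier_cell[OF \<Omega>(2)] m by blast
  \<comment> \<open>The convex combination with weights \<open>a\<close>, \<open>b\<close> of the two vertices, rescaled to a point of the simplex.\<close>
  have comb: "(\<lambda>v. a / (a + b) * vertex_point p v + b / (a + b) * vertex_point q v) \<in> realize_cell {p, q}"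
    if "0 \<le> a" "0 \<le> b" "a + b > 0" for a b :: real and p q :: 'v
  proof -
    have "1 - b / (a + b) = a / (a + b)" using that by (simp add: field_simps)
    moreover have "mix (b / (a + b)) (vertex_point p) (vertex_point q) \<in> realize_cell {p, q}"
      by (rule mix_in_realize_cell) (use that in \<open>auto intro: vertex_point_in_realize_cell simp: field_simps\<close>)
    ultimately show ?thesis by (simp add: mix_def)
  qed
  have hom: "path_homotopic X (concat_loop (seg (x', y') (vp (?u, ?w))) (seg (vp (?u, ?w)) (vp (?u', ?w')))) (seg (x', y') (vp (?u', ?w')))"
  proof (rule seg_triangle)
    fix a b :: real assume ab: "0 \<le> a" "0 \<le> b" "a + b \<le> 1"
    let ?c = "\<lambda>z p q v. (1 - a - b) * z v + a * vertex_point p v + b * vertex_point q v :: real"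
    show "{\<lambda>v. (1 - a - b) * fst (x', y') v + a * fst (vp (?u, ?w)) v + b * fst (vp (?u', ?w')) v,
       \<lambda>v. (1 - a - b) * snd (x', y') v + a * snd (vp (?u, ?w)) v + b * snd (vp (?u', ?w')) v} \<in> \<Omega>"
    proof (cases "a + b = 0")
      case True
      then have "a = 0" "b = 0" using ab by auto
      then show ?thesis using \<Omega>(2) by simp
    next
      case False
      then have pos: "a + b > 0" using ab by auto
      have eq: "?c z p q = mix (a + b) z (\<lambda>v. a / (a + b) * vertex_point p v + b / (a + b) * vertex_point q v)" for z p q
        using False by (auto simp: mix_def distrib_left)
      have "{mix (a + b) x' (\<lambda>v. a / (a + b) * vertex_point ?u v + b / (a + b) * vertex_point ?u' v),
         mix (a + b) y' (\<lambda>v. a / (a + b) * vertex_point ?w v + b / (a + b) * vertex_point ?w' v)} \<in> \<Omega>"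
        by (rule push[OF \<Omega>(2) comb[OF ab(1,2) pos] _ _ comb[OF ab(1,2) pos]]) (use m ab in auto)
      then show ?thesis unfolding fst_conv snd_conv eq .
    qed
  qed
  have p: "pathin X (seg (x', y') (vp (?u, ?w)))" by (rule pathin_push[OF \<Omega>(2) m(1,2)])
  show ?thesis
    unfolding approach_eq[of x' y'] edge_class_def
    using path_class_concat[OF p pathin_seg_cell[OF c]] path_class_homotopic[OF hom] by simp
qed

lemma approach_closed:
  assumes "z \<in> \<Omega>"
  shows "path_class (approach z) \<in> carrier \<pi>\<^sub>1"
proof -
  obtain x y where "z = {x, y}" using assms \<Omega>_subset topspace_UC_cases by blast
  then show ?thesis using path_class_closed[OF pathin_approach[of x y]] assms by simp
qed

text \<open>The images under \<open>\<Psi>\<close> of the classes of the initial pieces of \<open>f\<close>, each completed by the straight path to the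
  chosen vertex, form a lift. Hence a homomorphism is recovered as monodromy from its values on edges.\<close>

lemma lift_path_class:
  assumes H: "group H" and g: "cell_cocycle H K g" and \<Psi>: "\<Psi> \<in> hom \<pi>\<^sub>1 H"
    and eq: "\<And>\<sigma> \<tau> u w u' w'. \<lbrakk>{\<sigma>, \<tau>} \<in> K; u \<in> \<sigma>; w \<in> \<tau>; u' \<in> \<sigma>; w' \<in> \<tau>\<rbrakk> \<Longrightarrow>
        \<Psi> (edge_class (u, w) (u', w')) = g (u, w) (u', w')"
    and f: "pathin X f"
  shows "local_cocycle.lift H X nbhd (transition g) {0..1} f
     (\<lambda>t. \<Psi> (path_class (subpath f 0 t) \<otimes>\<^bsub>\<pi>\<^sub>1\<^esub> path_class (approach (f t))))"
proof -
  interpret H: group H by fact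
  interpret L: local_cocycle H X nbhd "transition g" by (rule local_cocycle_transition[OF H g])
  interpret \<Psi>: group_hom \<pi>\<^sub>1 H \<Psi> by unfold_locales (rule \<Psi>)
  have f\<Omega>: "f t \<in> \<Omega>" if "t \<in> {0..1}" for t
    using path_image_subset_topspace[OF f] that unfolding topspace_X by blast
  let ?a = "\<lambda>t. path_class (subpath f 0 t) \<otimes>\<^bsub>\<pi>\<^sub>1\<^esub> path_class (approach (f t))"
  have app: "path_class (approach (f t)) \<in> carrier \<pi>\<^sub>1" if "t \<in> {0..1}" for t
    by (rule approach_closed[OF f\<Omega>[OF that]])
  have sub: "path_class (subpath f s t) \<in> carrier \<pi>\<^sub>1" if "s \<in> {0..1}" "t \<in> {0..1}" for s t
    by (rule path_class_closed[OF pathin_subpath[OF f that]])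
  have a: "?a t \<in> carrier \<pi>\<^sub>1" if "t \<in> {0..1}" for t using app[OF that] sub[of 0 t] that by simp
  show ?thesis
    unfolding L.lift_def
  proof (intro ballI conjI)
    fix t :: real assume t: "t \<in> {0..1}"
    show "f t \<in> topspace X" unfolding topspace_X by (rule f\<Omega>[OF t])
    show "\<Psi> (?a t) \<in> carrier H" using a[OF t] by simp
    obtain x y where xy: "f t = {x, y}" using f\<Omega>[OF t] \<Omega>_subset topspace_UC_cases by blast
    have \<Omega>: "{x, y} \<in> \<Omega>" using f\<Omega>[OF t] xy by simp
    have "openin (top_of_set {0..1}) {r \<in> {0..1}. f r \<in> nbhd (f t)}"
      using openin_continuous_map_preimage[OF f[unfolded pathin_def] openin_nbhd[OF f\<Omega>[OF t]]] by simp
    then obtain U where U: "open U" "{r \<in> {0..1}. f r \<in> nbhd (f t)} = {0..1} \<inter> U"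
      unfolding openin_open by blast
    have "t \<in> U" using U(2) in_nbhd[OF f\<Omega>[OF t]] t by blast
    then obtain e where e: "e > 0" "ball t e \<subseteq> U" using U(1) open_contains_ball by blast
    have "f t' \<in> nbhd (f t) \<and> inv\<^bsub>H\<^esub> \<Psi> (?a t) \<otimes>\<^bsub>H\<^esub> \<Psi> (?a t') = transition g (f t) (f t')"
      if t': "t' \<in> ball t e \<inter> {0..1}" for t'
    proof -
      have t01: "t' \<in> {0..1}" using t' by auto
      have in_n: "f r \<in> nbhd {x, y}" if "r \<in> ball t e" "r \<in> {0..1}" for r
      proof -
        have "r \<in> {r \<in> {0..1}. f r \<in> nbhd (f t)}" unfolding U(2) using that e(2) by blast
        then show ?thesis using xy by simp
      qed
      have nt': "f t' \<in> nbhd {x, y}" using in_n t' by auto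
      then obtain x' y' where xy': "f t' = {x', y'}" "f t' \<in> \<Omega>" "dominates (x, y) (x', y')"
        by (rule nbhd_cases)
      have \<Omega>': "{x', y'} \<in> \<Omega>" using xy' by simp
      let ?m = "(top_vertex x y, top_vertex y x)" and ?m' = "(top_vertex x' y', top_vertex y' x')"
      obtain \<sigma> \<tau> where c: "{\<sigma>, \<tau>} \<in> K" "pos x' y' \<subseteq> \<sigma>" "pos y' x' \<subseteq> \<tau>"
        "top_vertex x y \<in> \<sigma>" "top_vertex y x \<in> \<tau>" "top_vertex x' y' \<in> \<sigma>" "top_vertex y' x' \<in> \<tau>"
        by (rule dominates_cell[OF \<Omega>' \<Omega> xy'(3)])
      have between: "(1 - r) * t + r * t' \<in> ball t e" if "r \<in> {0..1}" for r
        using convexD_alt[OF convex_ball, of t t e t' r] t' e(1) that by simp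
      have p1: "path_class (subpath f t t') \<otimes>\<^bsub>\<pi>\<^sub>1\<^esub> path_class (seg (x', y') (vp ?m)) = path_class (approach {x, y})"
      proof (rule path_class_push[OF pathin_subpath[OF f t t01] _ _ _ \<Omega> xy'(3)])
        show "subpath f t t' r \<in> nbhd {x, y}" if "r \<in> {0..1}" for r
          unfolding subpath_def by (rule in_n[OF between[OF that] affine_mem[OF t t01 that]])
      qed (simp_all add: subpath_def xy xy')
      have p2: "path_class (approach {x', y'}) = path_class (seg (x', y') (vp ?m)) \<otimes>\<^bsub>\<pi>\<^sub>1\<^esub> edge_class ?m ?m'"
        by (rule path_class_approach[OF \<Omega> \<Omega>' xy'(3)])
      have p3: "path_class (subpath f 0 t') = path_class (subpath f 0 t) \<otimes>\<^bsub>\<pi>\<^sub>1\<^esub> path_class (subpath f t t')"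
        by (rule path_class_subpath[OF f _ t t01]) simp
      have car: "path_class (seg (x', y') (vp ?m)) \<in> carrier \<pi>\<^sub>1"
        by (rule path_class_closed[OF pathin_push[OF \<Omega>']])
          (use xy'(3) top_vertex[OF \<Omega>] top_vertex'[OF \<Omega>] in \<open>auto simp: dominates_def\<close>)
      have ec: "edge_class ?m ?m' \<in> carrier \<pi>\<^sub>1" by (rule cell_cocycleD(1)[OF cell_cocycle_edge_class c(1,4-7)])
      have s1: "path_class (subpath f 0 t) \<in> carrier \<pi>\<^sub>1" "path_class (subpath f t t') \<in> carrier \<pi>\<^sub>1"
        using sub t t01 by auto
      have "?a t' = path_class (subpath f 0 t) \<otimes>\<^bsub>\<pi>\<^sub>1\<^esub> (path_class (subpath f t t') \<otimes>\<^bsub>\<pi>\<^sub>1\<^esub>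
          path_class (seg (x', y') (vp ?m))) \<otimes>\<^bsub>\<pi>\<^sub>1\<^esub> edge_class ?m ?m'"
        unfolding xy' p2 p3 using car ec s1 by (simp add: pi1.m_assoc)
      then have step: "?a t' = ?a t \<otimes>\<^bsub>\<pi>\<^sub>1\<^esub> edge_class ?m ?m'" unfolding p1 xy .
      have "\<Psi> (?a t') = \<Psi> (?a t) \<otimes>\<^bsub>H\<^esub> g ?m ?m'"
        unfolding step using a[OF t] ec eq[OF c(1,4-7)] by simp
      then have "inv\<^bsub>H\<^esub> \<Psi> (?a t) \<otimes>\<^bsub>H\<^esub> \<Psi> (?a t') = g ?m ?m'"
        using a[OF t] cell_cocycleD(1)[OF g c(1,4-7)] by (simp add: H.m_assoc[symmetric])
      moreover have "transition g (f t) (f t') = g ?m ?m'"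
        unfolding xy xy'(1) by (rule transition_eq[OF g \<Omega> \<Omega>' xy'(3)])
      ultimately show ?thesis using nt' xy by simp
    qed
    then show "\<exists>U. open U \<and> t \<in> U \<and> (\<forall>t'\<in>U \<inter> {0..1}. f t' \<in> nbhd (f t) \<and>
        inv\<^bsub>H\<^esub> \<Psi> (?a t) \<otimes>\<^bsub>H\<^esub> \<Psi> (?a t') = transition g (f t) (f t'))"
      using e(1) by (intro exI[of _ "ball t e"]) auto
  qed
qed

lemma cell_cocycle_hom:
  assumes "group H" "\<Psi> \<in> hom \<pi>\<^sub>1 H"
  shows "cell_cocycle H K (\<lambda>p q. \<Psi> (edge_class p q))"
  unfolding cell_cocycle_def
proof (intro allI impI ballI conjI)
  fix \<sigma> \<tau> u w u' w' assume c: "{\<sigma>, \<tau>} \<in> K" "u \<in> \<sigma>" "w \<in> \<tau>" "u' \<in> \<sigma>" "w' \<in> \<tau>"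
  note e = cell_cocycleD[OF cell_cocycle_edge_class]
  show "\<Psi> (edge_class (u, w) (u', w')) \<in> carrier H" by (rule hom_in_carrier[OF assms(2) e(1)[OF c]])
  show "\<Psi> (edge_class (w, u) (w', u')) = \<Psi> (edge_class (u, w) (u', w'))" by (simp only: e(2)[OF c])
  fix u'' w'' assume c': "u'' \<in> \<sigma>" "w'' \<in> \<tau>"
  show "\<Psi> (edge_class (u, w) (u', w')) \<otimes>\<^bsub>H\<^esub> \<Psi> (edge_class (u', w') (u'', w'')) = \<Psi> (edge_class (u, w) (u'', w''))"
    using hom_mult[OF assms(2) e(1)[OF c] e(1)[OF c(1,4,5) c']] e(3)[OF c c'] by simp
qed

text \<open>Two homomorphisms with the same edge values induce the same transitions, hence the same monodromy, and
  by \<open>lift_path_class\<close> the monodromy determines both.\<close>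

theorem edge_class_hom_unique:
  assumes H: "group H" and \<Psi>: "\<Psi>1 \<in> hom \<pi>\<^sub>1 H" "\<Psi>2 \<in> hom \<pi>\<^sub>1 H"
    and eq: "\<And>\<sigma> \<tau> u w u' w'. \<lbrakk>{\<sigma>, \<tau>} \<in> K; u \<in> \<sigma>; w \<in> \<tau>; u' \<in> \<sigma>; w' \<in> \<tau>\<rbrakk> \<Longrightarrow>
        \<Psi>1 (edge_class (u, w) (u', w')) = \<Psi>2 (edge_class (u, w) (u', w'))"
    and A: "A \<in> carrier \<pi>\<^sub>1"
  shows "\<Psi>1 A = \<Psi>2 A"
proof -
  define g where "g p q = \<Psi>1 (edge_class p q)" for p q
  have g: "cell_cocycle H K g" unfolding g_def by (rule cell_cocycle_hom[OF H \<Psi>(1)])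
  interpret H: group H by fact
  interpret L: local_cocycle H X nbhd "transition g" by (rule local_cocycle_transition[OF H g])
  interpret \<Psi>1: group_hom \<pi>\<^sub>1 H \<Psi>1 by unfold_locales (rule \<Psi>)
  interpret \<Psi>2: group_hom \<pi>\<^sub>1 H \<Psi>2 by unfold_locales (rule \<Psi>)
  let ?r = "base_path x0" and ?k = "path_class (approach x0)"
  note r = base_path(1-3)[OF base]
  have rl: "?r \<in> loops_at X x0" using r by (simp add: loops_at_def)
  define k0 where "k0 = loop_class X x0 ?r"
  have k0: "k0 \<in> carrier \<pi>\<^sub>1" unfolding k0_def by (rule loop_class_in_carrier[OF rl])
  have k: "?k \<in> carrier \<pi>\<^sub>1"
    by (rule approach_closed[OF base])
  \<comment> \<open>The lift along a loop \<open>f\<close> gives the value on a fixed conjugate of the class of \<open>f\<close>.\<close>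
  define B where "B = inv\<^bsub>\<pi>\<^sub>1\<^esub> k0 \<otimes>\<^bsub>\<pi>\<^sub>1\<^esub> ?k \<otimes>\<^bsub>\<pi>\<^sub>1\<^esub> A \<otimes>\<^bsub>\<pi>\<^sub>1\<^esub> inv\<^bsub>\<pi>\<^sub>1\<^esub> ?k \<otimes>\<^bsub>\<pi>\<^sub>1\<^esub> k0"
  have "B \<in> carrier \<pi>\<^sub>1" unfolding B_def using k0 k A by simp
  then obtain f where f: "f \<in> loops_at X x0" "B = loop_class X x0 f"
    unfolding carrier_fundamental_group by blast
  have fp: "pathin X f" "f 0 = x0" "f 1 = x0" using f by (auto simp: loops_at_def)
  have pcf: "path_class f = k0 \<otimes>\<^bsub>\<pi>\<^sub>1\<^esub> B \<otimes>\<^bsub>\<pi>\<^sub>1\<^esub> inv\<^bsub>\<pi>\<^sub>1\<^esub> k0"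
  proof -
    have rr: "reverse_path ?r \<in> loops_at X x0" using rl by (auto simp: loops_at_def intro: pathin_reverse)
    have "loop_class X x0 (reverse_path ?r) \<otimes>\<^bsub>\<pi>\<^sub>1\<^esub> k0 = \<one>\<^bsub>\<pi>\<^sub>1\<^esub>"
      unfolding k0_def mult_fundamental_group[OF rr rl] one_fundamental_group
      by (rule loop_class_eqI[OF concat_in_loops_at[OF rr rl] concat_reverse'[OF r(1)]]) (simp add: r)
    then have "loop_class X x0 (reverse_path ?r) = inv\<^bsub>\<pi>\<^sub>1\<^esub> k0"
      using pi1.inv_equality[OF _ k0 loop_class_in_carrier[OF rr]] by simp
    moreover have "path_class f = k0 \<otimes>\<^bsub>\<pi>\<^sub>1\<^esub> B \<otimes>\<^bsub>\<pi>\<^sub>1\<^esub> loop_class X x0 (reverse_path ?r)"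
      unfolding path_class_def fp f(2) k0_def mult_fundamental_group[OF rl f(1)]
        mult_fundamental_group[OF concat_in_loops_at[OF rl f(1)] rr] ..
    ultimately show ?thesis by simp
  qed
  have "k0 \<otimes>\<^bsub>\<pi>\<^sub>1\<^esub> B \<otimes>\<^bsub>\<pi>\<^sub>1\<^esub> inv\<^bsub>\<pi>\<^sub>1\<^esub> k0 = ?k \<otimes>\<^bsub>\<pi>\<^sub>1\<^esub> A \<otimes>\<^bsub>\<pi>\<^sub>1\<^esub> inv\<^bsub>\<pi>\<^sub>1\<^esub> ?k"
  proof -
    have "k0 \<otimes>\<^bsub>\<pi>\<^sub>1\<^esub> (inv\<^bsub>\<pi>\<^sub>1\<^esub> k0 \<otimes>\<^bsub>\<pi>\<^sub>1\<^esub> Z) = Z" if "Z \<in> carrier \<pi>\<^sub>1" for Z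
      using k0 that by (simp add: pi1.m_assoc[symmetric])
    then show ?thesis unfolding B_def using k0 k A by (simp add: pi1.m_assoc)
  qed
  then have pcf': "path_class f = ?k \<otimes>\<^bsub>\<pi>\<^sub>1\<^esub> A \<otimes>\<^bsub>\<pi>\<^sub>1\<^esub> inv\<^bsub>\<pi>\<^sub>1\<^esub> ?k" using pcf by simp
  have sub0: "path_class (subpath f 0 0) = \<one>\<^bsub>\<pi>\<^sub>1\<^esub>"
    using path_class_const[OF base] fp by (simp add: subpath_def)
  have sub1: "path_class (subpath f 0 1) = path_class f" by (simp add: subpath_def)
  have conj: "inv\<^bsub>\<pi>\<^sub>1\<^esub> ?k \<otimes>\<^bsub>\<pi>\<^sub>1\<^esub> (path_class f \<otimes>\<^bsub>\<pi>\<^sub>1\<^esub> ?k) = A"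
  proof -
    have "inv\<^bsub>\<pi>\<^sub>1\<^esub> ?k \<otimes>\<^bsub>\<pi>\<^sub>1\<^esub> (?k \<otimes>\<^bsub>\<pi>\<^sub>1\<^esub> A) = A" using k A by (simp add: pi1.m_assoc[symmetric])
    then show ?thesis unfolding pcf' using k A by (simp add: pi1.m_assoc)
  qed
  have pc: "path_class f \<in> carrier \<pi>\<^sub>1" by (rule path_class_closed[OF fp(1)])
  have val: "L.monodromy f = \<Psi> A"
    if \<Psi>: "\<Psi> \<in> hom \<pi>\<^sub>1 H" and eq: "\<And>\<sigma> \<tau> u w u' w'. \<lbrakk>{\<sigma>, \<tau>} \<in> K; u \<in> \<sigma>; w \<in> \<tau>; u' \<in> \<sigma>; w' \<in> \<tau>\<rbrakk> \<Longrightarrow>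
        \<Psi> (edge_class (u, w) (u', w')) = g (u, w) (u', w')" for \<Psi>
  proof -
    interpret \<Psi>: group_hom \<pi>\<^sub>1 H \<Psi> by unfold_locales (rule \<Psi>)
    have "L.monodromy f = inv\<^bsub>H\<^esub> \<Psi> ?k \<otimes>\<^bsub>H\<^esub> \<Psi> (path_class f \<otimes>\<^bsub>\<pi>\<^sub>1\<^esub> ?k)"
      using L.monodromy_eq[OF lift_path_class[OF H g \<Psi> eq fp(1)]] k by (simp add: sub0 sub1 fp)
    also have "\<dots> = \<Psi> (inv\<^bsub>\<pi>\<^sub>1\<^esub> ?k \<otimes>\<^bsub>\<pi>\<^sub>1\<^esub> (path_class f \<otimes>\<^bsub>\<pi>\<^sub>1\<^esub> ?k))"
      using k pc by simp
    finally show ?thesis unfolding conj .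
  qed
  have "L.monodromy f = \<Psi>1 A" by (rule val[OF \<Psi>(1)]) (simp add: g_def)
  moreover have "L.monodromy f = \<Psi>2 A" by (rule val[OF \<Psi>(2)]) (simp add: g_def eq)
  ultimately show ?thesis by simp
qed

end

section \<open>Monoid presentations of groups\<close>

definition word_class :: "'a set \<Rightarrow> ('a list \<times> 'a list) set \<Rightarrow> 'a list \<Rightarrow> 'a list set" where
  "word_class A R w = word_cong A R `` {w}"

locale presentation =
  fixes A :: "'a set" and R :: "('a list \<times> 'a list) set"
  assumes relators: "R \<subseteq> lists A \<times> lists A"
begin

abbreviation step where "step \<equiv> word_step A R \<union> (word_step A R)\<inverse>"

lemma step_in_lists: "(x, y) \<in> step \<Longrightarrow> x \<in> lists A \<and> y \<in> lists A"
proof -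
  have *: "x \<in> lists A \<and> y \<in> lists A" if xy: "(x, y) \<in> word_step A R" for x y
  proof -
    obtain u v l r where *: "x = u @ l @ v" "y = u @ r @ v" "u \<in> lists A" "v \<in> lists A" "(l, r) \<in> R"
      using xy unfolding word_step_def by blast
    moreover have "l \<in> lists A" "r \<in> lists A" using relators *(5) by blast+
    ultimately show ?thesis by simp
  qed
  assume "(x, y) \<in> step"
  then show ?thesis using *[of x y] *[of y x] by blast
qed

lemma steps_in_lists: "(x, y) \<in> step\<^sup>* \<Longrightarrow> x \<in> lists A \<Longrightarrow> y \<in> lists A"
proof (induction rule: rtrancl_induct)
  case (step y z)
  then show ?case using step_in_lists[of y z] by blast
qed

lemma word_cong_iff: "(x, y) \<in> word_cong A R \<longleftrightarrow> x \<in> lists A \<and> (x, y) \<in> step\<^sup>*"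
  using steps_in_lists by (auto simp: word_cong_def)

lemma sym_steps: "sym (step\<^sup>*)"
  by (rule sym_rtrancl) (auto simp: sym_def)

lemma equiv_word_cong: "equiv (lists A) (word_cong A R)"
proof (rule equivI)
  show "word_cong A R \<subseteq> lists A \<times> lists A" by (auto simp: word_cong_def)
  show "refl_on (lists A) (word_cong A R)" by (auto simp: refl_on_def word_cong_def)
  show "sym (word_cong A R)"
    using sym_steps unfolding sym_def word_cong_def by blast
  show "trans (word_cong A R)"
    unfolding trans_def word_cong_def by (blast intro: rtrancl_trans)
qed

lemma step_append: "(x, y) \<in> step \<Longrightarrow> u \<in> lists A \<Longrightarrow> v \<in> lists A \<Longrightarrow> (u @ x @ v, u @ y @ v) \<in> step"
proof -
  have *: "(u @ x @ v, u @ y @ v) \<in> word_step A R"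
    if xy: "(x, y) \<in> word_step A R" and uv: "u \<in> lists A" "v \<in> lists A" for x y
  proof -
    obtain u' v' l r where *: "x = u' @ l @ v'" "y = u' @ r @ v'" "u' \<in> lists A" "v' \<in> lists A" "(l, r) \<in> R"
      using xy unfolding word_step_def by blast
    have "u @ x @ v = (u @ u') @ l @ (v' @ v)" "u @ y @ v = (u @ u') @ r @ (v' @ v)"
      "u @ u' \<in> lists A" "v' @ v \<in> lists A" using * uv by auto
    then show ?thesis using *(5) unfolding word_step_def by blast
  qed
  assume "(x, y) \<in> step" "u \<in> lists A" "v \<in> lists A"
  then show ?thesis using *[of x y] *[of y x] by auto
qed

lemma steps_append: "(x, y) \<in> step\<^sup>* \<Longrightarrow> u \<in> lists A \<Longrightarrow> v \<in> lists A \<Longrightarrow> (u @ x @ v, u @ y @ v) \<in> step\<^sup>*"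
proof (induction rule: rtrancl_induct)
  case (step y z)
  show ?case
    by (rule rtrancl_into_rtrancl[OF step.IH[OF step.prems] step_append[OF step.hyps(2) step.prems]])
qed simp

lemma word_cong_append:
  assumes "(x, x') \<in> word_cong A R" "(y, y') \<in> word_cong A R"
  shows "(x @ y, x' @ y') \<in> word_cong A R"
proof -
  have l: "x \<in> lists A" "x' \<in> lists A" "y \<in> lists A" using assms by (auto simp: word_cong_def)
  have "(x @ y, x' @ y) \<in> step\<^sup>*"
    using steps_append[of x x' "[]" y] assms(1) l by (simp add: word_cong_iff)
  moreover have "(x' @ y, x' @ y') \<in> step\<^sup>*"
    using steps_append[of y y' x' "[]"] assms(2) l by (simp add: word_cong_iff)
  ultimately show ?thesis using l by (auto simp: word_cong_iff intro: rtrancl_trans)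
qed

abbreviation P :: "'a list set monoid" where "P \<equiv> presented_monoid A R"
abbreviation cls :: "'a list \<Rightarrow> 'a list set" where "cls \<equiv> word_class A R"

lemma carrier_P: "carrier P = cls ` lists A"
  by (auto simp: presented_monoid_def quotient_def word_class_def)

lemma cls_closed: "w \<in> lists A \<Longrightarrow> cls w \<in> carrier P"
  by (simp add: carrier_P)

lemma one_P: "\<one>\<^bsub>P\<^esub> = cls []"
  by (simp add: presented_monoid_def word_class_def)

lemma cls_eqI: "(x, y) \<in> word_cong A R \<Longrightarrow> cls x = cls y"
  unfolding word_class_def by (rule equiv_class_eq[OF equiv_word_cong])

lemma cls_relation: "(x, y) \<in> R \<Longrightarrow> cls x = cls y"
proof (rule cls_eqI)
  assume R: "(x, y) \<in> R"
  then have "([] @ x @ [], [] @ y @ []) \<in> word_step A R" unfolding word_step_def by blast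
  then show "(x, y) \<in> word_cong A R" using R relators by (auto simp: word_cong_iff)
qed

lemma mult_P:
  assumes "x \<in> lists A" "y \<in> lists A"
  shows "cls x \<otimes>\<^bsub>P\<^esub> cls y = cls (x @ y)"
proof -
  have "congruent2 (word_cong A R) (word_cong A R) (\<lambda>x y. cls (x @ y))"
    by (rule congruent2I') (auto intro!: cls_eqI word_cong_append)
  from UN_equiv_class2[OF equiv_word_cong equiv_word_cong this assms]
  show ?thesis by (simp add: presented_monoid_def word_class_def)
qed

lemma cls_Cons: "a \<in> A \<Longrightarrow> w \<in> lists A \<Longrightarrow> cls (a # w) = cls [a] \<otimes>\<^bsub>P\<^esub> cls w"
  by (simp add: mult_P)

text \<open>A presented monoid is a group as soon as each letter has a left inverse.\<close>

lemma group_P: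
  assumes inv: "\<And>a. a \<in> A \<Longrightarrow> \<exists>w\<in>lists A. cls (w @ [a]) = cls []"
  shows "group P"
proof (rule groupI)
  show "\<one>\<^bsub>P\<^esub> \<in> carrier P" by (simp add: one_P cls_closed)
  fix x assume "x \<in> carrier P"
  then obtain u where u: "u \<in> lists A" "x = cls u" by (auto simp: carrier_P)
  show "\<one>\<^bsub>P\<^esub> \<otimes>\<^bsub>P\<^esub> x = x" using mult_P[of "[]" u] u by (simp add: one_P)
  have "\<exists>w\<in>lists A. cls (w @ u) = cls []"
    using u(1)
  proof (induction u)
    case Nil
    then show ?case by force
  next
    case (Cons a u)
    then obtain v where v: "v \<in> lists A" "cls (v @ u) = cls []" by auto
    obtain w where w: "w \<in> lists A" "cls (w @ [a]) = cls []" using inv Cons.hyps by blast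
    have l: "w @ [a] \<in> lists A" "u \<in> lists A" "(w @ [a]) @ u \<in> lists A" using w Cons.hyps by auto
    have "cls ((v @ w) @ a # u) = cls (v @ ((w @ [a]) @ u))" by simp
    also have "\<dots> = cls v \<otimes>\<^bsub>P\<^esub> cls ((w @ [a]) @ u)" by (rule mult_P[OF v(1) l(3), symmetric])
    also have "\<dots> = cls v \<otimes>\<^bsub>P\<^esub> (cls [] \<otimes>\<^bsub>P\<^esub> cls u)" by (simp only: mult_P[OF l(1,2), symmetric] w(2))
    also have "\<dots> = cls (v @ u)" using mult_P[of "[]" u] mult_P[OF v(1) l(2)] l(2) by simp
    also have "\<dots> = cls []" by (rule v(2))
    finally show ?case using v(1) w(1) by (intro bexI[of _ "v @ w"]) auto
  qed
  then show "\<exists>y\<in>carrier P. y \<otimes>\<^bsub>P\<^esub> x = \<one>\<^bsub>P\<^esub>"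
    using u by (auto simp: carrier_P one_P mult_P)
  fix y assume "y \<in> carrier P"
  then obtain v where v: "v \<in> lists A" "y = cls v" by (auto simp: carrier_P)
  show "x \<otimes>\<^bsub>P\<^esub> y \<in> carrier P" using u v by (simp add: mult_P cls_closed)
  fix z assume "z \<in> carrier P"
  then obtain w where w: "w \<in> lists A" "z = cls w" by (auto simp: carrier_P)
  show "x \<otimes>\<^bsub>P\<^esub> y \<otimes>\<^bsub>P\<^esub> z = x \<otimes>\<^bsub>P\<^esub> (y \<otimes>\<^bsub>P\<^esub> z)" using u v w by (simp add: mult_P)
qed

definition eval_word :: "('g, 'm) monoid_scheme \<Rightarrow> ('a \<Rightarrow> 'g) \<Rightarrow> 'a list \<Rightarrow> 'g" where
  "eval_word H f w = foldr (\<lambda>a x. f a \<otimes>\<^bsub>H\<^esub> x) w \<one>\<^bsub>H\<^esub>"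

text \<open>A function on letters that respects the relations extends by evaluating words.\<close>

lemma universal_P:
  assumes H: "group H" and f: "\<And>a. a \<in> A \<Longrightarrow> f a \<in> carrier H"
    and rel: "\<And>l r. (l, r) \<in> R \<Longrightarrow> eval_word H f l = eval_word H f r"
  shows "\<exists>\<Phi>\<in>hom P H. \<forall>a\<in>A. \<Phi> (cls [a]) = f a"
proof -
  interpret H: group H by fact
  let ?e = "eval_word H f"
  have closed: "?e w \<in> carrier H" if "w \<in> lists A" for w
    using that by (induction w) (auto simp: eval_word_def f)
  have app: "?e (u @ v) = ?e u \<otimes>\<^bsub>H\<^esub> ?e v" if "u \<in> lists A" "v \<in> lists A" for u v
    using that
  proof (induction u)
    case Nil
    then show ?case using closed[of v] by (simp add: eval_word_def)
  next
    case (Cons a u)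
    then show ?case using closed[of v] closed[of u] f[of a] by (simp add: eval_word_def H.m_assoc)
  qed
  have step: "?e x = ?e y" if xy: "(x, y) \<in> word_step A R" for x y
  proof -
    obtain u v l r where *: "x = u @ l @ v" "y = u @ r @ v" "u \<in> lists A" "v \<in> lists A" "(l, r) \<in> R"
      using xy unfolding word_step_def by blast
    then have "l \<in> lists A" "r \<in> lists A" using relators by auto
    then show ?thesis using * rel[OF *(5)] by (simp add: app)
  qed
  have steps: "?e x = ?e y" if "(x, y) \<in> step\<^sup>*" for x y
    using that by (induction rule: rtrancl_induct) (auto dest: step)
  define \<Phi> where "\<Phi> X = ?e (SOME w. w \<in> X)" for X
  have \<Phi>: "\<Phi> (cls w) = ?e w" if w: "w \<in> lists A" for w
  proof -
    have "w \<in> cls w" using w by (simp add: word_class_def word_cong_iff)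
    then have "(SOME v. v \<in> cls w) \<in> cls w" by (rule someI)
    then have "(w, SOME v. v \<in> cls w) \<in> word_cong A R" unfolding word_class_def by blast
    then have "(w, SOME v. v \<in> cls w) \<in> step\<^sup>*" unfolding word_cong_iff by blast
    from steps[OF this] show ?thesis unfolding \<Phi>_def by (rule sym)
  qed
  have "\<Phi> \<in> hom P H"
  proof (rule homI)
    fix x y assume "x \<in> carrier P" "y \<in> carrier P"
    then obtain u v where uv: "u \<in> lists A" "x = cls u" "v \<in> lists A" "y = cls v" unfolding carrier_P by blast
    show "\<Phi> x \<in> carrier H" using \<Phi>[OF uv(1)] closed[OF uv(1)] uv(2) by simp
    have "u @ v \<in> lists A" using uv by simp
    then show "\<Phi> (x \<otimes>\<^bsub>P\<^esub> y) = \<Phi> x \<otimes>\<^bsub>H\<^esub> \<Phi> y"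
      unfolding uv(2,4) mult_P[OF uv(1,3)] using \<Phi>[OF uv(1)] \<Phi>[OF uv(3)] \<Phi>[of "u @ v"] app[OF uv(1,3)] by simp
  qed
  moreover have "\<Phi> (cls [a]) = f a" if "a \<in> A" for a
    using \<Phi>[of "[a]"] that f[OF that] by (simp add: eval_word_def)
  ultimately show ?thesis by blast
qed

lemma unique_P:
  assumes "group P" "group H" "\<Phi> \<in> hom P H" "\<Psi> \<in> hom P H" "\<And>a. a \<in> A \<Longrightarrow> \<Phi> (cls [a]) = \<Psi> (cls [a])"
    and "x \<in> carrier P"
  shows "\<Phi> x = \<Psi> x"
proof -
  obtain w where w: "w \<in> lists A" "x = cls w" using assms(6) by (auto simp: carrier_P)
  have "\<Phi> (cls w) = \<Psi> (cls w)"
    using w(1)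
  proof (induction w)
    case Nil
    then show ?case using hom_one[OF assms(3,1,2)] hom_one[OF assms(4,1,2)] by (simp add: one_P)
  next
    case (Cons a w)
    have "[a] \<in> lists A" using Cons.hyps by simp
    then have c: "cls [a] \<in> carrier P" "cls w \<in> carrier P" using cls_closed Cons.hyps by blast+
    show ?case
      unfolding cls_Cons[OF Cons.hyps] hom_mult[OF assms(3) c] hom_mult[OF assms(4) c] Cons.IH
        assms(5)[OF Cons.hyps(1)] ..
  qed
  then show ?thesis using w(2) by simp
qed

end

section \<open>Free groups\<close>

definition free_relations :: "'a set \<Rightarrow> (('a \<times> bool) list \<times> ('a \<times> bool) list) set" where
  "free_relations S = {([(s, b), (s, \<not> b)], []) | s b. s \<in> S}"

lemma free_group_eq: "free_group S = presented_monoid (S \<times> UNIV) (free_relations S)"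
  by (simp add: free_group_def free_relations_def)

definition free_gen :: "'a set \<Rightarrow> 'a \<Rightarrow> ('a \<times> bool) list set" where
  "free_gen S s = word_class (S \<times> UNIV) (free_relations S) [(s, True)]"

lemma presentation_free_group:
  "presentation (S \<times> UNIV) (free_relations S)"
  by unfold_locales (auto simp: free_relations_def)

lemma group_free_group: "group (free_group (S :: 'a set))"
proof -
  interpret presentation "S \<times> UNIV" "free_relations S"
    by (rule presentation_free_group)
  show ?thesis
    unfolding free_group_eq
  proof (rule group_P)
    fix a :: "'a \<times> bool" assume "a \<in> S \<times> UNIV"
    then obtain s b where a: "a = (s, b)" "s \<in> S" by auto
    have "([(s, \<not> b), (s, \<not> \<not> b)], []) \<in> (free_relations S)" using a unfolding free_relations_def by blast
    from cls_relation[OF this] show "\<exists>w\<in>lists (S \<times> UNIV). cls (w @ [a]) = cls []"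
      using a by (intro bexI[of _ "[(s, \<not> b)]"]) auto
  qed
qed

lemma free_gen_closed: "s \<in> S \<Longrightarrow> free_gen S s \<in> carrier (free_group S)"
proof -
  interpret presentation "S \<times> UNIV" "free_relations S"
    by (rule presentation_free_group)
  show "s \<in> S \<Longrightarrow> ?thesis" unfolding free_gen_def free_group_eq by (rule cls_closed) simp
qed

lemma free_group_hom_exists:
  assumes H: "group H" and f: "\<And>s. s \<in> S \<Longrightarrow> f s \<in> carrier H"
  shows "\<exists>\<Phi>\<in>hom (free_group S) H. \<forall>s\<in>S. \<Phi> (free_gen S s) = f s"
proof -
  interpret H: group H by fact
  interpret presentation "S \<times> UNIV" "free_relations S"
    by (rule presentation_free_group)
  let ?f = "\<lambda>(s, b). if b then f s else inv\<^bsub>H\<^esub> f s"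
  have "\<exists>\<Phi>\<in>hom P H. \<forall>a\<in>S \<times> UNIV. \<Phi> (cls [a]) = ?f a"
    by (rule universal_P[OF H]) (auto simp: free_relations_def eval_word_def f split: if_splits)
  then obtain \<Phi> where \<Phi>: "\<Phi> \<in> hom P H" "\<forall>a\<in>S \<times> UNIV. \<Phi> (cls [a]) = ?f a" by blast
  have "\<Phi> (free_gen S s) = f s" if "s \<in> S" for s
    using bspec[OF \<Phi>(2), of "(s, True)"] that unfolding free_gen_def by simp
  then show ?thesis using \<Phi>(1) unfolding free_group_eq by blast
qed

lemma free_group_hom_unique:
  fixes S :: "'a set"
  assumes H: "group H" and \<Phi>: "\<Phi> \<in> hom (free_group S) H" "\<Psi> \<in> hom (free_group S) H"
    and eq: "\<And>s. s \<in> S \<Longrightarrow> \<Phi> (free_gen S s) = \<Psi> (free_gen S s)" and "x \<in> carrier (free_group S)"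
  shows "\<Phi> x = \<Psi> x"
proof -
  interpret presentation "S \<times> UNIV" "free_relations S"
    by (rule presentation_free_group)
  interpret F: group P by (rule group_free_group[of S, unfolded free_group_eq])
  interpret H: group H by fact
  interpret \<Phi>: group_hom P H \<Phi> by unfold_locales (rule \<Phi>(1)[unfolded free_group_eq])
  interpret \<Psi>: group_hom P H \<Psi> by unfold_locales (rule \<Phi>(2)[unfolded free_group_eq])
  show ?thesis
  proof (rule unique_P[OF F.is_group H \<Phi>.homh \<Psi>.homh])
    fix a :: "'a \<times> bool" assume "a \<in> S \<times> UNIV"
    then obtain s b where a: "a = (s, b)" "s \<in> S" by auto
    have g: "cls [(s, True)] \<in> carrier P" using a by (intro cls_closed) auto
    have eq': "\<Phi> (cls [(s, True)]) = \<Psi> (cls [(s, True)])" using eq[OF a(2)] by (simp add: free_gen_def)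
    have "([(s, False), (s, \<not> False)], []) \<in> (free_relations S)" using a unfolding free_relations_def by blast
    from cls_relation[OF this] have "cls [(s, False)] \<otimes>\<^bsub>P\<^esub> cls [(s, True)] = \<one>\<^bsub>P\<^esub>"
      using a by (simp add: mult_P one_P)
    then have "cls [(s, False)] = inv\<^bsub>P\<^esub> cls [(s, True)]"
      using F.inv_equality[OF _ g cls_closed[of "[(s, False)]"]] a by simp
    then show "\<Phi> (cls [a]) = \<Psi> (cls [a])" using a eq' g by (cases b) simp_all
  qed (rule assms(5)[unfolded free_group_eq])
qed

section \<open>Free products\<close>

lemma Inl_in_Plus_iff [simp]: "Inl x \<in> A <+> B \<longleftrightarrow> x \<in> A"
  and Inr_in_Plus_iff [simp]: "Inr y \<in> A <+> B \<longleftrightarrow> y \<in> B"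
  by auto

locale group_pair = G: group G + H: group H
  for G :: "('a, 'c) monoid_scheme" and H :: "('b, 'd) monoid_scheme"
begin

definition relations :: "(('a + 'b) list \<times> ('a + 'b) list) set" where
  "relations = {([Inl x, Inl y], [Inl (x \<otimes>\<^bsub>G\<^esub> y)]) | x y. x \<in> carrier G \<and> y \<in> carrier G}
      \<union> {([Inr x, Inr y], [Inr (x \<otimes>\<^bsub>H\<^esub> y)]) | x y. x \<in> carrier H \<and> y \<in> carrier H}
      \<union> {([Inl \<one>\<^bsub>G\<^esub>], []), ([Inr \<one>\<^bsub>H\<^esub>], [])}"

sublocale presentation "carrier G <+> carrier H" relations
  by unfold_locales (auto simp: relations_def)

lemma free_product_eq: "free_product G H = P"
  by (simp add: free_product_def relations_def)

definition inl :: "'a \<Rightarrow> ('a + 'b) list set" where "inl x = cls [Inl x]"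
definition inr :: "'b \<Rightarrow> ('a + 'b) list set" where "inr x = cls [Inr x]"

lemma inl_closed: "x \<in> carrier G \<Longrightarrow> inl x \<in> carrier P"
  and inr_closed: "y \<in> carrier H \<Longrightarrow> inr y \<in> carrier P"
  by (auto simp: inl_def inr_def intro!: cls_closed)

lemma inl_hom: "inl \<in> hom G P"
proof (rule homI)
  fix x y assume xy: "x \<in> carrier G" "y \<in> carrier G"
  then have "([Inl x, Inl y], [Inl (x \<otimes>\<^bsub>G\<^esub> y)]) \<in> relations" by (auto simp: relations_def)
  from cls_relation[OF this] show "inl (x \<otimes>\<^bsub>G\<^esub> y) = inl x \<otimes>\<^bsub>P\<^esub> inl y"
    using xy by (simp add: inl_def mult_P)
qed (rule inl_closed)

lemma inr_hom: "inr \<in> hom H P"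
proof (rule homI)
  fix x y assume xy: "x \<in> carrier H" "y \<in> carrier H"
  then have "([Inr x, Inr y], [Inr (x \<otimes>\<^bsub>H\<^esub> y)]) \<in> relations" by (auto simp: relations_def)
  from cls_relation[OF this] show "inr (x \<otimes>\<^bsub>H\<^esub> y) = inr x \<otimes>\<^bsub>P\<^esub> inr y"
    using xy by (simp add: inr_def mult_P)
qed (rule inr_closed)

lemma inl_one: "inl \<one>\<^bsub>G\<^esub> = \<one>\<^bsub>P\<^esub>" and inr_one: "inr \<one>\<^bsub>H\<^esub> = \<one>\<^bsub>P\<^esub>"
  unfolding inl_def inr_def one_P by (rule cls_relation, simp add: relations_def)+

lemma group_free_product: "group P"
proof (rule group_P)
  fix a assume "a \<in> carrier G <+> carrier H"
  then consider x where "a = Inl x" "x \<in> carrier G" | y where "a = Inr y" "y \<in> carrier H" by auto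
  then show "\<exists>w\<in>lists (carrier G <+> carrier H). cls (w @ [a]) = cls []"
  proof cases
    case 1
    then have "inl (inv\<^bsub>G\<^esub> x) \<otimes>\<^bsub>P\<^esub> inl x = \<one>\<^bsub>P\<^esub>"
      using hom_mult[OF inl_hom, of "inv\<^bsub>G\<^esub> x" x] inl_one by simp
    then show ?thesis
      using 1 by (intro bexI[of _ "[Inl (inv\<^bsub>G\<^esub> x)]"]) (auto simp: inl_def mult_P one_P)
  next
    case 2
    then have "inr (inv\<^bsub>H\<^esub> y) \<otimes>\<^bsub>P\<^esub> inr y = \<one>\<^bsub>P\<^esub>"
      using hom_mult[OF inr_hom, of "inv\<^bsub>H\<^esub> y" y] inr_one by simp
    then show ?thesis
      using 2 by (intro bexI[of _ "[Inr (inv\<^bsub>H\<^esub> y)]"]) (auto simp: inr_def mult_P one_P)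
  qed
qed

lemma free_product_hom_exists:
  assumes Q: "group Q" and \<phi>: "\<phi> \<in> hom G Q" and \<psi>: "\<psi> \<in> hom H Q"
  shows "\<exists>\<Phi>\<in>hom P Q. (\<forall>x\<in>carrier G. \<Phi> (inl x) = \<phi> x) \<and> (\<forall>y\<in>carrier H. \<Phi> (inr y) = \<psi> y)"
proof -
  interpret Q: group Q by fact
  interpret \<phi>: group_hom G Q \<phi> by unfold_locales (rule \<phi>)
  interpret \<psi>: group_hom H Q \<psi> by unfold_locales (rule \<psi>)
  have "\<exists>\<Phi>\<in>hom P Q. \<forall>a\<in>carrier G <+> carrier H. \<Phi> (cls [a]) = case_sum \<phi> \<psi> a"
    by (rule universal_P[OF Q]) (auto simp: eval_word_def relations_def)
  then obtain \<Phi> where \<Phi>: "\<Phi> \<in> hom P Q" "\<forall>a\<in>carrier G <+> carrier H. \<Phi> (cls [a]) = case_sum \<phi> \<psi> a" by blast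
  have "\<Phi> (inl x) = \<phi> x" if "x \<in> carrier G" for x
    using bspec[OF \<Phi>(2), of "Inl x"] that unfolding inl_def by simp
  moreover have "\<Phi> (inr y) = \<psi> y" if "y \<in> carrier H" for y
    using bspec[OF \<Phi>(2), of "Inr y"] that unfolding inr_def by simp
  ultimately show ?thesis using \<Phi>(1) by blast
qed

lemma free_product_hom_unique:
  assumes Q: "group Q" and "\<Phi> \<in> hom P Q" "\<Psi> \<in> hom P Q"
    and "\<And>x. x \<in> carrier G \<Longrightarrow> \<Phi> (inl x) = \<Psi> (inl x)" "\<And>y. y \<in> carrier H \<Longrightarrow> \<Phi> (inr y) = \<Psi> (inr y)"
    and "z \<in> carrier P"
  shows "\<Phi> z = \<Psi> z"
  by (rule unique_P[OF group_free_product Q assms(2,3) _ assms(6)])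
     (use assms(4,5) in \<open>auto simp: inl_def inr_def\<close>)

end

section \<open>Trees\<close>

definition inside :: "'v sgraph \<Rightarrow> 'v set \<Rightarrow> ('v \<times> 'v) set" where
  "inside T W = {(x, y). {x, y} \<in> gedges T \<and> x \<in> W \<and> y \<in> W}"

definition connected_inside :: "'v sgraph \<Rightarrow> 'v set \<Rightarrow> bool" where
  "connected_inside T W \<longleftrightarrow> (\<forall>x\<in>W. \<forall>y\<in>W. (x, y) \<in> (inside T W)\<^sup>*)"

lemma sym_inside: "sym (inside T W)"
  by (auto simp: sym_def inside_def insert_commute)

lemma inside_sym_rtrancl: "(x, y) \<in> (inside T W)\<^sup>* \<Longrightarrow> (y, x) \<in> (inside T W)\<^sup>*"
  using sym_rtrancl[OF sym_inside] by (rule symD)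

lemma distinct_walk:
  assumes "(a, c) \<in> R\<^sup>*"
  shows "\<exists>vs. distinct vs \<and> vs \<noteq> [] \<and> hd vs = a \<and> last vs = c \<and> successively (\<lambda>x y. (x, y) \<in> R) vs \<and>
     set vs \<subseteq> insert c (Domain R)"
  using assms
proof (induction rule: converse_rtrancl_induct)
  case base
  show ?case by (rule exI[of _ "[c]"]) auto
next
  case (step a a')
  then obtain vs where vs: "distinct vs" "vs \<noteq> []" "hd vs = a'" "last vs = c"
    "successively (\<lambda>x y. (x, y) \<in> R) vs" "set vs \<subseteq> insert c (Domain R)" by blast
  show ?case
  proof (cases "a \<in> set vs")
    case True
    then obtain xs ys where "vs = xs @ a # ys" by (meson split_list)
    then show ?thesis using vs
      by (intro exI[of _ "a # ys"]) (auto simp: successively_append_iff split: if_splits)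
  next
    case False
    then show ?thesis using vs step.hyps(1)
      by (intro exI[of _ "a # vs"]) (auto simp: successively_Cons)
  qed
qed

text \<open>Two edges from a connected set to one outside vertex would close up to a cycle.\<close>

lemma tree_one_neighbour:
  assumes T: "finite_tree T" and W: "connected_inside T W" and b: "b \<notin> W"
    and a: "a \<in> W" "{a, b} \<in> gedges T" and a': "a' \<in> W" "{a', b} \<in> gedges T"
  shows "a = a'"
proof (rule ccontr)
  assume ne: "a \<noteq> a'"
  have "(a, a') \<in> (inside T W)\<^sup>*" using W a(1) a'(1) unfolding connected_inside_def by blast
  from distinct_walk[OF this] obtain vs where vs: "distinct vs" "vs \<noteq> []" "hd vs = a" "last vs = a'"
    "successively (\<lambda>x y. (x, y) \<in> inside T W) vs" "set vs \<subseteq> insert a' (Domain (inside T W))" by blast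
  have bvs: "b \<notin> set vs" using vs(6) a'(1) b by (auto simp: inside_def)
  have len: "2 \<le> length vs"
    using ne vs(2-4) by (cases vs; cases "tl vs") auto
  have "graph_cycle T (b # vs)"
    unfolding graph_cycle_def
  proof (intro conjI allI impI)
    show "3 \<le> length (b # vs)" using len by simp
    show "distinct (b # vs)" using vs(1) bvs by simp
    fix i assume i: "i < length (b # vs)"
    consider "i = 0" | "i = length vs" "i \<noteq> 0" | j where "i = Suc j" "Suc j < length vs"
      using i by (cases i) force+
    then show "{(b # vs) ! i, (b # vs) ! (Suc i mod length (b # vs))} \<in> gedges T"
    proof cases
      case 1
      then show ?thesis using len vs(2,3) a(2) by (simp add: hd_conv_nth insert_commute)
    next
      case 2
      then show ?thesis using vs(2,4) a'(2) by (simp add: last_conv_nth nth_Cons')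
    next
      case 3
      then have "(vs ! j, vs ! Suc j) \<in> inside T W"
        using vs(5) by (auto simp: successively_conv_nth)
      then show ?thesis using 3 by (simp add: inside_def)
    qed
  qed
  then show False using T by (auto simp: finite_tree_def)
qed

section \<open>Bunches of grapes\<close>

primrec stem :: "'v grape_vertex \<Rightarrow> 'v" where
  "stem (Stem v) = v"
| "stem (Tip v i b) = v"

locale normal_bunch =
  fixes T :: "'v sgraph" and l :: "'v \<Rightarrow> nat" and \<Gamma> :: "'v grape_vertex sgraph"
  assumes bunch: "bunch_of_grapes T l" and \<Gamma>: "\<Gamma> = grapes_graph T l" and normal: "normal_graph \<Gamma>"
begin

abbreviation V where "V \<equiv> gverts T"
abbreviation E where "E \<equiv> gedges T"

lemma tree: "finite_tree T" and min_model: "v \<in> V \<Longrightarrow> valency T v = 2 \<Longrightarrow> 1 \<le> l v"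
  using bunch by (auto simp: bunch_of_grapes_def)

lemma finite_V: "finite V" and V_nonempty: "V \<noteq> {}"
  using tree by (auto simp: finite_tree_def finite_simple_graph_def connected_graph_def)

lemma E_doubleton: "e \<in> E \<Longrightarrow> \<exists>a b. e = {a, b} \<and> a \<noteq> b \<and> a \<in> V \<and> b \<in> V"
proof -
  assume e: "e \<in> E"
  then have "e \<subseteq> V" "card e = 2" using tree by (auto simp: finite_tree_def finite_simple_graph_def)
  then show ?thesis by (auto simp: card_2_iff)
qed

lemma E_verts: "{a, b} \<in> E \<Longrightarrow> a \<in> V \<and> b \<in> V \<and> a \<noteq> b"
  by (drule E_doubleton) (auto simp: doubleton_eq_iff)

lemma leafless_\<Gamma>: "leafless \<Gamma>" using normal by (simp add: normal_graph_def)

lemma verts_\<Gamma> [simp]: "Stem v \<in> gverts \<Gamma> \<longleftrightarrow> v \<in> V" "Tip v i b \<in> gverts \<Gamma> \<longleftrightarrow> v \<in> V \<and> i < l v"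
  by (auto simp: \<Gamma> grapes_graph_def)

lemma edge_\<Gamma>: "e \<in> gedges \<Gamma> \<longleftrightarrow> (\<exists>a b. {a, b} \<in> E \<and> e = {Stem a, Stem b}) \<or>
    (\<exists>v i b. v \<in> V \<and> i < l v \<and> e = {Stem v, Tip v i b}) \<or>
    (\<exists>v i. v \<in> V \<and> i < l v \<and> e = {Tip v i False, Tip v i True})"
proof -
  have "e \<in> (\<lambda>e. Stem ` e) ` E \<longleftrightarrow> (\<exists>a b. {a, b} \<in> E \<and> e = {Stem a, Stem b})"
  proof
    assume "e \<in> (\<lambda>e. Stem ` e) ` E"
    then obtain e' where "e' \<in> E" "e = Stem ` e'" by blast
    then show "\<exists>a b. {a, b} \<in> E \<and> e = {Stem a, Stem b}" using E_doubleton[of e'] by fastforce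
  next
    assume "\<exists>a b. {a, b} \<in> E \<and> e = {Stem a, Stem b}"
    then obtain a b where "{a, b} \<in> E" "e = Stem ` {a, b}" by auto
    then show "e \<in> (\<lambda>e. Stem ` e) ` E" by blast
  qed
  then show ?thesis unfolding \<Gamma> grapes_graph_def by auto
qed

lemma edge_stem [simp]: "{Stem a, Stem b} \<in> gedges \<Gamma> \<longleftrightarrow> {a, b} \<in> E"
  unfolding edge_\<Gamma> by (auto simp: doubleton_eq_iff insert_commute)

lemma edge_near [simp]: "{Stem v, Tip w i b} \<in> gedges \<Gamma> \<longleftrightarrow> v = w \<and> v \<in> V \<and> i < l v"
  unfolding edge_\<Gamma> by (auto simp: doubleton_eq_iff)

lemma edge_near' [simp]: "{Tip w i b, Stem v} \<in> gedges \<Gamma> \<longleftrightarrow> v = w \<and> v \<in> V \<and> i < l v"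
  using edge_near by (simp add: insert_commute)

lemma edge_far [simp]: "{Tip v i b, Tip w j c} \<in> gedges \<Gamma> \<longleftrightarrow> v = w \<and> i = j \<and> b \<noteq> c \<and> v \<in> V \<and> i < l v"
  unfolding edge_\<Gamma> by (cases b; cases c) (auto simp: doubleton_eq_iff)

lemma finite_graph_\<Gamma>: "finite_simple_graph \<Gamma>"
proof -
  have "gverts \<Gamma> \<subseteq> Stem ` V \<union> (\<Union>v\<in>V. \<Union>i\<in>{..<l v}. {Tip v i False, Tip v i True})"
  proof
    fix x assume "x \<in> gverts \<Gamma>"
    then show "x \<in> Stem ` V \<union> (\<Union>v\<in>V. \<Union>i\<in>{..<l v}. {Tip v i False, Tip v i True})"
    proof (cases x)
      case (Tip v i b)
      with \<open>x \<in> gverts \<Gamma>\<close> have "v \<in> V" "i < l v" by auto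
      then show ?thesis using Tip by (cases b) auto
    qed auto
  qed
  moreover have "finite (Stem ` V \<union> (\<Union>v\<in>V. \<Union>i\<in>{..<l v}. {Tip v i False, Tip v i True}))"
    using finite_V by simp
  ultimately have "finite (gverts \<Gamma>)" by (rule finite_subset)
  moreover have "e \<subseteq> gverts \<Gamma> \<and> card e = 2" if e: "e \<in> gedges \<Gamma>" for e
  proof -
    consider a b where "{a, b} \<in> E" "e = {Stem a, Stem b}"
      | v i b where "v \<in> V" "i < l v" "e = {Stem v, Tip v i b}"
      | v i where "v \<in> V" "i < l v" "e = {Tip v i False, Tip v i True}"
      using e unfolding edge_\<Gamma> by blast
    then show ?thesis
      by cases (use E_verts in \<open>auto simp: card_insert_if\<close>)
  qed
  ultimately show ?thesis by (simp add: finite_simple_graph_def)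
qed

lemma edge_verts: "{x, y} \<in> gedges \<Gamma> \<Longrightarrow> x \<in> gverts \<Gamma> \<and> y \<in> gverts \<Gamma> \<and> x \<noteq> y"
  using finite_graph_\<Gamma> by (force simp: finite_simple_graph_def card_2_iff)

lemma edge_doubleton: "e \<in> gedges \<Gamma> \<Longrightarrow> \<exists>x y. e = {x, y} \<and> x \<noteq> y"
  using finite_graph_\<Gamma> by (auto simp: finite_simple_graph_def card_2_iff)

lemma finite_edges: "finite (gedges \<Gamma>)"
proof (rule finite_subset)
  show "gedges \<Gamma> \<subseteq> Pow (gverts \<Gamma>)" using finite_graph_\<Gamma> by (auto simp: finite_simple_graph_def)
  show "finite (Pow (gverts \<Gamma>))" using finite_graph_\<Gamma> by (simp add: finite_simple_graph_def)
qed

lemma finite_cells: "finite (graph_cells \<Gamma>)"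
  using finite_edges finite_graph_\<Gamma> by (simp add: graph_cells_def finite_simple_graph_def)

lemma cell_cases:
  assumes "\<sigma> \<in> graph_cells \<Gamma>"
  obtains x where "\<sigma> = {x}" "x \<in> gverts \<Gamma>" | x y where "\<sigma> = {x, y}" "x \<noteq> y" "{x, y} \<in> gedges \<Gamma>"
  using assms edge_doubleton unfolding graph_cells_def by blast

lemma doubleton_cell: "{x, y} \<in> graph_cells \<Gamma> \<longleftrightarrow> (x = y \<and> x \<in> gverts \<Gamma>) \<or> {x, y} \<in> gedges \<Gamma>"
  unfolding graph_cells_def using edge_verts[of x y] by (auto simp: doubleton_eq_iff)

lemma stem_in_V: "x \<in> gverts \<Gamma> \<Longrightarrow> stem x \<in> V"
  by (cases x) auto

lemma stem_edge: "{x, y} \<in> gedges \<Gamma> \<Longrightarrow> stem x = stem y \<or> (\<exists>a b. x = Stem a \<and> y = Stem b \<and> {a, b} \<in> E)"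
  by (cases x; cases y) auto

text \<open>A cycle on stem vertices alone would be a cycle of the tree. A cycle through a tip has two different neighbours of
  this tip, and one of them is the stem.\<close>

lemma cycle_through_grape:
  assumes c: "graph_cycle \<Gamma> vs"
  shows "\<exists>v i. v \<in> V \<and> i < l v \<and> Stem v \<in> set vs"
proof -
  let ?n = "length vs"
  have n: "3 \<le> ?n" and d: "distinct vs" and e: "\<And>i. i < ?n \<Longrightarrow> {vs ! i, vs ! (Suc i mod ?n)} \<in> gedges \<Gamma>"
    using c by (auto simp: graph_cycle_def)
  show ?thesis
  proof (cases "\<exists>x\<in>set vs. \<forall>v. x \<noteq> Stem v")
    case False
    then have "\<forall>x\<in>set vs. x = Stem (stem x)" by (metis stem.simps(1))
    then have vs: "vs = map Stem (map stem vs)" by (simp add: map_idI)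
    have "graph_cycle T (map stem vs)"
      unfolding graph_cycle_def
    proof (intro conjI allI impI)
      show "3 \<le> length (map stem vs)" using n by simp
      have "inj_on stem (set vs)"
        using \<open>\<forall>x\<in>set vs. x = Stem (stem x)\<close> by (intro inj_onI) metis
      then show "distinct (map stem vs)" using d by (simp add: distinct_map)
      fix i assume i: "i < length (map stem vs)"
      then have "Suc i mod ?n < ?n" by (intro mod_less_divisor) auto
      then have "{Stem (map stem vs ! i), Stem (map stem vs ! (Suc i mod ?n))} \<in> gedges \<Gamma>"
        using e[of i] i vs by (metis length_map nth_map)
      then show "{map stem vs ! i, map stem vs ! (Suc i mod length (map stem vs))} \<in> E" by simp
    qed
    then show ?thesis using tree by (auto simp: finite_tree_def)
  next
    case True
    then obtain k where k: "k < ?n" "\<forall>v. vs ! k \<noteq> Stem v" by (metis in_set_conv_nth)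
    then obtain v i b where t: "vs ! k = Tip v i b" by (metis grape_vertex.exhaust)
    let ?s = "Suc k mod ?n" and ?p = "(k + ?n - 1) mod ?n"
    have sp: "?s < ?n" "?p < ?n" using n by (auto intro!: mod_less_divisor)
    have "Suc ?p mod ?n = k"
    proof -
      have "Suc ?p mod ?n = Suc (k + ?n - 1) mod ?n" by (simp add: mod_Suc_eq)
      also have "Suc (k + ?n - 1) = k + ?n" using n by simp
      also have "(k + ?n) mod ?n = k" using k(1) by simp
      finally show ?thesis .
    qed
    then have e1: "{vs ! ?p, Tip v i b} \<in> gedges \<Gamma>" using e[OF sp(2)] t by simp
    have e2: "{Tip v i b, vs ! ?s} \<in> gedges \<Gamma>" using e[OF k(1)] t by simp
    have "?p \<noteq> ?s"
    proof
      assume "?p = ?s"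
      then have "(k + ?n - 1) mod ?n = Suc k mod ?n" .
      moreover have "(k + ?n - 1) mod ?n = (if k = 0 then ?n - 1 else k - 1)"
        using k(1) n by (cases k) auto
      moreover have "Suc k mod ?n = (if Suc k = ?n then 0 else Suc k)" using k(1) by simp
      ultimately show False using n k(1) by (auto split: if_splits)
    qed
    then have ne: "vs ! ?p \<noteq> vs ! ?s" using d sp by (simp add: nth_eq_iff_index_eq)
    have "vs ! ?p = Stem v \<or> vs ! ?p = Tip v i (\<not> b)" using e1 by (cases "vs ! ?p") auto
    moreover have "vs ! ?s = Stem v \<or> vs ! ?s = Tip v i (\<not> b)" using e2 by (cases "vs ! ?s") auto
    ultimately have "Stem v \<in> set vs" using ne sp nth_mem by metis
    moreover have "v \<in> V" "i < l v" using e1 edge_verts verts_\<Gamma>(2) by blast+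
    ultimately show ?thesis by blast
  qed
qed

lemma two_grapes: "\<exists>v w. v \<in> V \<and> w \<in> V \<and> v \<noteq> w \<and> 0 < l v \<and> 0 < l w"
proof -
  obtain vs ws where c: "graph_cycle \<Gamma> vs" "graph_cycle \<Gamma> ws" "set vs \<inter> set ws = {}"
    using normal by (auto simp: normal_graph_def)
  obtain v i where v: "v \<in> V" "i < l v" "Stem v \<in> set vs" using cycle_through_grape[OF c(1)] by (elim exE conjE)
  obtain w j where w: "w \<in> V" "j < l w" "Stem w \<in> set ws" using cycle_through_grape[OF c(2)] by (elim exE conjE)
  have "v \<noteq> w" using v(3) w(3) c(3) by blast
  then show ?thesis using v w by (intro exI[of _ v] exI[of _ w]) auto
qed

lemma connected_T: "a \<in> V \<Longrightarrow> b \<in> V \<Longrightarrow> (a, b) \<in> {(a, b). {a, b} \<in> E}\<^sup>*"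
  using tree by (auto simp: finite_tree_def connected_graph_def)

lemma has_neighbour: "a \<in> V \<Longrightarrow> \<exists>c. {a, c} \<in> E"
proof -
  assume a: "a \<in> V"
  obtain v w where vw: "v \<in> V" "w \<in> V" "v \<noteq> w" using two_grapes by (elim exE conjE)
  obtain b where b: "b \<in> V" "b \<noteq> a" using vw that[of v] that[of w] by (cases "v = a") auto
  from connected_T[OF a b(1)] show ?thesis
    by (rule converse_rtranclE) (use b(2) in auto)
qed
end

section \<open>The product subcomplexes of a bunch of grapes\<close>

context normal_bunch
begin

lemma valency_two_edges:
  assumes "e1 \<in> gedges H" "e2 \<in> gedges H" "v \<in> e1" "v \<in> e2" "e1 \<noteq> e2"
  shows "valency H v \<noteq> 1"
proof
  assume "valency H v = 1"
  then obtain e where e: "{e \<in> gedges H. v \<in> e} = {e}" unfolding valency_def by (rule card_1_singletonE)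
  have "e1 \<in> {e \<in> gedges H. v \<in> e}" "e2 \<in> {e \<in> gedges H. v \<in> e}" using assms by auto
  then show False using assms(5) unfolding e by simp
qed

text \<open>Such a vertex is not isolated as the tree has another vertex, not a leaf by normality, and not of valency two by
  minimality. So the loss of one edge leaves it with at least two.\<close>

lemma three_neighbours:
  assumes a: "a \<in> V" and l: "l a = 0"
  shows "finite {c. {a, c} \<in> E}" "3 \<le> card {c. {a, c} \<in> E}"
proof -
  let ?N = "{c. {a, c} \<in> E}"
  show fin: "finite ?N" by (rule finite_subset[OF _ finite_V]) (use E_verts in auto)
  have "{e \<in> E. a \<in> e} = (\<lambda>c. {a, c}) ` ?N"
  proof (intro subset_antisym subsetI)
    fix e assume e: "e \<in> {e \<in> E. a \<in> e}"
    then obtain p q where pq: "e = {p, q}" using E_doubleton[of e] by blast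
    then obtain r where "e = {a, r}" using e by (cases "a = p") (auto simp: insert_commute)
    then show "e \<in> (\<lambda>c. {a, c}) ` ?N" using e by blast
  qed auto
  moreover have "inj_on (\<lambda>c. {a, c}) ?N" by (rule inj_onI) (auto simp: doubleton_eq_iff)
  ultimately have vT: "valency T a = card ?N" unfolding valency_def by (simp add: card_image)
  have "{e \<in> gedges \<Gamma>. Stem a \<in> e} = (\<lambda>c. {Stem a, Stem c}) ` ?N"
  proof (intro subset_antisym subsetI)
    fix e assume e: "e \<in> {e \<in> gedges \<Gamma>. Stem a \<in> e}"
    then consider c d where "{c, d} \<in> E" "e = {Stem c, Stem d}" "a = c \<or> a = d"
      | i b where "i < l a" "e = {Stem a, Tip a i b}"
      unfolding mem_Collect_eq edge_\<Gamma> by auto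
    then show "e \<in> (\<lambda>c. {Stem a, Stem c}) ` ?N"
      by cases (use l in \<open>auto simp: insert_commute\<close>)
  qed auto
  moreover have "inj_on (\<lambda>c. {Stem a, Stem c}) ?N" by (rule inj_onI) (auto simp: doubleton_eq_iff)
  ultimately have "valency \<Gamma> (Stem a) = card ?N" unfolding valency_def by (simp add: card_image)
  then have "card ?N \<noteq> 1" using leafless_\<Gamma> a by (auto simp: leafless_def)
  moreover have "card ?N \<noteq> 2" using min_model[OF a] l vT by auto
  moreover have "card ?N \<noteq> 0" using has_neighbour[OF a] fin by auto
  ultimately show "3 \<le> card ?N" by linarith
qed

definition over :: "'v set \<Rightarrow> 'v grape_vertex sgraph" where
  "over W = \<lparr>gverts = {x \<in> gverts \<Gamma>. stem x \<in> W}, gedges = {e \<in> gedges \<Gamma>. stem ` e \<subseteq> W}\<rparr>"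

lemma over_simps [simp]: "gverts (over W) = {x \<in> gverts \<Gamma>. stem x \<in> W}"
  "gedges (over W) = {e \<in> gedges \<Gamma>. stem ` e \<subseteq> W}"
  by (simp_all add: over_def)

lemma is_subgraph_over: "is_subgraph (over W) \<Gamma>"
  using finite_graph_\<Gamma> by (auto simp: is_subgraph_def finite_simple_graph_def)

lemma connected_over:
  assumes W: "W \<subseteq> V" "W \<noteq> {}" "connected_inside T W"
  shows "connected_graph (over W)"
proof -
  let ?R = "{(a, b). {a, b} \<in> gedges (over W)}"
  have "sym ?R" by (auto simp: sym_def insert_commute)
  have sym: "(x, y) \<in> ?R\<^sup>* \<Longrightarrow> (y, x) \<in> ?R\<^sup>*" for x y by (rule symD[OF sym_rtrancl[OF \<open>sym ?R\<close>]])
  have stems: "(Stem a, Stem b) \<in> ?R\<^sup>*" if "(a, b) \<in> (inside T W)\<^sup>*" for a b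
    using that
  proof (induction rule: rtrancl_induct)
    case (step b c)
    then have "(Stem b, Stem c) \<in> ?R" by (auto simp: inside_def)
    with step.IH show ?case by (rule rtrancl_into_rtrancl)
  qed simp
  have to_stem: "(x, Stem (stem x)) \<in> ?R\<^sup>*" if "x \<in> gverts (over W)" for x
    using that by (cases x) (auto intro!: r_into_rtrancl)
  show ?thesis
    unfolding connected_graph_def
  proof (intro conjI ballI)
    obtain a where "a \<in> W" using W(2) by blast
    then have "Stem a \<in> gverts (over W)" using W(1) by auto
    then show "gverts (over W) \<noteq> {}" by blast
    fix x y assume xy: "x \<in> gverts (over W)" "y \<in> gverts (over W)"
    then have "(stem x, stem y) \<in> (inside T W)\<^sup>*" using W(3) by (auto simp: connected_inside_def)
    from rtrancl_trans[OF to_stem[OF xy(1)] rtrancl_trans[OF stems[OF this] sym[OF to_stem[OF xy(2)]]]]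
    show "(x, y) \<in> ?R\<^sup>*" .
  qed
qed

lemma stem_two_edges:
  assumes W: "W \<subseteq> V" and out: "\<And>c d. \<lbrakk>{a, c} \<in> E; {a, d} \<in> E; c \<notin> W; d \<notin> W\<rbrakk> \<Longrightarrow> c = d" and a: "a \<in> W"
  obtains e1 e2 where "e1 \<in> gedges (over W)" "e2 \<in> gedges (over W)" "Stem a \<in> e1" "Stem a \<in> e2" "e1 \<noteq> e2"
proof (cases "l a = 0")
  case False
  show thesis
    by (rule that[of "{Stem a, Tip a 0 True}" "{Stem a, Tip a 0 False}"])
       (use a W False in \<open>auto simp: doubleton_eq_iff\<close>)
next
  case True
  let ?N = "{c. {a, c} \<in> E}"
  have N: "finite ?N" "3 \<le> card ?N" using three_neighbours[OF _ True] a W by auto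
  have "card (?N - W) \<le> 1"
    by (rule card_le_Suc0_iff_eq[THEN iffD2, folded One_nat_def]) (use N(1) out in auto)
  moreover have "card ?N = card (?N \<inter> W) + card (?N - W)"
    using card_Int_Diff[OF N(1)] by simp
  ultimately have "2 \<le> card (?N \<inter> W)" using N(2) by linarith
  then obtain S where S: "S \<subseteq> ?N \<inter> W" "card S = 2" by (rule obtain_subset_with_card_n)
  then obtain c d where "S = {c, d}" "c \<noteq> d" by (auto simp: card_2_iff)
  then have "c \<in> ?N \<inter> W" "d \<in> ?N \<inter> W" "c \<noteq> d" using S(1) by auto
  then show thesis
    by (intro that[of "{Stem a, Stem c}" "{Stem a, Stem d}"]) (use a in \<open>auto simp: doubleton_eq_iff\<close>)
qed

lemma good_over:
  assumes W: "W \<subseteq> V" "W \<noteq> {}" "connected_inside T W"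
    and out: "\<And>a c d. \<lbrakk>a \<in> W; {a, c} \<in> E; {a, d} \<in> E; c \<notin> W; d \<notin> W\<rbrakk> \<Longrightarrow> c = d"
  shows "is_subgraph (over W) \<Gamma> \<and> connected_graph (over W) \<and> leafless (over W) \<and> gedges (over W) \<noteq> {}"
proof (intro conjI)
  show "is_subgraph (over W) \<Gamma>" by (rule is_subgraph_over)
  show "connected_graph (over W)" by (rule connected_over[OF W])
  obtain a where a: "a \<in> W" using W(2) by blast
  obtain e1 e2 where "e1 \<in> gedges (over W)" "e2 \<in> gedges (over W)" "Stem a \<in> e1" "Stem a \<in> e2" "e1 \<noteq> e2"
    by (rule stem_two_edges[OF W(1) out[OF a] a])
  then show "gedges (over W) \<noteq> {}" by blast
  show "leafless (over W)"
    unfolding leafless_def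
  proof
    fix x assume x: "x \<in> gverts (over W)"
    show "valency (over W) x \<noteq> 1"
    proof (cases x)
      case (Stem a)
      then have "a \<in> W" using x by simp
      obtain e1 e2 where "e1 \<in> gedges (over W)" "e2 \<in> gedges (over W)" "Stem a \<in> e1" "Stem a \<in> e2" "e1 \<noteq> e2"
        by (rule stem_two_edges[OF W(1) out[OF \<open>a \<in> W\<close>] \<open>a \<in> W\<close>])
      then show ?thesis unfolding Stem by (rule valency_two_edges)
    next
      case (Tip v i b)
      show ?thesis
        by (rule valency_two_edges[of "{Stem v, Tip v i b}" _ "{Tip v i b, Tip v i (\<not> b)}"])
           (use x Tip in \<open>auto simp: doubleton_eq_iff\<close>)
    qed
  qed
qed

text \<open>A tip has only two neighbours, its stem and the other tip of the grape. Without the stem it is a leaf.\<close>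

lemma leafless_contains_stem:
  assumes H: "is_subgraph H \<Gamma>" "connected_graph H" "leafless H" "gedges H \<noteq> {}" and x: "x \<in> gverts H"
  shows "Stem (stem x) \<in> gverts H"
proof (cases x)
  case (Stem v)
  then show ?thesis using x by simp
next
  case (Tip v i b)
  obtain e where e: "e \<in> gedges H" using H(4) by blast
  then have "e \<in> gedges \<Gamma>" "e \<subseteq> gverts H" using H(1) by (auto simp: is_subgraph_def)
  then obtain y where y: "y \<in> gverts H" "y \<noteq> x" using edge_doubleton[of e] by auto
  have "(x, y) \<in> {(a, b). {a, b} \<in> gedges H}\<^sup>*" using H(2) x y unfolding connected_graph_def by blast
  then obtain z where z: "{x, z} \<in> gedges H" by (rule converse_rtranclE) (use y in auto)
  show ?thesis
  proof (rule ccontr)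
    assume no: "\<not> ?thesis"
    have "e = {x, Tip v i (\<not> b)}" if eH: "e \<in> gedges H" "x \<in> e" for e
    proof -
      have e: "e \<in> gedges \<Gamma>" "e \<subseteq> gverts H" using eH H(1) by (auto simp: is_subgraph_def)
      then obtain p q where "e = {p, q}" using edge_doubleton by blast
      then obtain w where w: "e = {x, w}" using eH(2) by auto
      have "w \<noteq> Stem v" using no e(2) w Tip by auto
      then show ?thesis using e(1) unfolding w Tip by (cases w) auto
    qed
    then have "e = {x, z}" if "e \<in> gedges H" "x \<in> e" for e
      using that z by (metis insertI1)
    then have "{e \<in> gedges H. x \<in> e} \<subseteq> {{x, z}}" by blast
    moreover have "{{x, z}} \<subseteq> {e \<in> gedges H. x \<in> e}" using z by blast
    ultimately have "{e \<in> gedges H. x \<in> e} = {{x, z}}" by (rule subset_antisym)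
    then have "valency H x = 1" by (simp add: valency_def)
    then show False using H(3) x by (simp add: leafless_def)
  qed
qed

lemma cell_subset_verts: "\<sigma> \<in> graph_cells H \<Longrightarrow> is_subgraph H \<Gamma> \<Longrightarrow> \<sigma> \<subseteq> gverts H \<and> \<sigma> \<in> graph_cells \<Gamma>"
  by (auto simp: graph_cells_def is_subgraph_def)

lemma stem_cell:
  assumes "\<sigma> \<in> graph_cells \<Gamma>"
  shows "stem ` \<sigma> \<noteq> {}" "stem ` \<sigma> \<subseteq> V" "connected_inside T (stem ` \<sigma>)"
proof -
  have "stem ` \<sigma> \<noteq> {} \<and> stem ` \<sigma> \<subseteq> V \<and> connected_inside T (stem ` \<sigma>)"
    using assms
  proof (cases rule: cell_cases)
    case (1 x)
    then show ?thesis using stem_in_V by (auto simp: connected_inside_def)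
  next
    case (2 x y)
    have V: "stem x \<in> V" "stem y \<in> V" using 2(3) edge_verts stem_in_V by blast+
    have "stem x = stem y \<or> {stem x, stem y} \<in> E" using stem_edge[OF 2(3)] by auto
    then have "connected_inside T {stem x, stem y}"
    proof
      assume "{stem x, stem y} \<in> E"
      then have "(stem x, stem y) \<in> inside T {stem x, stem y}" "(stem y, stem x) \<in> inside T {stem x, stem y}"
        by (auto simp: inside_def insert_commute)
      then show ?thesis unfolding connected_inside_def by blast
    qed (simp add: connected_inside_def)
    then show ?thesis using V 2(1) by simp
  qed
  then show "stem ` \<sigma> \<noteq> {}" "stem ` \<sigma> \<subseteq> V" "connected_inside T (stem ` \<sigma>)" by auto
qed

text \<open>Take for \<open>W\<close> everything that can be reached from \<open>A\<close> without meeting \<open>B\<close>. A path from a vertex outside \<open>W\<close> to \<open>B\<close>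
  cannot enter \<open>W\<close> before it meets \<open>B\<close>, so the complement is connected through \<open>B\<close>.\<close>

lemma separate:
  assumes A: "A \<subseteq> V" "A \<noteq> {}" "connected_inside T A" and B: "B \<subseteq> V" "B \<noteq> {}" "connected_inside T B"
    and AB: "A \<inter> B = {}"
  obtains W where "A \<subseteq> W" "W \<subseteq> V" "B \<subseteq> V - W" "connected_inside T W" "connected_inside T (V - W)"
    "\<And>a c. \<lbrakk>a \<in> W; {a, c} \<in> E; c \<notin> W\<rbrakk> \<Longrightarrow> c \<in> B"
proof -
  define W where "W = {x \<in> V - B. \<exists>a\<in>A. (a, x) \<in> (inside T (V - B))\<^sup>*}"
  have AW: "A \<subseteq> W" using A(1) AB by (auto simp: W_def)
  have WV: "W \<subseteq> V" by (auto simp: W_def)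
  have BW: "B \<subseteq> V - W" using B(1) by (auto simp: W_def)
  have mono: "inside T S \<subseteq> inside T S'" if "S \<subseteq> S'" for S S' using that by (auto simp: inside_def)
  have reach: "(a, x) \<in> (inside T W)\<^sup>* \<and> x \<in> W" if "(a, x) \<in> (inside T (V - B))\<^sup>*" "a \<in> A" for a x
    using that(1)
  proof (induction rule: rtrancl_induct)
    case base
    then show ?case using AW that(2) by auto
  next
    case (step x y)
    have "(a, y) \<in> (inside T (V - B))\<^sup>*" using step.hyps by (rule rtrancl_into_rtrancl)
    moreover have "y \<in> V - B" using step.hyps(2) by (simp add: inside_def)
    ultimately have y: "y \<in> W" using that(2) by (auto simp: W_def)
    then have "(x, y) \<in> inside T W" using step.IH step.hyps(2) by (simp add: inside_def)
    then show ?case using step.IH y by (auto intro: rtrancl_into_rtrancl)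
  qed
  have W: "connected_inside T W"
    unfolding connected_inside_def
  proof (intro ballI)
    fix x y assume "x \<in> W" "y \<in> W"
    then obtain a b where ab: "a \<in> A" "(a, x) \<in> (inside T (V - B))\<^sup>*" "b \<in> A" "(b, y) \<in> (inside T (V - B))\<^sup>*"
      by (auto simp: W_def)
    have "(a, b) \<in> (inside T W)\<^sup>*"
      using A(3) ab rtrancl_mono[OF mono[OF AW]] by (auto simp: connected_inside_def)
    then show "(x, y) \<in> (inside T W)\<^sup>*"
      using rtrancl_trans[OF inside_sym_rtrancl[OF conjunct1[OF reach[OF ab(2,1)]]]
          rtrancl_trans[OF _ conjunct1[OF reach[OF ab(4,3)]]]] by simp
  qed
  have boundary: "c \<in> B" if a: "a \<in> W" and e: "{a, c} \<in> E" and c: "c \<notin> W" for a c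
  proof (rule ccontr)
    assume cB: "c \<notin> B"
    obtain a0 where a0: "a0 \<in> A" "(a0, a) \<in> (inside T (V - B))\<^sup>*" using a by (auto simp: W_def)
    have "(a, c) \<in> inside T (V - B)" using a e cB E_verts[OF e] by (auto simp: inside_def W_def)
    with a0(2) have "(a0, c) \<in> (inside T (V - B))\<^sup>*" by (rule rtrancl_into_rtrancl)
    then show False using reach a0(1) c by blast
  qed
  obtain b0 where b0: "b0 \<in> B" using B(2) by blast
  have to_B: "x \<in> V - W \<Longrightarrow> \<exists>b\<in>B. (x, b) \<in> (inside T (V - W))\<^sup>*" if "(x, b0) \<in> {(a, b). {a, b} \<in> E}\<^sup>*" for x
    using that
  proof (induction rule: converse_rtrancl_induct)
    case base
    then show ?case using b0 by blast
  next
    case (step x y)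
    show ?case
    proof (cases "x \<in> B")
      case False
      have e: "{x, y} \<in> E" using step.hyps(1) by simp
      have "y \<notin> W"
      proof
        assume "y \<in> W"
        then show False using boundary[of y x] e step.prems False by (auto simp: insert_commute)
      qed
      then have y: "y \<in> V - W" using E_verts[OF e] by simp
      then obtain b where "b \<in> B" "(y, b) \<in> (inside T (V - W))\<^sup>*" using step.IH by blast
      moreover have "(x, y) \<in> inside T (V - W)" using e y step.prems by (simp add: inside_def)
      ultimately show ?thesis by (intro bexI[of _ b] converse_rtrancl_into_rtrancl[of x y])
    qed blast
  qed
  have "connected_inside T (V - W)"
    unfolding connected_inside_def
  proof (intro ballI)
    fix x y assume xy: "x \<in> V - W" "y \<in> V - W"
    have "(x, b0) \<in> {(a, b). {a, b} \<in> E}\<^sup>*" "(y, b0) \<in> {(a, b). {a, b} \<in> E}\<^sup>*"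
      using connected_T xy b0 B(1) by auto
    then obtain b c where bc: "b \<in> B" "(x, b) \<in> (inside T (V - W))\<^sup>*" "c \<in> B" "(y, c) \<in> (inside T (V - W))\<^sup>*"
      using to_B[OF _ xy(1)] to_B[OF _ xy(2)] by blast
    have "(b, c) \<in> (inside T (V - W))\<^sup>*"
      using B(3) bc rtrancl_mono[OF mono[OF BW]] by (auto simp: connected_inside_def)
    from rtrancl_trans[OF bc(2) rtrancl_trans[OF this inside_sym_rtrancl[OF bc(4)]]]
    show "(x, y) \<in> (inside T (V - W))\<^sup>*" .
  qed
  then show thesis by (rule that[OF AW WV BW W]) (rule boundary)
qed

text \<open>For the inclusion from right to left, a tree that is cut into two connected parts loses a single edge, so
  no vertex loses more than one edge, and both parts remain leafless.\<close>

lemma UP2_\<Gamma>: "UP2 \<Gamma> = {{\<sigma>, \<tau>} | \<sigma> \<tau>. \<sigma> \<in> graph_cells \<Gamma> \<and> \<tau> \<in> graph_cells \<Gamma> \<and> stem ` \<sigma> \<inter> stem ` \<tau> = {}}"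
proof (intro subset_antisym subsetI)
  fix c assume "c \<in> UP2 \<Gamma>"
  then obtain G1 G2 where G: "c \<in> product_subcomplex G1 G2"
     "is_subgraph G1 \<Gamma>" "connected_graph G1" "leafless G1" "gedges G1 \<noteq> {}"
     "is_subgraph G2 \<Gamma>" "connected_graph G2" "leafless G2" "gedges G2 \<noteq> {}" "gverts G1 \<inter> gverts G2 = {}"
    unfolding UP2_def maximal_product_subcomplexes_def standard_product_subcomplexes_def by blast
  then obtain \<sigma> \<tau> where c: "c = {\<sigma>, \<tau>}" "\<sigma> \<in> graph_cells G1" "\<tau> \<in> graph_cells G2"
    unfolding product_subcomplex_def by blast
  note sub = cell_subset_verts[OF c(2) G(2)] cell_subset_verts[OF c(3) G(6)]
  have "stem ` \<sigma> \<inter> stem ` \<tau> = {}"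
  proof (rule ccontr)
    assume "stem ` \<sigma> \<inter> stem ` \<tau> \<noteq> {}"
    then obtain x y where xy: "x \<in> \<sigma>" "y \<in> \<tau>" "stem x = stem y" by blast
    have "x \<in> gverts G1" "y \<in> gverts G2" using xy sub by auto
    then have "Stem (stem x) \<in> gverts G1" "Stem (stem x) \<in> gverts G2"
      using leafless_contains_stem[OF G(2-5), of x] leafless_contains_stem[OF G(6-9), of y] xy(3) by simp_all
    then show False using G(10) by blast
  qed
  then show "c \<in> {{\<sigma>, \<tau>} | \<sigma> \<tau>. \<sigma> \<in> graph_cells \<Gamma> \<and> \<tau> \<in> graph_cells \<Gamma> \<and> stem ` \<sigma> \<inter> stem ` \<tau> = {}}"
    using c(1) sub by blast
next
  fix c assume "c \<in> {{\<sigma>, \<tau>} | \<sigma> \<tau>. \<sigma> \<in> graph_cells \<Gamma> \<and> \<tau> \<in> graph_cells \<Gamma> \<and> stem ` \<sigma> \<inter> stem ` \<tau> = {}}"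
  then obtain \<sigma> \<tau> where c: "c = {\<sigma>, \<tau>}" "\<sigma> \<in> graph_cells \<Gamma>" "\<tau> \<in> graph_cells \<Gamma>" "stem ` \<sigma> \<inter> stem ` \<tau> = {}"
    by blast
  note s = stem_cell[OF c(2)] and t = stem_cell[OF c(3)]
  obtain W where W: "stem ` \<sigma> \<subseteq> W" "W \<subseteq> V" "stem ` \<tau> \<subseteq> V - W" "connected_inside T W" "connected_inside T (V - W)"
    "\<And>a c. \<lbrakk>a \<in> W; {a, c} \<in> E; c \<notin> W\<rbrakk> \<Longrightarrow> c \<in> stem ` \<tau>"
    by (rule separate[OF s(2,1,3) t(2,1,3) c(4)]) blast
  have g1: "is_subgraph (over W) \<Gamma> \<and> connected_graph (over W) \<and> leafless (over W) \<and> gedges (over W) \<noteq> {}"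
  proof (rule good_over[OF W(2) _ W(4)])
    show "W \<noteq> {}" using W(1) s(1) by blast
    fix a d e assume a: "a \<in> W" "{a, d} \<in> E" "{a, e} \<in> E" "d \<notin> W" "e \<notin> W"
    show "d = e"
      using tree_one_neighbour[OF tree t(3), of a d e] W(3) a W(6)[OF a(1,2,4)] W(6)[OF a(1,3,5)]
      by (auto simp: insert_commute)
  qed
  have g2: "is_subgraph (over (V - W)) \<Gamma> \<and> connected_graph (over (V - W)) \<and> leafless (over (V - W)) \<and> gedges (over (V - W)) \<noteq> {}"
  proof (rule good_over[OF _ _ W(5)])
    show "V - W \<subseteq> V" by blast
    show "V - W \<noteq> {}" using W(3) t(1) by blast
    fix a d e assume a: "a \<in> V - W" "{a, d} \<in> E" "{a, e} \<in> E" "d \<notin> V - W" "e \<notin> V - W"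
    have "d \<in> W" "e \<in> W" using a E_verts[OF a(2)] E_verts[OF a(3)] by auto
    then show "d = e"
      using tree_one_neighbour[OF tree W(4), of a d e] a by (auto simp: insert_commute)
  qed
  have "product_subcomplex (over W) (over (V - W)) \<in> standard_product_subcomplexes \<Gamma>"
    unfolding standard_product_subcomplexes_def using g1 g2 by (intro CollectI exI conjI refl) auto
  moreover have "finite (standard_product_subcomplexes \<Gamma>)"
  proof (rule finite_subset)
    show "standard_product_subcomplexes \<Gamma> \<subseteq> Pow (Pow (graph_cells \<Gamma>))"
      unfolding standard_product_subcomplexes_def product_subcomplex_def
      using cell_subset_verts by blast
    show "finite (Pow (Pow (graph_cells \<Gamma>)))" using finite_cells by simp
  qed
  ultimately have "\<exists>P\<in>standard_product_subcomplexes \<Gamma>. product_subcomplex (over W) (over (V - W)) \<subseteq> P \<and>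
      (\<forall>Q\<in>standard_product_subcomplexes \<Gamma>. P \<subseteq> Q \<longrightarrow> P = Q)"
    by (rule finite_has_maximal2[rotated])
  then obtain P where P: "P \<in> standard_product_subcomplexes \<Gamma>"
      "product_subcomplex (over W) (over (V - W)) \<subseteq> P"
      "\<forall>Q\<in>standard_product_subcomplexes \<Gamma>. P \<subseteq> Q \<longrightarrow> P = Q"
    by (elim bexE conjE)
  have "P \<in> maximal_product_subcomplexes \<Gamma>"
    unfolding maximal_product_subcomplexes_def using P(1,3) by (intro CollectI conjI)
  moreover have "c \<in> product_subcomplex (over W) (over (V - W))"
  proof -
    have "\<sigma> \<in> graph_cells (over W)" using c(2) W(1) by (auto simp: graph_cells_def)
    moreover have "\<tau> \<in> graph_cells (over (V - W))" using c(3) W(3) by (auto simp: graph_cells_def)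
    ultimately show ?thesis unfolding product_subcomplex_def c(1) by blast
  qed
  ultimately show "c \<in> UP2 \<Gamma>" using P(2) unfolding UP2_def by blast
qed

end

section \<open>Configuration spaces and subcomplexes as models\<close>

lemma graph_cell_subset:
  assumes G: "finite_simple_graph G" and "\<sigma> \<in> graph_cells G" "\<rho> \<subseteq> \<sigma>" "\<rho> \<noteq> {}"
  shows "\<rho> \<in> graph_cells G"
proof -
  consider v where "\<sigma> = {v}" "v \<in> gverts G" | "\<sigma> \<in> gedges G" using assms(2) by (auto simp: graph_cells_def)
  then show ?thesis
  proof cases
    case 1
    then have "\<rho> = \<sigma>" using assms(3,4) by auto
    then show ?thesis using assms(2) by simp
  next
    case 2
    then have "\<sigma> \<subseteq> gverts G" "card \<sigma> = 2" using G by (auto simp: finite_simple_graph_def)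
    then obtain x y where xy: "\<sigma> = {x, y}" "x \<in> gverts G" "y \<in> gverts G" by (auto simp: card_2_iff)
    then have "\<rho> = {x} \<or> \<rho> = {y} \<or> \<rho> = \<sigma>" using assms(3,4) by auto
    then show ?thesis using xy assms(2) by (auto simp: graph_cells_def)
  qed
qed

lemma UD2_iff: "{\<sigma>, \<tau>} \<in> UD2 G \<longleftrightarrow> \<sigma> \<in> graph_cells G \<and> \<tau> \<in> graph_cells G \<and> \<sigma> \<inter> \<tau> = {}"
  unfolding UD2_def by (auto simp: doubleton_eq_iff)

text \<open>Moving \<open>x\<close> into a face where it dominates \<open>y\<close>, and \<open>y\<close> into a face where it dominates \<open>x\<close>, only increases the difference
  at a vertex of the first face, so the points never meet.\<close>

lemma pos_mix:
  assumes "x' \<in> realize_cell A" "A \<subseteq> pos x y" "y' \<in> realize_cell B" "B \<subseteq> pos y x" "0 \<le> t" "t \<le> 1"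
  shows "mix t x x' \<noteq> mix t y y'"
proof -
  have "\<exists>v\<in>A. x' v \<noteq> 0"
  proof (rule ccontr)
    assume "\<not> ?thesis"
    then have "(\<Sum>v\<in>A. x' v) = 0" by simp
    then show False using assms(1) by (simp add: realize_cell_def)
  qed
  then obtain v where v0: "v \<in> A" "x' v \<noteq> 0" by blast
  have "0 \<le> x' v" using assms(1) by (simp add: realize_cell_def)
  then have v: "v \<in> A" "x' v > 0" using v0 by auto
  then have lt: "y v < x v" using assms(2) by (auto simp: pos_def)
  then have "v \<notin> B" using assms(4) by (auto simp: pos_def)
  then have "y' v = 0" using assms(3) by (auto simp: realize_cell_def)
  then have "mix t x x' v - mix t y y' v = (1 - t) * (x v - y v) + t * x' v"
    by (simp add: mix_def algebra_simps)
  moreover have "(1 - t) * (x v - y v) + t * x' v > 0"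
  proof (cases "t = 1")
    case False
    then have "(1 - t) * (x v - y v) > 0" using lt assms(6) by simp
    then show ?thesis using v(2) assms(5) by (simp add: add_pos_nonneg)
  qed (use v in simp)
  ultimately show ?thesis by force
qed

lemma cell_in_topspace_UC:
  assumes "{\<sigma>, \<tau>} \<in> UD2 G" and xy: "x \<in> realize_cell \<sigma>" "y \<in> realize_cell \<tau>"
  shows "{x, y} \<in> topspace (UC G)"
proof -
  have c: "\<sigma> \<in> graph_cells G" "\<tau> \<in> graph_cells G" "\<sigma> \<inter> \<tau> = {}" using assms(1) unfolding UD2_iff by auto
  have "x \<noteq> y" by (rule disjoint_cells_distinct[OF xy c(3)])
  moreover have "x \<in> realize_points G" "y \<in> realize_points G" using c(1,2) xy by (auto simp: realize_points_def)
  ultimately show ?thesis by (simp add: in_topspace_UC)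
qed

lemma configuration_model_UC:
  assumes G: "finite_simple_graph G"
  shows "configuration_model G (topspace (UC G)) (UD2 G)"
proof
  show "finite_simple_graph G" by fact
  fix x y assume xy: "{x, y} \<in> topspace (UC G)"
  then obtain \<sigma> \<tau> where st: "\<sigma> \<in> graph_cells G" "x \<in> realize_cell \<sigma>" "\<tau> \<in> graph_cells G" "y \<in> realize_cell \<tau>" "x \<noteq> y"
    by (auto simp: in_topspace_UC realize_points_def)
  note fin = finite_graph_cell[OF G st(1)] finite_graph_cell[OF G st(3)]
  note ps = pos_subset_cell[OF st(2,4)] pos_subset_cell[OF st(4,2)]
  have "pos x y \<in> graph_cells G" "pos y x \<in> graph_cells G"
    using graph_cell_subset[OF G st(1) ps(1)] graph_cell_subset[OF G st(3) ps(2)]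
      pos_nonempty[OF st(2,4) fin(1,3) st(5)] pos_nonempty[OF st(4,2) fin(3,1)] st(5) by auto
  moreover have "pos x y \<inter> pos y x = {}" by (auto simp: pos_def)
  ultimately have "{pos x y, pos y x} \<in> UD2 G" unfolding UD2_iff by (intro conjI)
  then show "\<exists>\<sigma> \<tau>. {\<sigma>, \<tau>} \<in> UD2 G \<and> pos x y \<subseteq> \<sigma> \<and> pos y x \<subseteq> \<tau>" by blast
  fix x' A y' B and t :: real
  assume p: "x' \<in> realize_cell A" "finite A" "A \<subseteq> pos x y" "y' \<in> realize_cell B" "finite B" "B \<subseteq> pos y x" "0 \<le> t" "t \<le> 1"
  have "x' \<in> realize_cell \<sigma>" "y' \<in> realize_cell \<tau>"
    using realize_cell_mono[OF fin(1), of A] realize_cell_mono[OF fin(3), of B] p ps by blast+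
  then have "mix t x x' \<in> realize_cell \<sigma>" "mix t y y' \<in> realize_cell \<tau>"
    using st p(7,8) by (auto intro: mix_in_realize_cell)
  then have "mix t x x' \<in> realize_points G" "mix t y y' \<in> realize_points G"
    using st(1,3) by (auto simp: realize_points_def)
  then show "{mix t x x', mix t y y'} \<in> topspace (UC G)"
    using pos_mix[OF p(1,3,4,6-8)] by (simp add: in_topspace_UC)
next
  fix \<sigma> \<tau> x y assume c: "{\<sigma>, \<tau>} \<in> UD2 G"
  then show "finite \<sigma> \<and> finite \<tau> \<and> \<sigma> \<inter> \<tau> = {}"
    unfolding UD2_iff using finite_graph_cell[OF G] by simp
  assume xy: "x \<in> realize_cell \<sigma>" "y \<in> realize_cell \<tau>"
  show "{x, y} \<in> topspace (UC G)" by (rule cell_in_topspace_UC[OF c xy])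
qed simp

lemma realize_square_cellE:
  assumes "z \<in> (\<Union>c\<in>K. realize_square_cell c)"
  obtains x y \<sigma> \<tau> where "z = {x, y}" "{\<sigma>, \<tau>} \<in> K" "x \<in> realize_cell \<sigma>" "y \<in> realize_cell \<tau>"
  using assms unfolding realize_square_cell_def by blast

lemma realize_square_cellI:
  "\<lbrakk>{\<sigma>, \<tau>} \<in> K; x \<in> realize_cell \<sigma>; y \<in> realize_cell \<tau>\<rbrakk> \<Longrightarrow> {x, y} \<in> (\<Union>c\<in>K. realize_square_cell c)"
  unfolding realize_square_cell_def by blast

lemma configuration_model_subcomplex:
  assumes G: "finite_simple_graph G" and K: "K \<subseteq> UD2 G"
  shows "configuration_model G (\<Union>c\<in>K. realize_square_cell c) K"
proof
  show "finite_simple_graph G" by fact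
  show sub: "(\<Union>c\<in>K. realize_square_cell c) \<subseteq> topspace (UC G)"
  proof
    fix z assume "z \<in> (\<Union>c\<in>K. realize_square_cell c)"
    then obtain x y \<sigma> \<tau> where z: "z = {x, y}" "{\<sigma>, \<tau>} \<in> K" "x \<in> realize_cell \<sigma>" "y \<in> realize_cell \<tau>"
      by (rule realize_square_cellE)
    have "{\<sigma>, \<tau>} \<in> UD2 G" using z(2) K by (rule subsetD[rotated])
    then show "z \<in> topspace (UC G)" unfolding z(1) by (rule cell_in_topspace_UC[OF _ z(3,4)])
  qed
  fix x y assume "{x, y} \<in> (\<Union>c\<in>K. realize_square_cell c)"
  then obtain a b \<sigma>' \<tau>' where z: "{x, y} = {a, b}" "{\<sigma>', \<tau>'} \<in> K" "a \<in> realize_cell \<sigma>'" "b \<in> realize_cell \<tau>'"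
    by (rule realize_square_cellE)
  have "\<exists>\<sigma> \<tau>. {\<sigma>, \<tau>} \<in> K \<and> x \<in> realize_cell \<sigma> \<and> y \<in> realize_cell \<tau>"
  proof (cases "x = a \<and> y = b")
    case True
    then show ?thesis using z(2-4) by (intro exI[of _ \<sigma>'] exI[of _ \<tau>']) simp
  next
    case False
    then have "x = b" "y = a" using z(1) by (auto simp: doubleton_eq_iff)
    then show ?thesis using z(2-4) by (intro exI[of _ \<tau>'] exI[of _ \<sigma>']) (simp add: insert_commute)
  qed
  then obtain \<sigma> \<tau> where st: "{\<sigma>, \<tau>} \<in> K" "x \<in> realize_cell \<sigma>" "y \<in> realize_cell \<tau>" by (elim exE conjE)
  note ps = pos_subset_cell[OF st(2,3)] pos_subset_cell[OF st(3,2)]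
  show "\<exists>\<sigma> \<tau>. {\<sigma>, \<tau>} \<in> K \<and> pos x y \<subseteq> \<sigma> \<and> pos y x \<subseteq> \<tau>" using st(1) ps by blast
  have "{\<sigma>, \<tau>} \<in> UD2 G" using st(1) K by blast
  then have fin: "finite \<sigma>" "finite \<tau>" unfolding UD2_iff using finite_graph_cell[OF G] by auto
  fix x' A y' B and t :: real
  assume p: "x' \<in> realize_cell A" "finite A" "A \<subseteq> pos x y" "y' \<in> realize_cell B" "finite B" "B \<subseteq> pos y x" "0 \<le> t" "t \<le> 1"
  have "x' \<in> realize_cell \<sigma>" "y' \<in> realize_cell \<tau>"
    using realize_cell_mono[OF fin(1), of A] realize_cell_mono[OF fin(2), of B] p ps by blast+
  then show "{mix t x x', mix t y y'} \<in> (\<Union>c\<in>K. realize_square_cell c)"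
    using st p(7,8) by (intro realize_square_cellI[OF st(1)] mix_in_realize_cell)
next
  fix \<sigma> \<tau> x y assume c: "{\<sigma>, \<tau>} \<in> K"
  then have "{\<sigma>, \<tau>} \<in> UD2 G" using K by blast
  then show "finite \<sigma> \<and> finite \<tau> \<and> \<sigma> \<inter> \<tau> = {}"
    unfolding UD2_iff using finite_graph_cell[OF G] by simp
  assume xy: "x \<in> realize_cell \<sigma>" "y \<in> realize_cell \<tau>"
  show "{x, y} \<in> (\<Union>c\<in>K. realize_square_cell c)" by (rule realize_square_cellI[OF c xy])
qed

definition moves :: "'v set set set \<Rightarrow> ('v set \<times> 'v set) set" where
  "moves K = {(p, q). \<exists>u u' w. p = {u', w} \<and> q = {u, w} \<and> u' \<noteq> u \<and>
     {{u}, {w}} \<in> K \<and> {{u'}, {w}} \<in> K \<and> {{u', u}, {w}} \<in> K}"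

context configuration_model
begin

text \<open>Breadth first search: the parent is a neighbour at smaller distance from the root.\<close>

lemma spanning_tree:
  assumes conn: "\<And>u w. {{u}, {w}} \<in> K \<Longrightarrow> (b, {u, w}) \<in> (moves K)\<^sup>*"
  shows "\<exists>par (rank :: 'v set \<Rightarrow> nat). \<forall>u w. {{u}, {w}} \<in> K \<longrightarrow> {u, w} \<noteq> b \<longrightarrow>
     (\<exists>v' v s. {u, w} = {v, s} \<and> tree_edge b par v' v s \<and> rank {v', s} < rank {v, s})"
proof -
  define rank where "rank p = (LEAST n. (b, p) \<in> moves K ^^ n)" for p
  define par where "par p = (SOME q. (q, p) \<in> moves K \<and> rank q < rank p)" for p
  have "\<exists>v' v s. {u, w} = {v, s} \<and> tree_edge b par v' v s \<and> rank {v', s} < rank {v, s}"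
    if uw: "{{u}, {w}} \<in> K" "{u, w} \<noteq> b" for u w
  proof -
    let ?p = "{u, w}"
    obtain n where n: "(b, ?p) \<in> moves K ^^ n" using conn[OF uw(1)] rtrancl_imp_relpow by blast
    have r: "(b, ?p) \<in> moves K ^^ rank ?p" unfolding rank_def by (rule LeastI[of _ n]) (rule n)
    obtain m where m: "rank ?p = Suc m"
      using r uw(2) by (cases "rank ?p") auto
    obtain q where q: "(b, q) \<in> moves K ^^ m" "(q, ?p) \<in> moves K" using r unfolding m by (rule relpow_Suc_E)
    have "rank q \<le> m" unfolding rank_def by (rule Least_le) (rule q(1))
    then have "(q, ?p) \<in> moves K \<and> rank q < rank ?p" using q(2) m by simp
    then have par: "(par ?p, ?p) \<in> moves K \<and> rank (par ?p) < rank ?p" unfolding par_def by (rule someI)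
    then obtain v v' s where e: "par ?p = {v', s}" "?p = {v, s}" "v' \<noteq> v"
      "{{v}, {s}} \<in> K" "{{v'}, {s}} \<in> K" "{{v', v}, {s}} \<in> K" unfolding moves_def by blast
    have "tree_edge b par v' v s"
    proof -
      have "{v, s} \<noteq> b" using uw(2) unfolding e(2) .
      moreover have "par {v, s} = {v', s}" using e(1) unfolding e(2) .
      ultimately show ?thesis unfolding tree_edge_def using e(3-6) by (intro conjI)
    qed
    moreover have "rank {v', s} < rank {v, s}" using par unfolding e(1) unfolding e(2) by (rule conjunct2)
    ultimately show ?thesis using e(2) by (intro exI[of _ v'] exI[of _ v] exI[of _ s] conjI)
  qed
  then show ?thesis by blast
qed

end

context normal_bunch
begin

lemma UP2_iff: "{\<sigma>, \<tau>} \<in> UP2 \<Gamma> \<longleftrightarrow> \<sigma> \<in> graph_cells \<Gamma> \<and> \<tau> \<in> graph_cells \<Gamma> \<and> stem ` \<sigma> \<inter> stem ` \<tau> = {}"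
  unfolding UP2_\<Gamma> by (auto simp: doubleton_eq_iff)

lemma UP2_cases:
  assumes "c \<in> UP2 \<Gamma>"
  obtains \<sigma> \<tau> where "c = {\<sigma>, \<tau>}" "{\<sigma>, \<tau>} \<in> UP2 \<Gamma>" "\<sigma> \<in> graph_cells \<Gamma>" "\<tau> \<in> graph_cells \<Gamma>" "stem ` \<sigma> \<inter> stem ` \<tau> = {}"
proof -
  obtain \<sigma> \<tau> where "c = {\<sigma>, \<tau>}" using assms unfolding UP2_\<Gamma> by blast
  then show thesis using that assms UP2_iff[of \<sigma> \<tau>] by simp
qed

lemma UP2_subset: "UP2 \<Gamma> \<subseteq> UD2 \<Gamma>"
proof
  fix c assume "c \<in> UP2 \<Gamma>"
  then obtain \<sigma> \<tau> where c: "c = {\<sigma>, \<tau>}" "\<sigma> \<in> graph_cells \<Gamma>" "\<tau> \<in> graph_cells \<Gamma>" "stem ` \<sigma> \<inter> stem ` \<tau> = {}"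
    by (rule UP2_cases)
  then have "\<sigma> \<inter> \<tau> = {}" by blast
  then show "c \<in> UD2 \<Gamma>" unfolding c(1) UD2_iff using c by simp
qed

lemma UP2_face:
  assumes "e \<in> UD2 \<Gamma>" "c \<in> UP2 \<Gamma>" "face_of_cell e c"
  shows "e \<in> UP2 \<Gamma>"
proof -
  obtain \<sigma> \<tau> \<sigma>' \<tau>' where f: "e = {\<sigma>, \<tau>}" "c = {\<sigma>', \<tau>'}" "\<sigma> \<subseteq> \<sigma>'" "\<tau> \<subseteq> \<tau>'"
    using assms(3) unfolding face_of_cell_def by (elim exE conjE)
  have "\<sigma> \<in> graph_cells \<Gamma>" "\<tau> \<in> graph_cells \<Gamma>" using assms(1) unfolding f UD2_iff by auto
  moreover have "stem ` \<sigma>' \<inter> stem ` \<tau>' = {}" using assms(2) unfolding f UP2_iff by auto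
  then have "stem ` \<sigma> \<inter> stem ` \<tau> = {}" using f(3,4) by blast
  ultimately show ?thesis unfolding f UP2_iff by simp
qed

lemma cell_dim_doubleton:
  assumes "\<sigma> \<in> graph_cells \<Gamma>" "\<sigma> \<inter> \<tau> = {}"
  shows "cell_dim {\<sigma>, \<tau>} = (card \<sigma> - 1) + (card \<tau> - 1)"
proof -
  have "\<sigma> \<noteq> \<tau>" using finite_graph_cell[OF finite_graph_\<Gamma> assms(1)] assms(2) by auto
  then show ?thesis by (simp add: cell_dim_def)
qed

lemma edge_cell_through:
  assumes "\<sigma> \<in> graph_cells \<Gamma>" "x \<in> \<sigma>" "card \<sigma> = 2"
  shows "\<exists>x'. \<sigma> = {x, x'} \<and> {x, x'} \<in> gedges \<Gamma>"
  using assms(1)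
proof (cases rule: cell_cases)
  case (2 p q)
  then have "\<sigma> = {q, p}" "{q, p} \<in> gedges \<Gamma>" by (simp_all add: insert_commute)
  show ?thesis
  proof (cases "x = p")
    case True
    then show ?thesis using 2 by (intro exI[of _ q] conjI) simp_all
  next
    case False
    then have "x = q" using 2 assms(2) by simp
    then show ?thesis using \<open>\<sigma> = {q, p}\<close> \<open>{q, p} \<in> gedges \<Gamma>\<close> by (intro exI[of _ p] conjI) simp_all
  qed
qed (use assms(3) in simp)

text \<open>A cell of \<open>UD2\<close> at a vertex \<open>{x, y}\<close> belongs to \<open>UP2\<close> as soon as its edges at this vertex do. The only question is a
  square with corners \<open>{x, y}\<close> and \<open>{x', y'}\<close>, where \<open>x'\<close> and \<open>y'\<close> might have the same stem; but then both would be stem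
  vertices, hence equal.\<close>

lemma locally_convex_UP2: "locally_convex (UP2 \<Gamma>) (UD2 \<Gamma>)"
  unfolding locally_convex_def
proof (intro conjI ballI impI)
  show "UP2 \<Gamma> \<subseteq> UD2 \<Gamma>" by (rule UP2_subset)
  fix p assume p: "p \<in> UP2 \<Gamma>" "cell_dim p = 0"
  let ?s = "\<lambda>K c. {e \<in> K. cell_dim e = 1 \<and> face_of_cell p e \<and> face_of_cell e c}"
  have same: "?s (UP2 \<Gamma>) c = ?s (UD2 \<Gamma>) c" if "c \<in> UP2 \<Gamma>" for c
    using UP2_face[OF _ that] UP2_subset by blast
  have linkI: "?s (UD2 \<Gamma>) c \<in> link (UP2 \<Gamma>) p" if "c \<in> UP2 \<Gamma>" "face_of_cell p c" for c
    unfolding link_def same[OF that(1), symmetric] using that by blast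
  have "link (UP2 \<Gamma>) p \<subseteq> link (UD2 \<Gamma>) p"
  proof
    fix s assume "s \<in> link (UP2 \<Gamma>) p"
    then obtain c where c: "s = ?s (UP2 \<Gamma>) c" "c \<in> UP2 \<Gamma>" "face_of_cell p c" unfolding link_def by blast
    then show "s \<in> link (UD2 \<Gamma>) p" unfolding link_def c(1) same[OF c(2)] using UP2_subset by blast
  qed
  moreover have "s \<in> link (UP2 \<Gamma>) p" if s: "s \<in> link (UD2 \<Gamma>) p" "s \<subseteq> \<Union>(link (UP2 \<Gamma>) p)" for s
  proof -
    have "\<Union>(link (UP2 \<Gamma>) p) \<subseteq> UP2 \<Gamma>" unfolding link_def by blast
    with s(2) have sU: "s \<subseteq> UP2 \<Gamma>" by blast
    obtain c where c: "s = ?s (UD2 \<Gamma>) c" "c \<in> UD2 \<Gamma>" "face_of_cell p c" using s(1) unfolding link_def by blast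
    obtain \<alpha> \<beta> where ab: "p = {\<alpha>, \<beta>}" "\<alpha> \<in> graph_cells \<Gamma>" "\<beta> \<in> graph_cells \<Gamma>" "stem ` \<alpha> \<inter> stem ` \<beta> = {}"
      by (rule UP2_cases[OF p(1)])
    have dis: "\<alpha> \<inter> \<beta> = {}" using ab(4) by blast
    have "card \<alpha> \<le> 1" "card \<beta> \<le> 1" using p(2) cell_dim_doubleton[OF ab(2) dis] unfolding ab(1) by auto
    then obtain x y where xy: "\<alpha> = {x}" "\<beta> = {y}"
      using ab(2,3) by (elim cell_cases) auto
    have sxy: "stem x \<noteq> stem y" using ab(4) xy by auto
    obtain \<sigma> \<tau> where st: "c = {\<sigma>, \<tau>}" "x \<in> \<sigma>" "y \<in> \<tau>"
    proof -
      obtain a b \<sigma> \<tau> where f: "{{x}, {y}} = {a, b}" "c = {\<sigma>, \<tau>}" "a \<subseteq> \<sigma>" "b \<subseteq> \<tau>"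
        using c(3) unfolding ab(1) xy face_of_cell_def by (elim exE conjE)
      then consider "a = {x}" "b = {y}" | "a = {y}" "b = {x}" by (auto simp: doubleton_eq_iff)
      then show thesis
        by cases (use f that[of \<sigma> \<tau>] that[of \<tau> \<sigma>] in \<open>auto simp: insert_commute\<close>)
    qed
    have C: "\<sigma> \<in> graph_cells \<Gamma>" "\<tau> \<in> graph_cells \<Gamma>" "\<sigma> \<inter> \<tau> = {}" using c(2) unfolding st(1) UD2_iff by auto
    have V: "{x} \<in> graph_cells \<Gamma>" "{y} \<in> graph_cells \<Gamma>" using ab xy by auto
    \<comment> \<open>Each edge of \<open>c\<close> at \<open>p\<close> lies in the subcomplex.\<close>
    have edge: "{\<sigma>', \<tau>'} \<in> UP2 \<Gamma>"
      if "\<sigma>' \<in> graph_cells \<Gamma>" "\<tau>' \<in> graph_cells \<Gamma>" "x \<in> \<sigma>'" "y \<in> \<tau>'" "\<sigma>' \<subseteq> \<sigma>" "\<tau>' \<subseteq> \<tau>" "card \<sigma>' + card \<tau>' = 3" for \<sigma>' \<tau>'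
    proof -
      have d: "\<sigma>' \<inter> \<tau>' = {}" using that C(3) by blast
      have pos: "card \<sigma>' > 0" "card \<tau>' > 0"
        using that(3,4) finite_graph_cell(1)[OF finite_graph_\<Gamma> that(1)] finite_graph_cell(1)[OF finite_graph_\<Gamma> that(2)]
        by (auto simp: card_gt_0_iff)
      have "cell_dim {\<sigma>', \<tau>'} = 1" using cell_dim_doubleton[OF that(1) d] that(7) pos by linarith
      moreover have "{\<sigma>', \<tau>'} \<in> UD2 \<Gamma>" unfolding UD2_iff using that d by simp
      moreover have "face_of_cell p {\<sigma>', \<tau>'}" unfolding face_of_cell_def ab(1) xy using that by blast
      moreover have "face_of_cell {\<sigma>', \<tau>'} c" unfolding face_of_cell_def st(1) using that by blast
      ultimately have "{\<sigma>', \<tau>'} \<in> s" unfolding c(1) by simp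
      then show ?thesis using sU by blast
    qed
    have sing: "card \<sigma> = 2 \<or> \<sigma> = {x}" "card \<tau> = 2 \<or> \<tau> = {y}"
      using C(1,2) st(2,3) by (auto elim!: cell_cases simp: card_insert_if)
    have "c \<in> UP2 \<Gamma>"
    proof (cases "card \<sigma> = 2 \<and> card \<tau> = 2")
      case False
      then consider "\<sigma> = {x}" "\<tau> = {y}" | "\<sigma> = {x}" "card \<tau> = 2" | "card \<sigma> = 2" "\<tau> = {y}" using sing by blast
      then show ?thesis
      proof cases
        case 1
        then show ?thesis using p(1) st(1) ab(1) xy by simp
      next
        case 2
        then show ?thesis using edge[of \<sigma> \<tau>] C st by simp
      next
        case 3
        then show ?thesis using edge[of \<sigma> \<tau>] C st by simp
      qed
    next
      case True
      have e1: "{\<sigma>, {y}} \<in> UP2 \<Gamma>" by (rule edge) (use True C V st in auto)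
      have e2: "{{x}, \<tau>} \<in> UP2 \<Gamma>" by (rule edge) (use True C V st in auto)
      obtain x' where x': "\<sigma> = {x, x'}" "{x, x'} \<in> gedges \<Gamma>"
        using edge_cell_through[OF C(1) st(2)] True by blast
      obtain y' where y': "\<tau> = {y, y'}" "{y, y'} \<in> gedges \<Gamma>"
        using edge_cell_through[OF C(2) st(3)] True by blast
      have n: "stem x' \<noteq> stem y" "stem y' \<noteq> stem x" using e1 e2 unfolding UP2_iff x' y' by auto
      have "stem x' \<noteq> stem y'"
      proof
        assume eq: "stem x' = stem y'"
        obtain a where "x' = Stem a" using stem_edge[OF x'(2)] eq n by auto
        moreover obtain b where "y' = Stem b" using stem_edge[OF y'(2)] eq n by auto
        ultimately have "x' = y'" using eq by simp
        then show False using C(3) x' y' by auto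
      qed
      then show ?thesis unfolding st(1) UP2_iff using C(1,2) n sxy by (auto simp: x'(1) y'(1))
    qed
    then show ?thesis unfolding c(1) using linkI c(3) by blast
  qed
  ultimately show "full_subcomplex (link (UP2 \<Gamma>) p) (link (UD2 \<Gamma>) p)" unfolding full_subcomplex_def by blast
qed

lemma UP2_vertex [simp]: "{{x}, {y}} \<in> UP2 \<Gamma> \<longleftrightarrow> x \<in> gverts \<Gamma> \<and> y \<in> gverts \<Gamma> \<and> stem x \<noteq> stem y"
  unfolding UP2_iff using doubleton_cell[of x x] doubleton_cell[of y y] edge_verts[of x x] edge_verts[of y y] by auto

lemma UP2_edge: "{{x, x'}, {y}} \<in> UP2 \<Gamma> \<longleftrightarrow> {x, x'} \<in> graph_cells \<Gamma> \<and> y \<in> gverts \<Gamma> \<and> stem x \<noteq> stem y \<and> stem x' \<noteq> stem y"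
  unfolding UP2_iff using doubleton_cell[of y y] edge_verts[of y y] by auto

lemma UP2_moveI:
  assumes "{x, x'} \<in> gedges \<Gamma>" "y \<in> gverts \<Gamma>" "stem x \<noteq> stem y" "stem x' \<noteq> stem y"
  shows "({x, y}, {x', y}) \<in> moves (UP2 \<Gamma>)"
proof -
  have "x \<noteq> x'" "{{x'}, {y}} \<in> UP2 \<Gamma>" "{{x}, {y}} \<in> UP2 \<Gamma>" "{{x, x'}, {y}} \<in> UP2 \<Gamma>"
    using assms edge_verts[OF assms(1)] by (auto simp: UP2_edge doubleton_cell)
  then show ?thesis unfolding moves_def by blast
qed

text \<open>Configurations of two adjacent stem vertices are connected along the tree, since one of the points can give way
  to let an edge turn around a vertex. Every other configuration is first moved to the stems and then closer together.\<close>

lemma UP2_connected: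
  assumes e0: "{a0, b0} \<in> E" and "{{x}, {y}} \<in> UP2 \<Gamma>"
  shows "({Stem a0, Stem b0}, {x, y}) \<in> (moves (UP2 \<Gamma>))\<^sup>*"
proof -
  let ?M = "(moves (UP2 \<Gamma>))\<^sup>*" and ?b = "{Stem a0, Stem b0}"
  have mv: "({Stem p, Stem r}, {Stem q, Stem r}) \<in> ?M" if "{p, q} \<in> E" "r \<in> V" "p \<noteq> r" "q \<noteq> r" for p q r
    by (rule r_into_rtrancl[OF UP2_moveI]) (use that in auto)
  have share: "({Stem p, Stem m}, {Stem m, Stem q}) \<in> ?M" if "{p, m} \<in> E" "{m, q} \<in> E" for p m q
  proof (cases "p = q")
    case False
    have v: "p \<in> V" "m \<in> V" "q \<in> V" "p \<noteq> m" "m \<noteq> q" using E_verts[OF that(1)] E_verts[OF that(2)] by auto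
    have "({Stem m, Stem p}, {Stem q, Stem p}) \<in> ?M" by (rule mv) (use that v False in auto)
    moreover have "({Stem p, Stem q}, {Stem m, Stem q}) \<in> ?M" by (rule mv) (use that v False in auto)
    ultimately show ?thesis by (simp add: insert_commute rtrancl_trans)
  qed (simp add: insert_commute)
  have edges: "(?b, {Stem a, Stem c}) \<in> ?M" if "(a0, a) \<in> {(a, b). {a, b} \<in> E}\<^sup>*" "{a, c} \<in> E" for a c
    using that
  proof (induction arbitrary: c rule: rtrancl_induct)
    case base
    then show ?case using share[of b0 a0 c] e0 by (simp add: insert_commute)
  next
    case (step a a')
    then have "(?b, {Stem a, Stem a'}) \<in> ?M" by simp
    also have "({Stem a, Stem a'}, {Stem a', Stem c}) \<in> ?M" by (rule share) (use step in auto)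
    finally show ?case .
  qed
  have a0: "a0 \<in> V" using E_verts[OF e0] by simp
  have stems: "a \<noteq> c \<Longrightarrow> (?b, {Stem a, Stem c}) \<in> ?M" if "(c, a) \<in> {(a, b). {a, b} \<in> E}\<^sup>*" "c \<in> V" for a c
    using that
  proof (induction rule: rtrancl_induct)
    case (step a' a)
    then have e: "{a', a} \<in> E" by simp
    show ?case
    proof (cases "a' = c")
      case True
      then show ?thesis using edges[OF connected_T[OF a0 step.prems(2)], of a] e by (simp add: insert_commute)
    next
      case False
      then have "(?b, {Stem a', Stem c}) \<in> ?M" using step by simp
      also have "({Stem a', Stem c}, {Stem a, Stem c}) \<in> ?M" by (rule mv[OF e step.prems(2) False step.prems(1)])
      finally show ?thesis .
    qed
  qed simp
  have drop: "({Stem (stem x), y}, {x, y}) \<in> ?M" if "x \<in> gverts \<Gamma>" "y \<in> gverts \<Gamma>" "stem x \<noteq> stem y" for x y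
  proof (cases x)
    case (Tip v i s)
    show ?thesis
      by (rule r_into_rtrancl[OF UP2_moveI]) (use that Tip in auto)
  qed simp
  have xy: "x \<in> gverts \<Gamma>" "y \<in> gverts \<Gamma>" "stem x \<noteq> stem y" using assms(2) by auto
  have sV: "stem x \<in> V" "stem y \<in> V" using xy stem_in_V by auto
  have "(?b, {Stem (stem x), Stem (stem y)}) \<in> ?M" by (rule stems[OF connected_T[OF sV(2,1)] sV(2) xy(3)])
  also have "({Stem (stem x), Stem (stem y)}, {Stem (stem x), y}) \<in> ?M"
    using drop[of y "Stem (stem x)"] xy sV by (simp add: insert_commute)
  also have "({Stem (stem x), y}, {x, y}) \<in> ?M" using drop[of x y] xy by simp
  finally show ?thesis .
qed

end

section \<open>Moves inside the clusters\<close>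

text \<open>The two ways from a corner of a square to the opposite one have equal labels, so the diagonal can be labelled
  by the way on which the first point moves first.\<close>

lemma cell_cocycle_of_moves:
  assumes H: "group H" and G: "finite_simple_graph G"
    and closed: "\<And>u u' w. \<lbrakk>{u, u'} \<in> gedges G; w \<in> gverts G; w \<noteq> u; w \<noteq> u'\<rbrakk> \<Longrightarrow> st u u' w \<in> carrier H"
    and st_refl: "\<And>u w. st u u w = \<one>\<^bsub>H\<^esub>"
    and st_inv: "\<And>u u' w. \<lbrakk>{u, u'} \<in> gedges G; w \<in> gverts G; w \<noteq> u; w \<noteq> u'\<rbrakk> \<Longrightarrow> st u u' w \<otimes>\<^bsub>H\<^esub> st u' u w = \<one>\<^bsub>H\<^esub>"
    and square: "\<And>u u' w w'. \<lbrakk>{u, u'} \<in> gedges G; {w, w'} \<in> gedges G; {u, u'} \<inter> {w, w'} = {}\<rbrakk> \<Longrightarrow>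
        st u u' w \<otimes>\<^bsub>H\<^esub> st w w' u' = st w w' u \<otimes>\<^bsub>H\<^esub> st u u' w'"
  shows "cell_cocycle H (UD2 G) (\<lambda>p q. st (fst p) (fst q) (snd p) \<otimes>\<^bsub>H\<^esub> st (snd p) (snd q) (fst q))"
proof -
  interpret H: group H by fact
  have two: "(u = u' \<and> u \<in> gverts G) \<or> {u, u'} \<in> gedges G" if s: "\<sigma> \<in> graph_cells G" "u \<in> \<sigma>" "u' \<in> \<sigma>" for \<sigma> u u'
  proof -
    consider x where "\<sigma> = {x}" "x \<in> gverts G" | "\<sigma> \<in> gedges G" using s(1) by (auto simp: graph_cells_def)
    then show ?thesis
    proof cases
      case 1
      then show ?thesis using s by simp
    next
      case 2
      then have c: "\<sigma> \<subseteq> gverts G" "card \<sigma> = 2" using G by (auto simp: finite_simple_graph_def)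
      show ?thesis
      proof (cases "u = u'")
        case False
        then have "\<sigma> = {u, u'}" using s(2,3) c(2) by (auto simp: card_2_iff)
        then show ?thesis using 2 by simp
      qed (use c s(2) in auto)
    qed
  qed
  have vert: "u \<in> gverts G" if "\<sigma> \<in> graph_cells G" "u \<in> \<sigma>" for \<sigma> u
    using that G by (auto simp: graph_cells_def finite_simple_graph_def)
  show ?thesis
    unfolding cell_cocycle_def fst_conv snd_conv
  proof (intro allI impI ballI conjI)
    fix \<sigma> \<tau> u w u' w' assume c: "{\<sigma>, \<tau>} \<in> UD2 G" and u: "u \<in> \<sigma>" "w \<in> \<tau>" "u' \<in> \<sigma>" "w' \<in> \<tau>"
    have st: "\<sigma> \<in> graph_cells G" "\<tau> \<in> graph_cells G" "\<sigma> \<inter> \<tau> = {}" using c unfolding UD2_iff by auto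
    have cl: "st x x' y \<in> carrier H" "st y y' x \<in> carrier H"
      if "x \<in> \<sigma>" "x' \<in> \<sigma>" "y \<in> \<tau>" "y' \<in> \<tau>" for x x' y y'
    proof -
      have n: "y \<noteq> x" "y \<noteq> x'" "x \<noteq> y'" "x \<noteq> y" using that st(3) by auto
      show "st x x' y \<in> carrier H"
        using two[OF st(1) that(1,2)] closed[of x x' y] vert[OF st(2) that(3)] n st_refl by auto
      show "st y y' x \<in> carrier H"
        using two[OF st(2) that(3,4)] closed[of y y' x] vert[OF st(1) that(1)] n st_refl by auto
    qed
    have trans1: "st x x' y \<otimes>\<^bsub>H\<^esub> st x' x'' y = st x x'' y" if x: "x \<in> \<sigma>" "x' \<in> \<sigma>" "x'' \<in> \<sigma>" "y \<in> \<tau>" for x x' x'' y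
    proof -
      have n: "y \<noteq> x" "y \<noteq> x'" using that st(3) by auto
      consider "x = x'" | "x' = x''" | "x \<noteq> x'" "x'' = x"
        using two[OF st(1) x(1,2)] two[OF st(1) x(2,3)] two[OF st(1) x(1,3)]
          st(1) x G by (auto simp: graph_cells_def finite_simple_graph_def card_2_iff)
      then show ?thesis
      proof cases
        case 3
        then show ?thesis using two[OF st(1) x(1,2)] st_inv[of x x' y] vert[OF st(2) x(4)] n st_refl by auto
      qed (use cl[OF x(1,2) x(4,4)] cl[OF x(2,3) x(4,4)] cl[OF x(1,3) x(4,4)] st_refl in auto)
    qed
    have trans2: "st y y' x \<otimes>\<^bsub>H\<^esub> st y' y'' x = st y y'' x" if y: "y \<in> \<tau>" "y' \<in> \<tau>" "y'' \<in> \<tau>" "x \<in> \<sigma>" for x y y' y''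
    proof -
      have n: "x \<noteq> y" "x \<noteq> y'" using that st(3) by auto
      consider "y = y'" | "y' = y''" | "y \<noteq> y'" "y'' = y"
        using two[OF st(2) y(1,2)] two[OF st(2) y(2,3)] two[OF st(2) y(1,3)]
          st(2) y G by (auto simp: graph_cells_def finite_simple_graph_def card_2_iff)
      then show ?thesis
      proof cases
        case 3
        then show ?thesis using two[OF st(2) y(1,2)] st_inv[of y y' x] vert[OF st(1) y(4)] n st_refl by auto
      qed (use cl[OF y(4,4) y(1,2)] cl[OF y(4,4) y(2,3)] cl[OF y(4,4) y(1,3)] st_refl in auto)
    qed
    have sq: "st x x' y \<otimes>\<^bsub>H\<^esub> st y y' x' = st y y' x \<otimes>\<^bsub>H\<^esub> st x x' y'"
      if x: "x \<in> \<sigma>" "x' \<in> \<sigma>" "y \<in> \<tau>" "y' \<in> \<tau>" for x x' y y'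
    proof (cases "x = x' \<or> y = y'")
      case True
      then show ?thesis using cl[OF x] cl[OF x(2,1) x(3,4)] cl[OF x(1,2) x(4,3)] st_refl by auto
    next
      case False
      then have "{x, x'} \<in> gedges G" "{y, y'} \<in> gedges G" using two[OF st(1) x(1,2)] two[OF st(2) x(3,4)] by auto
      moreover have "{x, x'} \<inter> {y, y'} = {}" using x st(3) by blast
      ultimately show ?thesis by (rule square)
    qed
    show "st u u' w \<otimes>\<^bsub>H\<^esub> st w w' u' \<in> carrier H" using cl[OF u(1,3,2,4)] cl[OF u(3,1,2,4)] by simp
    show "st w w' u \<otimes>\<^bsub>H\<^esub> st u u' w' = st u u' w \<otimes>\<^bsub>H\<^esub> st w w' u'" using sq[OF u(1,3,2,4)] by simp
    fix u'' w'' assume u'': "u'' \<in> \<sigma>" "w'' \<in> \<tau>"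
    have C: "st u u' w \<in> carrier H" "st w w' u' \<in> carrier H" "st u' u'' w' \<in> carrier H" "st w' w'' u'' \<in> carrier H"
      "st u' u'' w \<in> carrier H" "st w w' u'' \<in> carrier H"
      using cl[OF u(1,3,2,4)] cl[OF u(3,1,2,4)] cl[OF u(3) u''(1) u(4) u''(2)] cl[OF u''(1) u(3) u(4) u''(2)]
        cl[OF u(3) u''(1) u(2,4)] cl[OF u''(1) u(3) u(2,4)] by auto
    have "st u u' w \<otimes>\<^bsub>H\<^esub> st w w' u' \<otimes>\<^bsub>H\<^esub> (st u' u'' w' \<otimes>\<^bsub>H\<^esub> st w' w'' u'')
        = st u u' w \<otimes>\<^bsub>H\<^esub> (st w w' u' \<otimes>\<^bsub>H\<^esub> st u' u'' w') \<otimes>\<^bsub>H\<^esub> st w' w'' u''"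
      using C by (simp add: H.m_assoc)
    also have "st w w' u' \<otimes>\<^bsub>H\<^esub> st u' u'' w' = st u' u'' w \<otimes>\<^bsub>H\<^esub> st w w' u''"
      using sq[OF u(3) u''(1) u(2,4)] by simp
    also have "st u u' w \<otimes>\<^bsub>H\<^esub> (st u' u'' w \<otimes>\<^bsub>H\<^esub> st w w' u'') \<otimes>\<^bsub>H\<^esub> st w' w'' u''
        = (st u u' w \<otimes>\<^bsub>H\<^esub> st u' u'' w) \<otimes>\<^bsub>H\<^esub> (st w w' u'' \<otimes>\<^bsub>H\<^esub> st w' w'' u'')"
      using C by (simp add: H.m_assoc)
    also have "\<dots> = st u u'' w \<otimes>\<^bsub>H\<^esub> st w w'' u''"
      by (simp only: trans1[OF u(1,3) u''(1) u(2)] trans2[OF u(2,4) u''(2,1)])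
    finally show "st u u' w \<otimes>\<^bsub>H\<^esub> st w w' u' \<otimes>\<^bsub>H\<^esub> (st u' u'' w' \<otimes>\<^bsub>H\<^esub> st w' w'' u'') = st u u'' w \<otimes>\<^bsub>H\<^esub> st w w'' u''" .
  qed
qed

context normal_bunch
begin

text \<open>A chosen edge at each stem vertex \<open>v\<close>, through which the cluster at \<open>v\<close> is joined to \<open>UP2\<close>.\<close>

definition exit :: "'v \<Rightarrow> 'v" where "exit v = (SOME c. {v, c} \<in> E)"

lemma exit: "v \<in> V \<Longrightarrow> {v, exit v} \<in> E" "v \<in> V \<Longrightarrow> {exit v, v} \<in> E"
proof -
  assume "v \<in> V"
  then show "{v, exit v} \<in> E" unfolding exit_def by (rule someI_ex[OF has_neighbour])
  then show "{exit v, v} \<in> E" by (simp add: insert_commute)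
qed

text \<open>The triple \<open>(u, u', w)\<close> stands for the move of one point from \<open>u\<close> to \<open>u'\<close> while the other one stays at \<open>w\<close>. The label of such
  a move can be chosen freely for the entry to \<open>v\<close> through any edge other than the exit while a tip \<open>True\<close> is occupied, for
  the step to the tip \<open>False\<close> while the other tip of the same grape is occupied, and for three of the four steps to a tip of an
  earlier grape while a tip of a given later one is occupied.\<close>

definition generators :: "('v grape_vertex \<times> 'v grape_vertex \<times> 'v grape_vertex) set" where
  "generators =
     {(Stem c, Stem v, Tip v i True) | c v i. {c, v} \<in> E \<and> c \<noteq> exit v \<and> i < l v}
     \<union> {(Stem v, Tip v i False, Tip v i True) | v i. v \<in> V \<and> i < l v}
     \<union> {(Stem v, Tip v i s, Tip v j r) | v i s j r. v \<in> V \<and> i < j \<and> j < l v \<and> (s \<or> r)}"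

lemma finite_generators: "finite generators"
proof (rule finite_subset)
  show "generators \<subseteq> gverts \<Gamma> \<times> gverts \<Gamma> \<times> gverts \<Gamma>" unfolding generators_def using E_verts by auto
  show "finite (gverts \<Gamma> \<times> gverts \<Gamma> \<times> gverts \<Gamma>)" using finite_graph_\<Gamma> by (simp add: finite_simple_graph_def)
qed

lemma two_generators: "2 \<le> card generators"
proof -
  obtain v w where vw: "v \<in> V" "w \<in> V" "v \<noteq> w" "0 < l v" "0 < l w" using two_grapes by (elim exE conjE)
  let ?g = "\<lambda>v. (Stem v, Tip v 0 False, Tip v 0 True)"
  have "{?g v, ?g w} \<subseteq> generators" using vw by (auto simp: generators_def)
  from card_mono[OF finite_generators this] show ?thesis using vw(3) by simp
qed

text \<open>The tree edges from \<open>{v', s}\<close> to \<open>{v, s}\<close> inside the cluster at \<open>a\<close>: a point comes in through the exit while the other one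
  sits at a tip, and then it steps to a tip of a later grape, or to the tip \<open>True\<close> if the other one
  occupies the tip \<open>False\<close> of the same grape.\<close>

definition cluster_tree :: "'v grape_vertex \<Rightarrow> 'v grape_vertex \<Rightarrow> 'v grape_vertex \<Rightarrow> bool" where
  "cluster_tree v' v s \<longleftrightarrow> (\<exists>a i r. v' = Stem (exit a) \<and> v = Stem a \<and> s = Tip a i r \<and> a \<in> V \<and> i < l a) \<or>
     (\<exists>a i r j q. v' = Stem a \<and> v = Tip a i r \<and> s = Tip a j q \<and> a \<in> V \<and> i < l a \<and> j < l a \<and>
        (j < i \<or> (j = i \<and> r \<and> \<not> q)))"

lemma UD2_square_iff: "{{u, u'}, {w, w'}} \<in> UD2 \<Gamma> \<longleftrightarrow>
    {u, u'} \<in> graph_cells \<Gamma> \<and> {w, w'} \<in> graph_cells \<Gamma> \<and> {u, u'} \<inter> {w, w'} = {}"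
  by (rule UD2_iff)

text \<open>Every move outside \<open>UP2\<close>, the cluster trees and the generators is the last side of a square. The squares are used in
  this order: exchanging the tips of a grape while the other point sits at its stem, using the exit; entry with
  the tip \<open>False\<close> occupied; exchanging the tips of a grape while the other point sits in a later grape, then in an earlier one; and last the one remaining step between the
  tips \<open>False\<close> of two grapes.\<close>

lemma cluster_determined:
  assumes inv: "\<And>u u' w. \<lbrakk>{u, u'} \<in> gedges \<Gamma>; w \<in> gverts \<Gamma>; w \<noteq> u; w \<noteq> u'; P u u' w\<rbrakk> \<Longrightarrow> P u' u w"
    and square: "\<And>u u' w w'. \<lbrakk>{u, u'} \<in> gedges \<Gamma>; {w, w'} \<in> gedges \<Gamma>; {u, u'} \<inter> {w, w'} = {};
        P u u' w; P w w' u; P w w' u'\<rbrakk> \<Longrightarrow> P u u' w'"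
    and UP: "\<And>u u' w. \<lbrakk>{u, u'} \<in> gedges \<Gamma>; w \<in> gverts \<Gamma>; stem w \<noteq> stem u; stem w \<noteq> stem u'\<rbrakk> \<Longrightarrow> P u u' w"
    and tree: "\<And>u u' w. cluster_tree u u' w \<Longrightarrow> P u u' w"
    and gen: "\<And>u u' w. (u, u', w) \<in> generators \<Longrightarrow> P u u' w"
    and e: "{u, u'} \<in> gedges \<Gamma>" "w \<in> gverts \<Gamma>" "w \<noteq> u" "w \<noteq> u'"
  shows "P u u' w"
proof -
  have far_stem: "P (Tip v i True) (Tip v i False) (Stem v)" if v: "v \<in> V" "i < l v" for v i
  proof (rule square[of _ _ "Stem (exit v)"])
    show "P (Tip v i True) (Tip v i False) (Stem (exit v))"
      by (rule UP) (use v exit[OF v(1)] E_verts[OF exit(1)[OF v(1)]] in auto)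
    show "P (Stem (exit v)) (Stem v) (Tip v i True)" "P (Stem (exit v)) (Stem v) (Tip v i False)"
      by (rule tree; use v in \<open>auto simp: cluster_tree_def\<close>)+
  qed (use v exit[OF v(1)] in auto)
  have entryT: "P (Stem c) (Stem v) (Tip v i True)" if c: "{c, v} \<in> E" "i < l v" for c v i
  proof (cases "c = exit v")
    case True
    then show ?thesis using c E_verts[OF c(1)] by (intro tree) (auto simp: cluster_tree_def)
  next
    case False
    then show ?thesis using c by (intro gen) (auto simp: generators_def)
  qed
  have entryF: "P (Stem c) (Stem v) (Tip v i False)" if c: "{c, v} \<in> E" "i < l v" for c v i
  proof (rule square[OF _ _ _ entryT[OF c]])
    have v: "v \<in> V" "c \<in> V" "c \<noteq> v" using E_verts[OF c(1)] by auto
    show "P (Tip v i True) (Tip v i False) (Stem v)" by (rule far_stem[OF v(1) c(2)])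
    show "P (Tip v i True) (Tip v i False) (Stem c)" by (rule UP) (use v c in auto)
  qed (use c E_verts[OF c(1)] in auto)
  have entry: "P (Stem c) (Stem v) (Tip v i s)" if c: "{c, v} \<in> E" "i < l v" for c v i s
    using entryT[OF c] entryF[OF c] by (cases s) auto
  have near_same: "P (Stem v) (Tip v i s) (Tip v i (\<not> s))" if v: "v \<in> V" "i < l v" for v i s
  proof (cases s)
    case True
    have "cluster_tree (Stem v) (Tip v i True) (Tip v i False)" using v by (auto simp: cluster_tree_def)
    then show ?thesis using tree True by simp
  next
    case False
    have "(Stem v, Tip v i False, Tip v i True) \<in> generators" using v by (auto simp: generators_def)
    then show ?thesis using gen False by simp
  qed
  have near_high: "P (Stem v) (Tip v j r) (Tip v i s)" if v: "v \<in> V" "i < j" "j < l v" for v i s j r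
    using v by (intro tree) (auto simp: cluster_tree_def)
  have near_low: "P (Stem v) (Tip v i s) (Tip v j r)" if v: "v \<in> V" "i < j" "j < l v" "s \<or> r" for v i s j r
    using v by (intro gen) (auto simp: generators_def)
  have far_low: "P (Tip v i True) (Tip v i False) (Tip v j r)" if v: "v \<in> V" "i < j" "j < l v" for v i j r
    by (rule square[OF _ _ _ far_stem near_high near_high]) (use v in auto)
  have far_high_T: "P (Tip v j True) (Tip v j False) (Tip v i True)" if v: "v \<in> V" "i < j" "j < l v" for v i j
    by (rule square[OF _ _ _ far_stem near_low near_low]) (use v in auto)
  have far_high_F: "P (Tip v j True) (Tip v j False) (Tip v i False)" if v: "v \<in> V" "i < j" "j < l v" for v i j
    by (rule square[OF _ _ _ far_high_T far_low far_low]) (use v in auto)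
  have far_high: "P (Tip v j True) (Tip v j False) (Tip v i s)" if v: "v \<in> V" "i < j" "j < l v" for v i j s
    using far_high_T[OF v] far_high_F[OF v] by (cases s) auto
  have near_low_F: "P (Stem v) (Tip v i False) (Tip v j False)" if v: "v \<in> V" "i < j" "j < l v" for v i j
    by (rule square[OF _ _ _ near_low[of v i j False True] far_stem far_high_F]) (use v in auto)
  have near: "P (Stem v) (Tip v i s) (Tip v j r)" if v: "v \<in> V" "i < l v" "j < l v" "(i, s) \<noteq> (j, r)" for v i s j r
  proof -
    consider "i = j" "r = (\<not> s)" | "j < i" | "i < j" "s \<or> r" | "i < j" "\<not> s" "\<not> r"
      using v(4) by (cases "i = j") (auto simp: neq_iff)
    then show ?thesis
      by cases (use v near_same[of v i s] near_high[of v j i s r] near_low[of v i j s r] near_low_F[of v i j] in auto)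
  qed
  have far: "P (Tip v i True) (Tip v i False) w" if v: "v \<in> V" "i < l v" and w: "w \<in> gverts \<Gamma>" "\<And>r. w \<noteq> Tip v i r" for v i w
  proof (cases "stem w = v")
    case False
    then show ?thesis using v w(1) by (intro UP) auto
  next
    case True
    show ?thesis
    proof (cases w)
      case (Stem a)
      then show ?thesis using far_stem[OF v] True by simp
    next
      case (Tip a j r)
      then have "a = v" "i \<noteq> j" "j < l v" using True w by auto
      then show ?thesis using far_low[of v i j r] far_high[of v j i r] v Tip by (cases "i < j") auto
    qed
  qed
  have "(\<exists>a c. {a, c} \<in> E \<and> u = Stem a \<and> u' = Stem c) \<or>
     (\<exists>v i s. v \<in> V \<and> i < l v \<and> u = Stem v \<and> u' = Tip v i s) \<or>
     (\<exists>v i s. v \<in> V \<and> i < l v \<and> u' = Stem v \<and> u = Tip v i s) \<or>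
     (\<exists>v i s. v \<in> V \<and> i < l v \<and> u = Tip v i s \<and> u' = Tip v i (\<not> s))"
  proof (cases u)
    case u: (Stem a)
    show ?thesis using e(1) u by (cases u') simp_all
  next
    case u: (Tip a i s)
    show ?thesis using e(1) u by (cases u') auto
  qed
  then consider a c where "{a, c} \<in> E" "u = Stem a" "u' = Stem c"
    | v i s where "v \<in> V" "i < l v" "u = Stem v" "u' = Tip v i s"
    | v i s where "v \<in> V" "i < l v" "u' = Stem v" "u = Tip v i s"
    | v i s where "v \<in> V" "i < l v" "u = Tip v i s" "u' = Tip v i (\<not> s)"
    by (elim disjE exE conjE)
  then show ?thesis
  proof cases
    case 1
    show ?thesis
    proof (cases w)
      case (Stem d)
      show ?thesis
        by (rule UP[OF e(1,2)]) (use Stem 1 e(3,4) in simp_all)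
    next
      case (Tip d i s)
      then have d: "i < l d" "d \<in> V" using e(2) by auto
      consider "d = c" | "d = a" | "d \<noteq> a" "d \<noteq> c" by blast
      then show ?thesis
      proof cases
        case 1
        then show ?thesis using entry[of a c i s] d \<open>{a, c} \<in> E\<close> Tip \<open>u = Stem a\<close> \<open>u' = Stem c\<close> by simp
      next
        case 2
        have "{c, a} \<in> E" using \<open>{a, c} \<in> E\<close> by (simp add: insert_commute)
        then have "P u' u w" using entry[of c a i s] d 2 Tip \<open>u = Stem a\<close> \<open>u' = Stem c\<close> by simp
        then show ?thesis by (rule inv[rotated 4]) (use e in \<open>simp_all add: insert_commute\<close>)
      next
        case 3
        show ?thesis
          by (rule UP[OF e(1,2)]) (use 3 Tip \<open>u = Stem a\<close> \<open>u' = Stem c\<close> in simp_all)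
      qed
    qed
  next
    case 2
    show ?thesis
    proof (cases "stem w = v")
      case True
      then obtain j r where w: "w = Tip v j r" using e(3) 2(3) by (cases w) simp_all
      then have "j < l v" "(i, s) \<noteq> (j, r)" using e(2,4) 2(4) by auto
      from near[OF 2(1,2) this] show ?thesis unfolding 2(3,4) w .
    next
      case False
      show ?thesis by (rule UP[OF e(1,2)]) (use False 2 in simp_all)
    qed
  next
    case 3
    have "P u' u w"
    proof (cases "stem w = v")
      case True
      then obtain j r where w: "w = Tip v j r" using e(4) 3(3) by (cases w) simp_all
      then have "j < l v" "(i, s) \<noteq> (j, r)" using e(2,3) 3(4) by auto
      from near[OF 3(1,2) this] show ?thesis unfolding 3(3,4) w .
    next
      case False
      have e': "{u', u} \<in> gedges \<Gamma>" using e(1) by (simp add: insert_commute)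
      show ?thesis by (rule UP[OF e' e(2)]) (use False 3 in simp_all)
    qed
    then show ?thesis by (rule inv[rotated 4]) (use e in \<open>simp_all add: insert_commute\<close>)
  next
    case 4
    have n: "w \<noteq> Tip v i r" for r using 4(3,4) e(3,4) by (cases "r = s") auto
    have f: "P (Tip v i True) (Tip v i False) w" by (rule far[OF 4(1,2) e(2) n])
    show ?thesis
    proof (cases s)
      case True
      then show ?thesis using f 4(3,4) by simp
    next
      case False
      have "P (Tip v i False) (Tip v i True) w" by (rule inv[OF _ e(2) n n f]) (use 4(1,2) in simp)
      then show ?thesis using False 4(3,4) by simp
    qed
  qed
qed

end

section \<open>Extension of cocycles over the clusters\<close>

text \<open>The labels of \<open>cluster_determined\<close> are solved for explicitly: given a cocycle on \<open>UP2\<close> and arbitrary values on the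
  generators, each square used there defines the label of its last side.\<close>

locale cocycle_extension = normal_bunch T l \<Gamma> + H: group H
  for T :: "'v sgraph" and l :: "'v \<Rightarrow> nat" and \<Gamma> :: "'v grape_vertex sgraph"
    and H :: "('g, 'm) monoid_scheme" +
  fixes A :: "'v grape_vertex \<times> 'v grape_vertex \<Rightarrow> 'v grape_vertex \<times> 'v grape_vertex \<Rightarrow> 'g"
    and \<zeta> :: "'v grape_vertex \<times> 'v grape_vertex \<times> 'v grape_vertex \<Rightarrow> 'g"
  assumes A: "cell_cocycle H (UP2 \<Gamma>) A" and \<zeta>: "s \<in> generators \<Longrightarrow> \<zeta> s \<in> carrier H"
begin

text \<open>The label of the far side of a grape, from the tip \<open>True\<close> to the tip \<open>False\<close>, while the other point waits
  outside the exit, and therefore also while it waits at the stem.\<close>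

definition far_exit :: "'v \<Rightarrow> nat \<Rightarrow> 'g" where
  "far_exit v i = A (Tip v i True, Stem (exit v)) (Tip v i False, Stem (exit v))"

text \<open>The label of the step from the stem \<open>v\<close> to the tip \<open>(i, s)\<close> while the other point occupies the tip \<open>(j, r)\<close>. The last
  value is forced by the square that the far sides of both grapes bound (see \<open>commutes_far\<close>).\<close>

definition near_label :: "'v \<Rightarrow> nat \<Rightarrow> bool \<Rightarrow> nat \<Rightarrow> bool \<Rightarrow> 'g" where
  "near_label v i s j r =
    (if j < i \<or> (j = i \<and> s) then \<one>\<^bsub>H\<^esub>
     else if i = j \<or> s \<or> r then \<zeta> (Stem v, Tip v i s, Tip v j r)
     else inv\<^bsub>H\<^esub> far_exit v j \<otimes>\<^bsub>H\<^esub> \<zeta> (Stem v, Tip v i False, Tip v j True) \<otimes>\<^bsub>H\<^esub> inv\<^bsub>H\<^esub> far_exit v i \<otimes>\<^bsub>H\<^esub>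
       inv\<^bsub>H\<^esub> \<zeta> (Stem v, Tip v i True, Tip v j True) \<otimes>\<^bsub>H\<^esub> far_exit v j \<otimes>\<^bsub>H\<^esub>
       \<zeta> (Stem v, Tip v i True, Tip v j False) \<otimes>\<^bsub>H\<^esub> far_exit v i)"

text \<open>The label of the entry from \<open>c\<close> to \<open>v\<close> while the other point occupies the tip \<open>(i, s)\<close>.\<close>

definition entry_label :: "'v \<Rightarrow> 'v \<Rightarrow> nat \<Rightarrow> bool \<Rightarrow> 'g" where
  "entry_label c v i s =
    (let e = (if c = exit v then \<one>\<^bsub>H\<^esub> else \<zeta> (Stem c, Stem v, Tip v i True)) in
     if s then e
     else inv\<^bsub>H\<^esub> A (Tip v i True, Stem c) (Tip v i False, Stem c) \<otimes>\<^bsub>H\<^esub> e \<otimes>\<^bsub>H\<^esub> far_exit v i)"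

text \<open>For a point \<open>w\<close> in another grape the value is read off from the square that moves \<open>w\<close> back to the stem.\<close>

definition far_label :: "'v \<Rightarrow> nat \<Rightarrow> 'v grape_vertex \<Rightarrow> 'g" where
  "far_label v i w = (case w of Stem _ \<Rightarrow> far_exit v i
     | Tip _ j r \<Rightarrow> inv\<^bsub>H\<^esub> near_label v j r i True \<otimes>\<^bsub>H\<^esub> far_exit v i \<otimes>\<^bsub>H\<^esub> near_label v j r i False)"

definition move_label :: "'v grape_vertex \<Rightarrow> 'v grape_vertex \<Rightarrow> 'v grape_vertex \<Rightarrow> 'g" where
  "move_label u u' w =
    (if u = u' then \<one>\<^bsub>H\<^esub>
     else if stem w \<noteq> stem u \<and> stem w \<noteq> stem u' then A (u, w) (u', w)
     else case (u, u', w) of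
       (Stem c, Stem v, Tip x i s) \<Rightarrow> if x = v then entry_label c v i s else inv\<^bsub>H\<^esub> entry_label v c i s
     | (Stem v, Tip _ i s, Tip _ j r) \<Rightarrow> near_label v i s j r
     | (Tip _ i s, Stem v, Tip _ j r) \<Rightarrow> inv\<^bsub>H\<^esub> near_label v i s j r
     | (Tip v i s, Tip _ _ _, _) \<Rightarrow> if s then far_label v i w else inv\<^bsub>H\<^esub> far_label v i w
     | _ \<Rightarrow> \<one>\<^bsub>H\<^esub>)"

lemma A_move:
  assumes e: "{u, u'} \<in> gedges \<Gamma>" "w \<in> gverts \<Gamma>" "stem w \<noteq> stem u" "stem w \<noteq> stem u'"
  shows "A (u, w) (u', w) \<in> carrier H" "A (u, w) (u', w) \<otimes>\<^bsub>H\<^esub> A (u', w) (u, w) = \<one>\<^bsub>H\<^esub>"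
proof -
  have c: "{{u, u'}, {w}} \<in> UP2 \<Gamma>" using e by (auto simp: UP2_edge doubleton_cell)
  show "A (u, w) (u', w) \<in> carrier H" by (rule cell_cocycleD(1)[OF A c]) auto
  have "A (u, w) (u', w) \<otimes>\<^bsub>H\<^esub> A (u', w) (u, w) = A (u, w) (u, w)" by (rule cell_cocycleD(3)[OF A c]) auto
  also have "\<dots> = \<one>\<^bsub>H\<^esub>" by (rule cell_cocycle_refl[OF H.is_group A c]) auto
  finally show "A (u, w) (u', w) \<otimes>\<^bsub>H\<^esub> A (u', w) (u, w) = \<one>\<^bsub>H\<^esub>" .
qed

lemma far_A_closed: "\<lbrakk>v \<in> V; i < l v; c \<in> V; c \<noteq> v\<rbrakk> \<Longrightarrow> A (Tip v i True, Stem c) (Tip v i False, Stem c) \<in> carrier H"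
  by (rule A_move(1)) auto

lemma far_exit_closed: "\<lbrakk>v \<in> V; i < l v\<rbrakk> \<Longrightarrow> far_exit v i \<in> carrier H"
  unfolding far_exit_def using E_verts[OF exit(1), of v] by (intro far_A_closed) auto

lemma near_label_closed:
  assumes v: "v \<in> V" "i < l v" "j < l v" "(i, s) \<noteq> (j, r)"
  shows "near_label v i s j r \<in> carrier H"
proof -
  have g: "\<zeta> (Stem v, Tip v i s, Tip v j r) \<in> carrier H" if "i < j" "s \<or> r" for s r
    using that v by (intro \<zeta>) (auto simp: generators_def)
  have "\<zeta> (Stem v, Tip v i False, Tip v i True) \<in> carrier H"
    using v by (intro \<zeta>) (auto simp: generators_def)
  then show ?thesis
    using g[of s r] g[of False True] g[of True False] g[of True True] v(4)
      far_exit_closed[OF v(1,2)] far_exit_closed[OF v(1,3)]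
    by (cases "i < j"; cases s; cases r) (auto simp: near_label_def)
qed

lemma entry_label_closed:
  assumes c: "{c, v} \<in> E" "i < l v"
  shows "entry_label c v i s \<in> carrier H"
proof -
  have v: "v \<in> V" "c \<in> V" "c \<noteq> v" using E_verts[OF c(1)] by auto
  have "\<zeta> (Stem c, Stem v, Tip v i True) \<in> carrier H" if "c \<noteq> exit v"
    using c that by (intro \<zeta>) (auto simp: generators_def)
  then show ?thesis
    using far_A_closed[OF v(1) c(2) v(2,3)] far_exit_closed[OF v(1) c(2)]
    by (cases "c = exit v") (simp_all add: entry_label_def Let_def)
qed

lemma far_label_closed:
  assumes v: "v \<in> V" "i < l v" and w: "w \<in> gverts \<Gamma>" "stem w = v" "\<And>r. w \<noteq> Tip v i r"
  shows "far_label v i w \<in> carrier H"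
proof (cases w)
  case (Stem x)
  then show ?thesis using far_exit_closed[OF v] by (simp add: far_label_def)
next
  case (Tip x j r)
  then have "x = v" "j < l v" "j \<noteq> i" using w by auto
  then show ?thesis
    using Tip v near_label_closed[of v j i r True] near_label_closed[of v j i r False] far_exit_closed[OF v]
    by (simp add: far_label_def)
qed

lemma edge_casesE:
  assumes "{u, u'} \<in> gedges \<Gamma>"
  obtains (leg) a c where "{a, c} \<in> E" "u = Stem a" "u' = Stem c"
  | (near) v i s where "v \<in> V" "i < l v" "u = Stem v" "u' = Tip v i s"
  | (near') v i s where "v \<in> V" "i < l v" "u = Tip v i s" "u' = Stem v"
  | (far) v i s where "v \<in> V" "i < l v" "u = Tip v i s" "u' = Tip v i (\<not> s)"
proof (cases u)
  case u: (Stem a)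
  show thesis
  proof (cases u')
    case (Stem c)
    then show thesis using assms u leg[of a c] by simp
  next
    case (Tip x i s)
    then show thesis using assms u near[of a i s] by auto
  qed
next
  case u: (Tip x i s)
  show thesis
  proof (cases u')
    case (Stem c)
    then show thesis using assms u near'[of x i s] by auto
  next
    case (Tip y j r)
    then have "y = x" "j = i" "r = (\<not> s)" "x \<in> V" "i < l x" using assms u by auto
    then show thesis using far[of x i s] u Tip by simp
  qed
qed

lemma move_label_inv:
  assumes e: "{u, u'} \<in> gedges \<Gamma>" "w \<in> gverts \<Gamma>" "w \<noteq> u" "w \<noteq> u'"
  shows "move_label u u' w \<in> carrier H \<and> move_label u u' w \<otimes>\<^bsub>H\<^esub> move_label u' u w = \<one>\<^bsub>H\<^esub>"
proof (cases "stem w \<noteq> stem u \<and> stem w \<noteq> stem u'")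
  case True
  then show ?thesis using A_move[OF e(1,2)] edge_verts[OF e(1)] by (auto simp: move_label_def)
next
  case False
  from e(1) show ?thesis
  proof (cases rule: edge_casesE)
    case (leg a c)
    have ac: "a \<noteq> c" "{c, a} \<in> E" using E_verts[OF leg(1)] leg(1) by (auto simp: insert_commute)
    obtain x i s where w: "w = Tip x i s" "i < l x" "x = a \<or> x = c" using False leg(2,3) e(2-4) by (cases w) auto
    then show ?thesis
      using entry_label_closed[OF leg(1), of i s] entry_label_closed[OF ac(2), of i s] ac(1) leg(2,3)
      by (auto simp: move_label_def)
  next
    case (near v i s)
    then obtain j r where w: "w = Tip v j r" "j < l v" "(i, s) \<noteq> (j, r)" using False e(2-4) by (cases w) auto
    then show ?thesis using near_label_closed[OF near(1,2) w(2,3)] near(3,4) by (simp add: move_label_def)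
  next
    case (near' v i s)
    then obtain j r where w: "w = Tip v j r" "j < l v" "(i, s) \<noteq> (j, r)" using False e(2-4) by (cases w) auto
    then show ?thesis using near_label_closed[OF near'(1,2) w(2,3)] near'(3,4) by (simp add: move_label_def)
  next
    case (far v i s)
    have "stem w = v" using False far(3,4) by simp
    moreover have "w \<noteq> Tip v i r" for r using e(3,4) far(3,4) by (cases "r = s") auto
    ultimately have "far_label v i w \<in> carrier H" using far_label_closed[OF far(1,2) e(2)] by simp
    then show ?thesis using far(3,4) \<open>stem w = v\<close> by (simp add: move_label_def)
  qed
qed

lemma move_label_simps:
  "\<lbrakk>u \<noteq> u'; stem w \<noteq> stem u; stem w \<noteq> stem u'\<rbrakk> \<Longrightarrow> move_label u u' w = A (u, w) (u', w)"
  "c \<noteq> v \<Longrightarrow> move_label (Stem c) (Stem v) (Tip v i s) = entry_label c v i s"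
  "move_label (Stem v) (Tip v i s) (Tip v j r) = near_label v i s j r"
  "stem w = v \<Longrightarrow> move_label (Tip v i True) (Tip v i False) w = far_label v i w"
  by (auto simp: move_label_def)

abbreviation commutes :: "'v grape_vertex \<Rightarrow> 'v grape_vertex \<Rightarrow> 'v grape_vertex \<Rightarrow> 'v grape_vertex \<Rightarrow> bool" where
  "commutes u u' w w' \<equiv> move_label u u' w \<otimes>\<^bsub>H\<^esub> move_label w w' u' = move_label w w' u \<otimes>\<^bsub>H\<^esub> move_label u u' w'"

text \<open>Reversing an edge inverts its two labels, so one orientation of each square suffices.\<close>

lemma commutes_flip:
  assumes e: "{u, u'} \<in> gedges \<Gamma>" "{w, w'} \<in> gedges \<Gamma>" "{u, u'} \<inter> {w, w'} = {}" and c: "commutes u u' w w'"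
  shows "commutes u' u w w'"
proof -
  let ?m = move_label
  have n: "w \<noteq> u" "w \<noteq> u'" "w' \<noteq> u" "w' \<noteq> u'" "u \<noteq> w" "u' \<noteq> w" "u \<noteq> w'" "u' \<noteq> w'" using e(3) by auto
  have v: "u \<in> gverts \<Gamma>" "u' \<in> gverts \<Gamma>" "w \<in> gverts \<Gamma>" "w' \<in> gverts \<Gamma>" using edge_verts e(1,2) by auto
  have e': "{u', u} \<in> gedges \<Gamma>" using e(1) by (simp add: insert_commute)
  have C: "?m u u' w \<in> carrier H" "?m u u' w' \<in> carrier H" "?m u' u w \<in> carrier H" "?m u' u w' \<in> carrier H"
    "?m w w' u \<in> carrier H" "?m w w' u' \<in> carrier H"
    using move_label_inv[OF e(1)] move_label_inv[OF e'] move_label_inv[OF e(2)] v n by auto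
  have i: "?m u' u w \<otimes>\<^bsub>H\<^esub> ?m u u' w = \<one>\<^bsub>H\<^esub>" "?m u u' w' \<otimes>\<^bsub>H\<^esub> ?m u' u w' = \<one>\<^bsub>H\<^esub>"
    using move_label_inv[OF e' v(3)] move_label_inv[OF e(1) v(4)] n by auto
  have "?m u' u w \<otimes>\<^bsub>H\<^esub> ?m w w' u = ?m u' u w \<otimes>\<^bsub>H\<^esub> (?m w w' u \<otimes>\<^bsub>H\<^esub> (?m u u' w' \<otimes>\<^bsub>H\<^esub> ?m u' u w'))"
    using C i by simp
  also have "\<dots> = ?m u' u w \<otimes>\<^bsub>H\<^esub> ((?m w w' u \<otimes>\<^bsub>H\<^esub> ?m u u' w') \<otimes>\<^bsub>H\<^esub> ?m u' u w')" using C by (simp add: H.m_assoc)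
  also have "\<dots> = ?m u' u w \<otimes>\<^bsub>H\<^esub> ((?m u u' w \<otimes>\<^bsub>H\<^esub> ?m w w' u') \<otimes>\<^bsub>H\<^esub> ?m u' u w')" using c by simp
  also have "\<dots> = (?m u' u w \<otimes>\<^bsub>H\<^esub> ?m u u' w) \<otimes>\<^bsub>H\<^esub> (?m w w' u' \<otimes>\<^bsub>H\<^esub> ?m u' u w')" using C by (simp add: H.m_assoc)
  also have "\<dots> = ?m w w' u' \<otimes>\<^bsub>H\<^esub> ?m u' u w'" using C i by simp
  finally show ?thesis .
qed

lemma cancel:
  assumes "p \<in> carrier H" "q \<in> carrier H"
  shows "p \<otimes>\<^bsub>H\<^esub> (inv\<^bsub>H\<^esub> p \<otimes>\<^bsub>H\<^esub> q) = q" "inv\<^bsub>H\<^esub> p \<otimes>\<^bsub>H\<^esub> (p \<otimes>\<^bsub>H\<^esub> q) = q"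
  using assms by (simp_all flip: H.m_assoc)

lemma commutes_UP2:
  assumes e: "{u, u'} \<in> gedges \<Gamma>" "{w, w'} \<in> gedges \<Gamma>" "{stem u, stem u'} \<inter> {stem w, stem w'} = {}"
  shows "commutes u u' w w'"
proof -
  have c: "{{u, u'}, {w, w'}} \<in> UP2 \<Gamma>" using e by (auto simp: UP2_iff doubleton_cell)
  have n: "u \<noteq> u'" "w \<noteq> w'" using edge_verts e(1,2) by auto
  have "A (u, w) (u', w) \<otimes>\<^bsub>H\<^esub> A (u', w) (u', w') = A (u, w) (u', w')"
    by (rule cell_cocycleD(3)[OF A c]) auto
  moreover have "A (u, w) (u, w') \<otimes>\<^bsub>H\<^esub> A (u, w') (u', w') = A (u, w) (u', w')"
    by (rule cell_cocycleD(3)[OF A c]) auto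
  moreover have "A (w, u') (w', u') = A (u', w) (u', w')" "A (w, u) (w', u) = A (u, w) (u, w')"
    by (rule cell_cocycleD(2)[OF A c]; simp)+
  moreover have "stem w \<noteq> stem u" "stem w \<noteq> stem u'" "stem w' \<noteq> stem u" "stem w' \<noteq> stem u'" using e(3) by auto
  ultimately show ?thesis using n by (simp add: move_label_simps(1) not_sym)
qed

lemma commutes_leg:
  assumes c: "{c, v} \<in> E" "i < l v"
  shows "commutes (Stem c) (Stem v) (Tip v i True) (Tip v i False)"
proof -
  have v: "v \<in> V" "c \<in> V" "c \<noteq> v" using E_verts[OF c(1)] by auto
  have C: "A (Tip v i True, Stem c) (Tip v i False, Stem c) \<in> carrier H" "far_exit v i \<in> carrier H"
    "entry_label c v i True \<in> carrier H"
    using far_A_closed[OF v(1) c(2) v(2,3)] far_exit_closed[OF v(1) c(2)] entry_label_closed[OF c] by auto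
  have "entry_label c v i False =
      inv\<^bsub>H\<^esub> A (Tip v i True, Stem c) (Tip v i False, Stem c) \<otimes>\<^bsub>H\<^esub> entry_label c v i True \<otimes>\<^bsub>H\<^esub> far_exit v i"
    by (simp add: entry_label_def Let_def)
  moreover have "move_label (Tip v i True) (Tip v i False) (Stem c) = A (Tip v i True, Stem c) (Tip v i False, Stem c)"
    using v(3) by (simp add: move_label_simps(1))
  moreover have "move_label (Tip v i True) (Tip v i False) (Stem v) = far_exit v i"
    by (simp add: move_label_simps(4) far_label_def)
  ultimately show ?thesis using C v(3) by (simp add: move_label_simps(2) H.m_assoc cancel)
qed

lemma commutes_near:
  assumes v: "v \<in> V" "i < l v" "j < l v" "i \<noteq> j"
  shows "commutes (Stem v) (Tip v i s) (Tip v j True) (Tip v j False)"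
proof -
  have C: "near_label v i s j True \<in> carrier H" "near_label v i s j False \<in> carrier H" "far_exit v j \<in> carrier H"
    using near_label_closed[OF v(1-3)] far_exit_closed[OF v(1,3)] v(4) by auto
  then show ?thesis by (simp add: move_label_simps(3,4) far_label_def H.m_assoc cancel)
qed

text \<open>The labels of all four sides are already fixed by other squares, so this one is a relation between labels at
  the stem; the last case of \<open>near_label\<close> is its solution.\<close>

lemma commutes_far:
  assumes v: "v \<in> V" "i < j" "j < l v"
  shows "commutes (Tip v i True) (Tip v i False) (Tip v j True) (Tip v j False)"
proof -
  define a b x y z where named: "a = far_exit v i" "b = far_exit v j"
    "x = near_label v i True j True" "y = near_label v i True j False" "z = near_label v i False j True"
  have C: "a \<in> carrier H" "b \<in> carrier H" "x \<in> carrier H" "y \<in> carrier H" "z \<in> carrier H"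
    unfolding named using far_exit_closed[OF v(1)] near_label_closed[OF v(1)] v by auto
  have low: "far_label v i (Tip v j r) = a" for r
    using v C by (simp add: far_label_def near_label_def named)
  have T: "far_label v j (Tip v i True) = inv\<^bsub>H\<^esub> x \<otimes>\<^bsub>H\<^esub> b \<otimes>\<^bsub>H\<^esub> y"
    by (simp add: far_label_def named)
  have "near_label v i False j False = inv\<^bsub>H\<^esub> b \<otimes>\<^bsub>H\<^esub> z \<otimes>\<^bsub>H\<^esub> inv\<^bsub>H\<^esub> a \<otimes>\<^bsub>H\<^esub> inv\<^bsub>H\<^esub> x \<otimes>\<^bsub>H\<^esub> b \<otimes>\<^bsub>H\<^esub> y \<otimes>\<^bsub>H\<^esub> a"
    using v by (simp add: near_label_def named)
  then have F: "far_label v j (Tip v i False) = inv\<^bsub>H\<^esub> z \<otimes>\<^bsub>H\<^esub> b \<otimes>\<^bsub>H\<^esub>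
      (inv\<^bsub>H\<^esub> b \<otimes>\<^bsub>H\<^esub> z \<otimes>\<^bsub>H\<^esub> inv\<^bsub>H\<^esub> a \<otimes>\<^bsub>H\<^esub> inv\<^bsub>H\<^esub> x \<otimes>\<^bsub>H\<^esub> b \<otimes>\<^bsub>H\<^esub> y \<otimes>\<^bsub>H\<^esub> a)"
    by (simp add: far_label_def named)
  have "a \<otimes>\<^bsub>H\<^esub> far_label v j (Tip v i False) = far_label v j (Tip v i True) \<otimes>\<^bsub>H\<^esub> a"
    unfolding F T using C by (simp add: H.m_assoc cancel)
  then show ?thesis by (simp add: move_label_simps(4) low)
qed

text \<open>Two disjoint edges with a common stem include the far side of a grape, because all other edges contain
  the stem vertex itself.\<close>

lemma commutes_all:
  assumes e: "{u, u'} \<in> gedges \<Gamma>" "{w, w'} \<in> gedges \<Gamma>" "{u, u'} \<inter> {w, w'} = {}"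
  shows "commutes u u' w w'"
proof -
  have sym: "commutes w w' u u'" if "commutes u u' w w'" for u u' w w' using that by simp
  have flip1: "commutes u' u w w' \<Longrightarrow> commutes u u' w w'"
    if "{u, u'} \<in> gedges \<Gamma>" "{w, w'} \<in> gedges \<Gamma>" "{u, u'} \<inter> {w, w'} = {}" for u u' w w'
    by (rule commutes_flip[of u' u w w']) (use that in \<open>simp_all add: insert_commute\<close>)
  have flip2: "commutes u u' w' w \<Longrightarrow> commutes u u' w w'"
    if "{u, u'} \<in> gedges \<Gamma>" "{w, w'} \<in> gedges \<Gamma>" "{u, u'} \<inter> {w, w'} = {}" for u u' w w'
    by (rule sym, rule flip1) (use that in \<open>simp_all add: Int_commute\<close>)
  have far_tips: "commutes u u' (Tip v j r) (Tip v j (\<not> r))"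
    if u: "{u, u'} \<in> gedges \<Gamma>" and v: "v \<in> V" "j < l v" and d: "{u, u'} \<inter> {Tip v j r, Tip v j (\<not> r)} = {}" for u u' v j r
  proof -
    have T: "commutes u u' (Tip v j True) (Tip v j False)"
      if u: "{u, u'} \<in> gedges \<Gamma>" and v: "v \<in> V" "j < l v" and d: "{u, u'} \<inter> {Tip v j True, Tip v j False} = {}" for u u' v j
    proof (cases "stem u = v \<or> stem u' = v")
      case False
      then show ?thesis using u v by (intro commutes_UP2) auto
    next
      case True
      have e2: "{Tip v j True, Tip v j False} \<in> gedges \<Gamma>" using v by simp
      note flip = flip1[OF u e2 d]
      from u show ?thesis
      proof (cases rule: edge_casesE)
        case (leg a c)
        have "{c, a} \<in> E" using leg(1) by (simp add: insert_commute)
        then show ?thesis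
          using True leg commutes_leg[OF _ v(2), of a] flip commutes_leg[OF _ v(2), of c] by auto
      next
        case (near x i s)
        then have "x = v" "i \<noteq> j" using True d by (auto split: if_splits)
        then show ?thesis using commutes_near[of v i j s] near v by simp
      next
        case (near' x i s)
        then have "x = v" "i \<noteq> j" using True d by (auto split: if_splits)
        then show ?thesis using flip commutes_near[of v i j s] near' v by simp
      next
        case (far x i s)
        then have x: "x = v" "i \<noteq> j" using True d by (auto split: if_splits)
        have "commutes (Tip v i True) (Tip v i False) (Tip v j True) (Tip v j False)"
          using commutes_far[of v i j] sym[OF commutes_far[of v j i]] x(2) far(2) v x(1) by (cases "i < j") auto
        then show ?thesis using flip far(3,4) x(1) by (cases s) simp_all
      qed
    qed
    show ?thesis
    proof (cases r)
      case True
      then show ?thesis using T[OF u v] d by simp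
    next
      case False
      have "commutes u u' (Tip v j False) (Tip v j True)"
        by (rule flip2[OF u _ _ T[OF u v]]) (use False d v in auto)
      then show ?thesis using False by simp
    qed
  qed
  have far_left: "commutes u u' w w'" if "v \<in> V" "i < l v" "u = Tip v i s" "u' = Tip v i (\<not> s)" for v i s
  proof -
    have "{w, w'} \<inter> {Tip v i s, Tip v i (\<not> s)} = {}" using e(3) that(3,4) by auto
    from sym[OF far_tips[OF e(2) that(1,2) this]] show ?thesis using that(3,4) by simp
  qed
  have far_right: "commutes u u' w w'" if "v \<in> V" "j < l v" "w = Tip v j r" "w' = Tip v j (\<not> r)" for v j r
    using far_tips[OF e(1) that(1,2), of r] e(3) that(3,4) by simp
  have near_root: "(\<exists>v i s. v \<in> V \<and> i < l v \<and> x = Tip v i s \<and> x' = Tip v i (\<not> s)) \<or>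
      (Stem (stem x) \<in> {x, x'} \<and> Stem (stem x') \<in> {x, x'})" if "{x, x'} \<in> gedges \<Gamma>" for x x'
    using that by (cases rule: edge_casesE) auto
  show ?thesis
  proof (cases "(Stem (stem u) \<in> {u, u'} \<and> Stem (stem u') \<in> {u, u'}) \<and> (Stem (stem w) \<in> {w, w'} \<and> Stem (stem w') \<in> {w, w'})")
    case True
    then have "{stem u, stem u'} \<inter> {stem w, stem w'} = {}" using e(3) by auto
    then show ?thesis by (rule commutes_UP2[OF e(1,2)])
  next
    case False
    then show ?thesis using near_root[OF e(1)] near_root[OF e(2)] far_left far_right by blast
  qed
qed

definition extension :: "'v grape_vertex \<times> 'v grape_vertex \<Rightarrow> 'v grape_vertex \<times> 'v grape_vertex \<Rightarrow> 'g" where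
  "extension p q = move_label (fst p) (fst q) (snd p) \<otimes>\<^bsub>H\<^esub> move_label (snd p) (snd q) (fst q)"

lemma cell_cocycle_extension: "cell_cocycle H (UD2 \<Gamma>) extension"
  unfolding extension_def
proof (rule cell_cocycle_of_moves[OF H.is_group finite_graph_\<Gamma>])
  show "move_label u u w = \<one>\<^bsub>H\<^esub>" for u w by (simp add: move_label_def)
qed (simp_all add: move_label_inv commutes_all)

lemma extension_move: "u \<noteq> w \<Longrightarrow> move_label u u' w \<in> carrier H \<Longrightarrow> extension (u, w) (u', w) = move_label u u' w"
  by (simp add: extension_def move_label_def)

lemma extension_UP2:
  assumes c: "{\<sigma>, \<tau>} \<in> UP2 \<Gamma>" "u \<in> \<sigma>" "w \<in> \<tau>" "u' \<in> \<sigma>" "w' \<in> \<tau>"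
  shows "extension (u, w) (u', w') = A (u, w) (u', w')"
proof -
  have d: "stem ` \<sigma> \<inter> stem ` \<tau> = {}" using c(1) by (simp add: UP2_iff)
  have r: "A (u, w) (u, w) = \<one>\<^bsub>H\<^esub>" "A (w, u') (w, u') = \<one>\<^bsub>H\<^esub>"
    using cell_cocycle_refl[OF H.is_group A c(1-3)] cell_cocycle_refl[OF H.is_group A _ c(3,4)] c(1)
    by (simp_all add: insert_commute)
  have n: "stem w \<noteq> stem u" "stem w \<noteq> stem u'" "stem w' \<noteq> stem u'" using d c by blast+
  have 1: "move_label u u' w = A (u, w) (u', w)"
    using n r(1) by (cases "u = u'") (simp_all add: move_label_simps(1), simp add: move_label_def)
  have 2: "move_label w w' u' = A (w, u') (w', u')"
    using n r(2) by (cases "w = w'") (simp_all add: move_label_simps(1) not_sym, simp add: move_label_def)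
  have 3: "A (w, u') (w', u') = A (u', w) (u', w')" by (rule cell_cocycleD(2)[OF A c(1)]) (use c in auto)
  have "A (u, w) (u', w) \<otimes>\<^bsub>H\<^esub> A (u', w) (u', w') = A (u, w) (u', w')"
    by (rule cell_cocycleD(3)[OF A c(1)]) (use c in auto)
  then show ?thesis by (simp add: extension_def 1 2 3)
qed

lemma extension_tree:
  assumes "cluster_tree v' v s"
  shows "extension (v', s) (v, s) = \<one>\<^bsub>H\<^esub>"
proof -
  consider (leg) a i r where "v' = Stem (exit a)" "v = Stem a" "s = Tip a i r" "a \<in> V" "i < l a"
    | (near) a i r j q where "v' = Stem a" "v = Tip a i r" "s = Tip a j q" "a \<in> V" "i < l a" "j < l a"
        "j < i \<or> (j = i \<and> r \<and> \<not> q)"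
    using assms unfolding cluster_tree_def by blast
  then have "move_label v' v s = \<one>\<^bsub>H\<^esub> \<and> v' \<noteq> s"
  proof cases
    case leg
    have "exit a \<noteq> a" using E_verts[OF exit(1)[OF leg(4)]] by auto
    moreover have "far_exit a i \<in> carrier H" by (rule far_exit_closed[OF leg(4,5)])
    ultimately show ?thesis using leg
      by (simp add: move_label_simps(2) entry_label_def Let_def) (simp add: far_exit_def)
  next
    case near
    then show ?thesis by (auto simp: move_label_simps(3) near_label_def)
  qed
  then show ?thesis by (simp add: extension_move)
qed

lemma extension_generator:
  assumes g: "(u, u', w) \<in> generators"
  shows "extension (u, w) (u', w) = \<zeta> (u, u', w)"
proof -
  have "move_label u u' w = \<zeta> (u, u', w) \<and> u \<noteq> w"
    using g E_verts unfolding generators_def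
    by (auto simp: move_label_simps(2,3) entry_label_def near_label_def)
  then show ?thesis using \<zeta>[OF g] by (simp add: extension_move)
qed

end

section \<open>Uniqueness of the extension and the spanning tree\<close>

context normal_bunch
begin

text \<open>The agreement of two cocycles is inherited by the last side of a square and by reversed moves, so
  \<open>cluster_determined\<close> applies; diagonals are products of moves.\<close>

lemma cocycle_determined:
  assumes H: "group H" and g: "cell_cocycle H (UD2 \<Gamma>) g" "cell_cocycle H (UD2 \<Gamma>) g'"
    and UP: "\<And>\<sigma> \<tau> u w u' w'. \<lbrakk>{\<sigma>, \<tau>} \<in> UP2 \<Gamma>; u \<in> \<sigma>; w \<in> \<tau>; u' \<in> \<sigma>; w' \<in> \<tau>\<rbrakk> \<Longrightarrow> g (u, w) (u', w') = g' (u, w) (u', w')"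
    and tree: "\<And>v' v s. cluster_tree v' v s \<Longrightarrow> g (v', s) (v, s) = g' (v', s) (v, s)"
    and gen: "\<And>u u' w. (u, u', w) \<in> generators \<Longrightarrow> g (u, w) (u', w) = g' (u, w) (u', w)"
    and c: "{\<sigma>, \<tau>} \<in> UD2 \<Gamma>" "u \<in> \<sigma>" "w \<in> \<tau>" "u' \<in> \<sigma>" "w' \<in> \<tau>"
  shows "g (u, w) (u', w') = g' (u, w) (u', w')"
proof -
  interpret H: group H by fact
  have reverse: "h (u', w) (u, w) = inv\<^bsub>H\<^esub> h (u, w) (u', w)"
    if h: "cell_cocycle H (UD2 \<Gamma>) h" and c: "{{u, u'}, {w}} \<in> UD2 \<Gamma>" for h u u' w
  proof -
    have "h (u', w) (u, w) \<otimes>\<^bsub>H\<^esub> h (u, w) (u', w) = h (u', w) (u', w)" by (rule cell_cocycleD(3)[OF h c]) auto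
    also have "\<dots> = \<one>\<^bsub>H\<^esub>" by (rule cell_cocycle_refl[OF H h c]) auto
    finally show ?thesis
      using cell_cocycleD(1)[OF h c, of u w u' w] cell_cocycleD(1)[OF h c, of u' w u w] by (simp add: H.inv_equality)
  qed
  have move: "g (u, w) (u', w) = g' (u, w) (u', w)"
    if e: "{u, u'} \<in> gedges \<Gamma>" "w \<in> gverts \<Gamma>" "w \<noteq> u" "w \<noteq> u'" for u u' w
    using _ _ _ _ _ e
  proof (rule cluster_determined[where P = "\<lambda>u u' w. g (u, w) (u', w) = g' (u, w) (u', w)"])
    fix u u' w assume e: "{u, u'} \<in> gedges \<Gamma>" "w \<in> gverts \<Gamma>" "w \<noteq> u" "w \<noteq> u'"
      and eq: "g (u, w) (u', w) = g' (u, w) (u', w)"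
    have "{{u, u'}, {w}} \<in> UD2 \<Gamma>" using e by (auto simp: UD2_iff doubleton_cell doubleton_cell[of w w, simplified])
    then show "g (u', w) (u, w) = g' (u', w) (u, w)" using reverse[OF g(1)] reverse[OF g(2)] eq by simp
  next
    fix u u' w w' assume e: "{u, u'} \<in> gedges \<Gamma>" "{w, w'} \<in> gedges \<Gamma>" "{u, u'} \<inter> {w, w'} = {}"
      and eq: "g (u, w) (u', w) = g' (u, w) (u', w)" "g (w, u) (w', u) = g' (w, u) (w', u)"
        "g (w, u') (w', u') = g' (w, u') (w', u')"
    have c: "{{u, u'}, {w, w'}} \<in> UD2 \<Gamma>" using e by (simp add: UD2_square_iff doubleton_cell)
    have square: "h (u, w) (u, w') \<in> carrier H" "h (u, w') (u', w') \<in> carrier H"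
      "h (u, w) (u, w') \<otimes>\<^bsub>H\<^esub> h (u, w') (u', w') = h (u, w) (u', w) \<otimes>\<^bsub>H\<^esub> h (u', w) (u', w')"
      "h (w, u) (w', u) = h (u, w) (u, w')" "h (w, u') (w', u') = h (u', w) (u', w')"
      if h: "cell_cocycle H (UD2 \<Gamma>) h" for h
      using cell_cocycleD(1)[OF h c, of u w u w'] cell_cocycleD(1)[OF h c, of u w' u' w']
        cell_cocycleD(3)[OF h c, of u w u w' u' w'] cell_cocycleD(3)[OF h c, of u w u' w u' w']
        cell_cocycleD(2)[OF h c, of u w u w'] cell_cocycleD(2)[OF h c, of u' w u' w'] by auto
    have "g (u, w) (u, w') \<otimes>\<^bsub>H\<^esub> g (u, w') (u', w') = g (u, w) (u, w') \<otimes>\<^bsub>H\<^esub> g' (u, w') (u', w')"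
      using square[OF g(1)] square[OF g(2)] eq by simp
    then show "g (u, w') (u', w') = g' (u, w') (u', w')"
      using square(1,2)[OF g(1)] square(2)[OF g(2)] by simp
  next
    fix u u' w assume "{u, u'} \<in> gedges \<Gamma>" "w \<in> gverts \<Gamma>" "stem w \<noteq> stem u" "stem w \<noteq> stem u'"
    then have "{{u, u'}, {w}} \<in> UP2 \<Gamma>" by (auto simp: UP2_edge doubleton_cell)
    then show "g (u, w) (u', w) = g' (u, w) (u', w)" by (rule UP) auto
  next
    fix u u' w show "cluster_tree u u' w \<Longrightarrow> g (u, w) (u', w) = g' (u, w) (u', w)" by (rule tree)
  next
    fix u u' w show "(u, u', w) \<in> generators \<Longrightarrow> g (u, w) (u', w) = g' (u, w) (u', w)" by (rule gen)
  qed
  have two: "u = u' \<or> {u, u'} \<in> gedges \<Gamma>" "u \<in> gverts \<Gamma>"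
    if "\<sigma> \<in> graph_cells \<Gamma>" "u \<in> \<sigma>" "u' \<in> \<sigma>" for \<sigma> u u'
    using that edge_verts by (auto elim!: cell_cases simp: insert_commute)
  have st: "\<sigma> \<in> graph_cells \<Gamma>" "\<tau> \<in> graph_cells \<Gamma>" "\<sigma> \<inter> \<tau> = {}" using c(1) by (simp_all add: UD2_iff)
  have n: "w \<noteq> u" "w \<noteq> u'" "u' \<noteq> w" "u' \<noteq> w'" using c st(3) by auto
  have c': "{\<tau>, \<sigma>} \<in> UD2 \<Gamma>" using c(1) by (simp add: insert_commute)
  have 1: "g (u, w) (u', w) = g' (u, w) (u', w)"
  proof (cases "u = u'")
    case True
    then show ?thesis using cell_cocycle_refl[OF H g(1) c(1-3)] cell_cocycle_refl[OF H g(2) c(1-3)] by simp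
  next
    case False
    then show ?thesis using two[OF st(1) c(2,4)] two(2)[OF st(2) c(3,5)] move n by auto
  qed
  have 2: "g (w, u') (w', u') = g' (w, u') (w', u')"
  proof (cases "w = w'")
    case True
    then show ?thesis using cell_cocycle_refl[OF H g(1) c' c(3,4)] cell_cocycle_refl[OF H g(2) c' c(3,4)] by simp
  next
    case False
    then show ?thesis using two[OF st(2) c(3,5)] two(2)[OF st(1) c(4,2)] move n by auto
  qed
  have split: "h (u, w) (u', w') = h (u, w) (u', w) \<otimes>\<^bsub>H\<^esub> h (w, u') (w', u')"
    if h: "cell_cocycle H (UD2 \<Gamma>) h" for h
    using cell_cocycleD(3)[OF h c(1-4,3) c(4,5)] cell_cocycleD(2)[OF h c(1) c(4,3,4,5)] by simp
  show ?thesis by (simp add: split[OF g(1)] split[OF g(2)] 1 2)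
qed

lemma cluster_tree_move:
  assumes "cluster_tree v' v s"
  shows "{{v}, {s}} \<in> UD2 \<Gamma>" "{{v'}, {s}} \<in> UD2 \<Gamma>" "{{v', v}, {s}} \<in> UD2 \<Gamma>" "v' \<noteq> v" "stem v = stem s"
proof -
  have "{v', v} \<in> gedges \<Gamma> \<and> s \<in> gverts \<Gamma> \<and> s \<noteq> v \<and> s \<noteq> v' \<and> stem v = stem s"
    using assms exit unfolding cluster_tree_def by auto
  then show "{{v}, {s}} \<in> UD2 \<Gamma>" "{{v'}, {s}} \<in> UD2 \<Gamma>" "{{v', v}, {s}} \<in> UD2 \<Gamma>" "v' \<noteq> v" "stem v = stem s"
    using edge_verts[of v' v] by (auto simp: UD2_iff graph_cells_def)
qed

lemma cluster_tree_unique: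
  assumes "cluster_tree v' v s" "cluster_tree u' u r" "{v, s} = {u, r}"
  shows "u' = v' \<and> u = v \<and> r = s"
  using assms unfolding cluster_tree_def by (auto simp: doubleton_eq_iff)

lemma cluster_tree_exists:
  assumes "{{u}, {w}} \<in> UD2 \<Gamma>" "stem u = stem w"
  shows "\<exists>v' v s. {u, w} = {v, s} \<and> cluster_tree v' v s"
proof -
  have *: "\<exists>v' v s. {u, w} = {v, s} \<and> cluster_tree v' v s"
    if u: "u \<in> gverts \<Gamma>" "w \<in> gverts \<Gamma>" "u \<noteq> w" "stem u = stem w"
      and o: "(\<exists>a. u = Stem a) \<or> (\<exists>a i r j q. u = Tip a i r \<and> w = Tip a j q \<and> (j < i \<or> (j = i \<and> r \<and> \<not> q)))" for u w
  proof -
    have "cluster_tree (if u = Stem (stem u) then Stem (exit (stem u)) else Stem (stem u)) u w"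
      using o
    proof (elim disjE exE conjE)
      fix a assume a: "u = Stem a"
      then obtain i r where "w = Tip a i r" using u(3,4) by (cases w) auto
      then show ?thesis using a u(1,2) by (simp add: cluster_tree_def)
    qed (use u(1,2) in \<open>auto simp: cluster_tree_def\<close>)
    then show ?thesis by blast
  qed
  have v: "u \<in> gverts \<Gamma>" "w \<in> gverts \<Gamma>" "u \<noteq> w"
    using assms(1) doubleton_cell[of u u] doubleton_cell[of w w] edge_verts[of u u] edge_verts[of w w] by (auto simp: UD2_iff)
  have "((\<exists>a. u = Stem a) \<or> (\<exists>a i r j q. u = Tip a i r \<and> w = Tip a j q \<and> (j < i \<or> (j = i \<and> r \<and> \<not> q)))) \<or>
    ((\<exists>a. w = Stem a) \<or> (\<exists>a i r j q. w = Tip a i r \<and> u = Tip a j q \<and> (j < i \<or> (j = i \<and> r \<and> \<not> q))))"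
  proof (cases u; cases w)
    fix a i r b j q assume "u = Tip a i r" "w = Tip b j q"
    then show ?thesis using v(3) assms(2) by (cases "i = j"; cases r; cases q) (auto simp: neq_iff)
  qed simp_all
  then show ?thesis
  proof
    assume "(\<exists>a. u = Stem a) \<or> (\<exists>a i r j q. u = Tip a i r \<and> w = Tip a j q \<and> (j < i \<or> (j = i \<and> r \<and> \<not> q)))"
    then show ?thesis by (rule *[OF v assms(2)])
  next
    assume "(\<exists>a. w = Stem a) \<or> (\<exists>a i r j q. w = Tip a i r \<and> u = Tip a j q \<and> (j < i \<or> (j = i \<and> r \<and> \<not> q)))"
    then have "\<exists>v' v s. {w, u} = {v, s} \<and> cluster_tree v' v s"
      by (rule *[OF v(2,1) not_sym[OF v(3)] assms(2)[symmetric]])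
    then show ?thesis unfolding insert_commute[of w u "{}"] .
  qed
qed

abbreviation "UD_edge \<equiv> configuration_model.tree_edge (UD2 \<Gamma>)"
abbreviation "UP_edge \<equiv> configuration_model.tree_edge (UP2 \<Gamma>)"

lemma UP_model: "configuration_model \<Gamma> (\<Union>c\<in>UP2 \<Gamma>. realize_square_cell c) (UP2 \<Gamma>)"
  by (rule configuration_model_subcomplex[OF finite_graph_\<Gamma> UP2_subset])

lemma UD_model: "configuration_model \<Gamma> (topspace (UC \<Gamma>)) (UD2 \<Gamma>)"
  by (rule configuration_model_UC[OF finite_graph_\<Gamma>])

text \<open>The tree of \<open>UP2\<close> is continued by the cluster trees, which reach \<open>UP2\<close> after at most two steps.\<close>

lemma UD2_tree:
  fixes par :: "'v grape_vertex set \<Rightarrow> 'v grape_vertex set" and rank :: "'v grape_vertex set \<Rightarrow> nat"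
  assumes b: "b = {x, y}" "{{x}, {y}} \<in> UP2 \<Gamma>"
    and par: "\<And>u w. {{u}, {w}} \<in> UP2 \<Gamma> \<Longrightarrow> {u, w} \<noteq> b \<Longrightarrow>
      \<exists>v' v s. {u, w} = {v, s} \<and> UP_edge b par v' v s \<and> rank {v', s} < rank {v, s}"
  shows "\<exists>par2 (rank2 :: 'v grape_vertex set \<Rightarrow> nat).
    (\<forall>u w. {{u}, {w}} \<in> UD2 \<Gamma> \<longrightarrow> {u, w} \<noteq> b \<longrightarrow>
      (\<exists>v' v s. {u, w} = {v, s} \<and> UD_edge b par2 v' v s \<and> rank2 {v', s} < rank2 {v, s})) \<and>
    (\<forall>v' v s. UD_edge b par2 v' v s \<longleftrightarrow> UP_edge b par v' v s \<or> cluster_tree v' v s)"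
proof -
  interpret UP: configuration_model \<Gamma> "\<Union>c\<in>UP2 \<Gamma>. realize_square_cell c" "UP2 \<Gamma>" by (rule UP_model)
  interpret UD: configuration_model \<Gamma> "topspace (UC \<Gamma>)" "UD2 \<Gamma>" by (rule UD_model)
  define separated where "separated p \<longleftrightarrow> (\<exists>u w. p = {u, w} \<and> {{u}, {w}} \<in> UP2 \<Gamma>)" for p :: "'v grape_vertex set"
  define par2 where "par2 p = (if separated p then par p else SOME q. \<exists>v' v s. p = {v, s} \<and> cluster_tree v' v s \<and> q = {v', s})" for p
  \<comment> \<open>A vertex of a cluster is one or two tree steps away from the subcomplex.\<close>
  define rank2 where "rank2 p = (if separated p then rank p else if separated (par2 p) then Suc (rank (par2 p))
    else Suc (Suc (rank (par2 (par2 p)))))" for p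
  have sep: "separated {u, w} \<longleftrightarrow> {{u}, {w}} \<in> UP2 \<Gamma>" for u w
    unfolding separated_def by (auto simp: doubleton_eq_iff)
  have sep_b: "separated b" using b sep by simp
  have UP_UD: "UD_edge b par2 v' v s \<and> rank2 {v', s} = rank {v', s} \<and> rank2 {v, s} = rank {v, s}" if e: "UP_edge b par v' v s" for v' v s
  proof -
    have "separated {v, s}" "separated {v', s}" using e sep by (auto simp: UP.tree_edge_def)
    then show ?thesis using e UP2_subset by (auto simp: UP.tree_edge_def UD.tree_edge_def par2_def rank2_def)
  qed
  have par2_cluster: "par2 {v, s} = {v', s} \<and> \<not> separated {v, s}" if e: "cluster_tree v' v s" for v' v s
  proof -
    have n: "\<not> separated {v, s}" using cluster_tree_move(5)[OF e] by (simp add: sep)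
    have "(SOME q. \<exists>u' u r. {v, s} = {u, r} \<and> cluster_tree u' u r \<and> q = {u', r}) = {v', s}"
    proof (rule some_equality)
      show "\<exists>u' u r. {v, s} = {u, r} \<and> cluster_tree u' u r \<and> {v', s} = {u', r}" using e by blast
      fix q assume "\<exists>u' u r. {v, s} = {u, r} \<and> cluster_tree u' u r \<and> q = {u', r}"
      then obtain u' u r where u: "{v, s} = {u, r}" "cluster_tree u' u r" "q = {u', r}" by (elim exE conjE)
      show "q = {v', s}" using cluster_tree_unique[OF e u(2,1)] u(3) by simp
    qed
    then show ?thesis using n by (simp add: par2_def)
  qed
  have cluster_UD: "UD_edge b par2 v' v s" if e: "cluster_tree v' v s" for v' v s
  proof -
    have "{v, s} \<noteq> b" using par2_cluster[OF e] sep_b by auto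
    then show ?thesis using cluster_tree_move[OF e] par2_cluster[OF e] by (simp add: UD.tree_edge_def)
  qed
  have cluster_rank: "rank2 {v', s} < rank2 {v, s}" if e: "cluster_tree v' v s" for v' v s
  proof -
    consider (leg) a i r where "v' = Stem (exit a)" "v = Stem a" "s = Tip a i r" "a \<in> V" "i < l a"
      | (near) a j q where "v' = Stem a" "s = Tip a j q" "a \<in> V" "j < l a"
      using e unfolding cluster_tree_def by blast
    then show ?thesis
    proof cases
      case leg
      have "separated {v', s}" using leg E_verts[OF exit(1)[OF leg(4)]] by (auto simp: sep)
      then show ?thesis using par2_cluster[OF e] by (simp add: rank2_def)
    next
      case near
      have e': "cluster_tree (Stem (exit a)) v' s" using near by (simp add: cluster_tree_def)
      have "separated {Stem (exit a), s}" using near E_verts[OF exit(1)[OF near(3)]] by (auto simp: sep)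
      then show ?thesis using par2_cluster[OF e] par2_cluster[OF e'] by (simp add: rank2_def)
    qed
  qed
  have ex: "\<exists>v' v s. {u, w} = {v, s} \<and> (UP_edge b par v' v s \<or> cluster_tree v' v s) \<and> rank2 {v', s} < rank2 {v, s}"
    if u: "{{u}, {w}} \<in> UD2 \<Gamma>" "{u, w} \<noteq> b" for u w
  proof (cases "stem u = stem w")
    case True
    from cluster_tree_exists[OF u(1) True] obtain v' v s where "{u, w} = {v, s}" "cluster_tree v' v s" by (elim exE conjE)
    then show ?thesis using cluster_rank by blast
  next
    case False
    have "u \<in> gverts \<Gamma>" "w \<in> gverts \<Gamma>"
      using u(1) doubleton_cell[of u u] doubleton_cell[of w w] edge_verts[of u u] edge_verts[of w w] by (auto simp: UD2_iff)
    then have "{{u}, {w}} \<in> UP2 \<Gamma>" using False by simp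
    from par[OF this u(2)] obtain v' v s where "{u, w} = {v, s}" "UP_edge b par v' v s" "rank {v', s} < rank {v, s}"
      by (elim exE conjE)
    moreover from UP_UD[OF this(2)] this(3) have "rank2 {v', s} < rank2 {v, s}" by simp
    ultimately show ?thesis by blast
  qed
  have iff: "UD_edge b par2 v' v s \<longleftrightarrow> UP_edge b par v' v s \<or> cluster_tree v' v s" for v' v s
  proof
    assume e: "UD_edge b par2 v' v s"
    then have "{{v}, {s}} \<in> UD2 \<Gamma>" "{v, s} \<noteq> b" by (simp_all add: UD.tree_edge_def)
    from ex[OF this] obtain u' u r where u: "{v, s} = {u, r}" "UP_edge b par u' u r \<or> cluster_tree u' u r" by (elim exE conjE)
    then have "UD_edge b par2 u' u r" using UP_UD cluster_UD by blast
    from UD.tree_edge_unique[OF e this u(1)] u(2) show "UP_edge b par v' v s \<or> cluster_tree v' v s" by simp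
  qed (use UP_UD cluster_UD in blast)
  show ?thesis
    by (intro exI[of _ par2] exI[of _ rank2]) (use ex iff in blast)
qed

end

section \<open>The splitting of the braid group\<close>

lemma cell_cocycle_mono:
  assumes g: "cell_cocycle H K g" and "K' \<subseteq> K"
  shows "cell_cocycle H K' g"
  unfolding cell_cocycle_def
proof (intro allI impI)
  fix \<sigma> \<tau> assume "{\<sigma>, \<tau>} \<in> K'"
  then have "{\<sigma>, \<tau>} \<in> K" using assms(2) by (rule rev_subsetD)
  from g[unfolded cell_cocycle_def, THEN spec, THEN spec, THEN mp, OF this]
  show "\<forall>u\<in>\<sigma>. \<forall>w\<in>\<tau>. \<forall>u'\<in>\<sigma>. \<forall>w'\<in>\<tau>.
     g (u, w) (u', w') \<in> carrier H \<and> g (w, u) (w', u') = g (u, w) (u', w') \<and>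
     (\<forall>u''\<in>\<sigma>. \<forall>w''\<in>\<tau>. g (u, w) (u', w') \<otimes>\<^bsub>H\<^esub> g (u', w') (u'', w'') = g (u, w) (u'', w''))" .
qed

context normal_bunch
begin

lemma generator_move: "(u, u', w) \<in> generators \<Longrightarrow> {{u, u'}, {w}} \<in> UD2 \<Gamma>"
  unfolding generators_def UD2_iff using E_verts by (auto simp: graph_cells_def)

text \<open>The homomorphism \<open>\<alpha>\<close> comes from the extension to \<open>UD2\<close> of the universal cocycle on \<open>UP2\<close>, with the free generators as
  labels of the generating moves; \<open>\<beta>\<close> is the inclusion on the first factor and sends each free generator to the
  class of its move. Both composites are the identity on edges, so they are the identity by uniqueness.\<close>

lemma braid_group_splits:
  assumes p: "p \<in> topspace (UC \<Gamma>)" and q: "q \<in> topspace (realize_subcomplex \<Gamma> (UP2 \<Gamma>))"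
  shows "braid_group2 \<Gamma> p \<cong>
    free_product (fundamental_group (realize_subcomplex \<Gamma> (UP2 \<Gamma>)) q) (free_group {..<card generators})"
proof -
  define \<Omega> where "\<Omega> = (\<Union>c\<in>UP2 \<Gamma>. realize_square_cell c)"
  define S where "S = {..<card generators}"
  define F where "F = free_group S"
  interpret UP: configuration_model \<Gamma> \<Omega> "UP2 \<Gamma>" unfolding \<Omega>_def by (rule UP_model)
  interpret UD: configuration_model \<Gamma> "topspace (UC \<Gamma>)" "UD2 \<Gamma>" by (rule UD_model)
  obtain a0 where "a0 \<in> V" using V_nonempty by auto
  then have e0: "{a0, exit a0} \<in> E" by (rule exit)
  define b where "b = {Stem a0, Stem (exit a0)}"
  have b: "{{Stem a0}, {Stem (exit a0)}} \<in> UP2 \<Gamma>" using E_verts[OF e0] by simp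
  have "\<exists>par (rank :: 'v grape_vertex set \<Rightarrow> nat). \<forall>u w. {{u}, {w}} \<in> UP2 \<Gamma> \<longrightarrow> {u, w} \<noteq> b \<longrightarrow>
     (\<exists>v' v s. {u, w} = {v, s} \<and> UP_edge b par v' v s \<and> rank {v', s} < rank {v, s})"
    by (rule UP.spanning_tree) (unfold b_def, rule UP2_connected[OF e0])
  then obtain par and rank :: "'v grape_vertex set \<Rightarrow> nat" where par: "\<And>u w. {{u}, {w}} \<in> UP2 \<Gamma> \<Longrightarrow> {u, w} \<noteq> b \<Longrightarrow>
     \<exists>v' v s. {u, w} = {v, s} \<and> UP_edge b par v' v s \<and> rank {v', s} < rank {v, s}" by blast
  have "\<exists>par2 (rank2 :: 'v grape_vertex set \<Rightarrow> nat).
    (\<forall>u w. {{u}, {w}} \<in> UD2 \<Gamma> \<longrightarrow> {u, w} \<noteq> b \<longrightarrow>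
      (\<exists>v' v s. {u, w} = {v, s} \<and> UD_edge b par2 v' v s \<and> rank2 {v', s} < rank2 {v, s})) \<and>
    (\<forall>v' v s. UD_edge b par2 v' v s \<longleftrightarrow> UP_edge b par v' v s \<or> cluster_tree v' v s)"
    by (rule UD2_tree[OF b_def b]) (rule par)
  then obtain par2 and rank2 :: "'v grape_vertex set \<Rightarrow> nat" where UD_tree:
    "(\<forall>u w. {{u}, {w}} \<in> UD2 \<Gamma> \<longrightarrow> {u, w} \<noteq> b \<longrightarrow>
      (\<exists>v' v s. {u, w} = {v, s} \<and> UD_edge b par2 v' v s \<and> rank2 {v', s} < rank2 {v, s})) \<and>
    (\<forall>v' v s. UD_edge b par2 v' v s \<longleftrightarrow> UP_edge b par v' v s \<or> cluster_tree v' v s)"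
    by (elim exE)
  note par2 = UD_tree[THEN conjunct1, rule_format] and tree = UD_tree[THEN conjunct2, rule_format]
  interpret M1: rooted_model \<Gamma> "topspace (UC \<Gamma>)" "UD2 \<Gamma>" b par2 rank2 p
  proof unfold_locales
    fix \<sigma> \<tau> u w assume c: "{\<sigma>, \<tau>} \<in> UD2 \<Gamma>" "u \<in> \<sigma>" "w \<in> \<tau>"
    then have "u \<in> gverts \<Gamma>" "w \<in> gverts \<Gamma>" "u \<noteq> w"
      using edge_verts by (auto simp: UD2_iff elim!: cell_cases)
    then show "{{u}, {w}} \<in> UD2 \<Gamma>" by (simp add: UD2_iff graph_cells_def)
  next
    show "\<exists>u w. b = {u, w} \<and> {{u}, {w}} \<in> UD2 \<Gamma>" using b UP2_subset unfolding b_def by blast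
  qed (rule par2 p; assumption)+
  interpret M2: rooted_model \<Gamma> \<Omega> "UP2 \<Gamma>" b par rank q
  proof unfold_locales
    fix \<sigma> \<tau> u w assume c: "{\<sigma>, \<tau>} \<in> UP2 \<Gamma>" "u \<in> \<sigma>" "w \<in> \<tau>"
    then have "u \<in> gverts \<Gamma>" "w \<in> gverts \<Gamma>" "stem u \<noteq> stem w"
      using edge_verts by (auto simp: UP2_iff elim!: cell_cases)
    then show "{{u}, {w}} \<in> UP2 \<Gamma>" by simp
  next
    show "q \<in> \<Omega>" using q by (simp add: realize_subcomplex_def topspace_subtopology \<Omega>_def)
  next
    show "\<exists>u w. b = {u, w} \<and> {{u}, {w}} \<in> UP2 \<Gamma>" using b unfolding b_def by blast
  qed (rule par; assumption)
  define G1 where "G1 = fundamental_group (subtopology (UC \<Gamma>) (topspace (UC \<Gamma>))) p"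
  define G2 where "G2 = fundamental_group (subtopology (UC \<Gamma>) \<Omega>) q"
  define e1 where "e1 = M1.edge_class"
  define e2 where "e2 = M2.edge_class"
  note group1 = M1.pi1.is_group[folded G1_def] and group2 = M2.pi1.is_group[folded G2_def]
    and cocycle1 = M1.cell_cocycle_edge_class[folded G1_def e1_def]
    and normal1 = M1.tree_normalized_edge_class[unfolded M1.tree_normalized_def, folded G1_def e1_def, rule_format]
    and normal2 = M2.tree_normalized_edge_class[unfolded M2.tree_normalized_def, folded G2_def e2_def, rule_format]
    and exists1 = M1.edge_class_hom_exists[unfolded M1.tree_normalized_def, folded G1_def e1_def]
    and exists2 = M2.edge_class_hom_exists[unfolded M2.tree_normalized_def, folded G2_def e2_def]
    and unique1 = M1.edge_class_hom_unique[folded G1_def e1_def]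
    and unique2 = M2.edge_class_hom_unique[folded G2_def e2_def]
    and cocycle_hom1 = M1.cell_cocycle_hom[folded G1_def e1_def]
    and cocycle_hom2 = M2.cell_cocycle_hom[folded G2_def e2_def]
  have groupF: "group F" unfolding F_def by (rule group_free_group)
  interpret G1: group G1 by (rule group1)
  interpret GP: group_pair G2 F using group2 groupF by (simp add: group_pair_def)
  define P where "P = free_product G2 F"
  note P_eq = GP.free_product_eq[folded P_def, symmetric]
  have groupP: "group P" using GP.group_free_product unfolding P_eq .
  interpret P: group P by (rule groupP)
  have inl: "GP.inl \<in> hom G2 P" and inr: "GP.inr \<in> hom F P"
    using GP.inl_hom GP.inr_hom unfolding P_eq by auto
  obtain idx where idx: "bij_betw idx generators S"
    using ex_bij_betw_finite_nat[OF finite_generators] unfolding S_def atLeast0LessThan by blast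
  have gen_F: "free_gen S (idx s) \<in> carrier F" if "s \<in> generators" for s
    unfolding F_def by (rule free_gen_closed) (use idx that in \<open>auto simp: bij_betw_def\<close>)
  define \<zeta> where "\<zeta> s = GP.inr (free_gen S (idx s))" for s
  interpret X: cocycle_extension T l \<Gamma> P "\<lambda>p q. GP.inl (e2 p q)" \<zeta>
  proof unfold_locales
    show "cell_cocycle P (UP2 \<Gamma>) (\<lambda>p q. GP.inl (e2 p q))" by (rule cocycle_hom2[OF groupP inl])
    show "\<zeta> s \<in> carrier P" if "s \<in> generators" for s
      unfolding \<zeta>_def by (rule hom_in_carrier[OF inr gen_F[OF that]])
  qed
  have "\<exists>\<Phi>\<in>hom G1 P. \<forall>\<sigma> \<tau>. {\<sigma>, \<tau>} \<in> UD2 \<Gamma> \<longrightarrow> (\<forall>u\<in>\<sigma>. \<forall>w\<in>\<tau>. \<forall>u'\<in>\<sigma>. \<forall>w'\<in>\<tau>.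
      \<Phi> (e1 (u, w) (u', w')) = X.extension (u, w) (u', w'))"
  proof (rule exists1[OF groupP X.cell_cocycle_extension], intro allI impI)
    fix v' v s assume "UD_edge b par2 v' v s"
    then consider "UP_edge b par v' v s" | "cluster_tree v' v s" using tree by blast
    then show "X.extension (v', s) (v, s) = \<one>\<^bsub>P\<^esub>"
    proof cases
      case 1
      then have "{{v', v}, {s}} \<in> UP2 \<Gamma>" by (simp add: UP.tree_edge_def)
      then have "X.extension (v', s) (v, s) = GP.inl (e2 (v', s) (v, s))" by (rule X.extension_UP2) auto
      also have "\<dots> = \<one>\<^bsub>P\<^esub>" using normal2[OF 1] hom_one[OF inl group2 groupP] by simp
      finally show ?thesis .
    qed (rule X.extension_tree)
  qed
  then obtain \<alpha> where \<alpha>: "\<alpha> \<in> hom G1 P"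
    and \<alpha>_edges: "\<forall>\<sigma> \<tau>. {\<sigma>, \<tau>} \<in> UD2 \<Gamma> \<longrightarrow> (\<forall>u\<in>\<sigma>. \<forall>w\<in>\<tau>. \<forall>u'\<in>\<sigma>. \<forall>w'\<in>\<tau>.
      \<alpha> (e1 (u, w) (u', w')) = X.extension (u, w) (u', w'))" by (elim bexE)
  note \<alpha>_edge = \<alpha>_edges[rule_format]
  have "cell_cocycle G1 (UP2 \<Gamma>) e1"
    by (rule cell_cocycle_mono[OF cocycle1 UP2_subset])
  then have "\<exists>\<Phi>\<in>hom G2 G1. \<forall>\<sigma> \<tau>. {\<sigma>, \<tau>} \<in> UP2 \<Gamma> \<longrightarrow> (\<forall>u\<in>\<sigma>. \<forall>w\<in>\<tau>. \<forall>u'\<in>\<sigma>. \<forall>w'\<in>\<tau>.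
      \<Phi> (e2 (u, w) (u', w')) = e1 (u, w) (u', w'))"
    by (rule exists2[OF group1]) (intro allI impI normal1 tree[THEN iffD2] disjI1)
  then obtain \<beta>2 where \<beta>2: "\<beta>2 \<in> hom G2 G1"
    and \<beta>2_edges: "\<forall>\<sigma> \<tau>. {\<sigma>, \<tau>} \<in> UP2 \<Gamma> \<longrightarrow> (\<forall>u\<in>\<sigma>. \<forall>w\<in>\<tau>. \<forall>u'\<in>\<sigma>. \<forall>w'\<in>\<tau>.
      \<beta>2 (e2 (u, w) (u', w')) = e1 (u, w) (u', w'))" by (elim bexE)
  note \<beta>2_edge = \<beta>2_edges[rule_format]
  \<comment> \<open>The class of the generating move \<open>s\<close> in the braid group.\<close>
  define move where "move s = (case s of (u, u', w) \<Rightarrow> e1 (u, w) (u', w))" for s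
  have move_closed: "move s \<in> carrier G1" if "s \<in> generators" for s
  proof -
    obtain u u' w where s: "s = (u, u', w)" by (cases s)
    show ?thesis unfolding move_def s split
      by (rule cell_cocycleD(1)[OF cocycle1 generator_move[of u u' w]]) (use that s in auto)
  qed
  have "\<exists>\<Phi>\<in>hom F G1. \<forall>i\<in>S. \<Phi> (free_gen S i) = move (the_inv_into generators idx i)"
    unfolding F_def
    by (rule free_group_hom_exists[OF group1 move_closed])
       (use idx in \<open>auto simp: bij_betw_def intro: the_inv_into_into\<close>)
  then obtain \<beta>3 where \<beta>3: "\<beta>3 \<in> hom F G1" and \<beta>3': "\<And>i. i \<in> S \<Longrightarrow> \<beta>3 (free_gen S i) = move (the_inv_into generators idx i)"
    by blast
  have \<beta>3_gen: "\<beta>3 (free_gen S (idx s)) = move s" if "s \<in> generators" for s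
    using \<beta>3'[of "idx s"] idx that by (auto simp: bij_betw_def the_inv_into_f_f)
  obtain \<beta> where \<beta>: "\<beta> \<in> hom P G1" and \<beta>_inl: "\<And>x. x \<in> carrier G2 \<Longrightarrow> \<beta> (GP.inl x) = \<beta>2 x"
    and \<beta>_inr: "\<And>y. y \<in> carrier F \<Longrightarrow> \<beta> (GP.inr y) = \<beta>3 y"
    using GP.free_product_hom_exists[OF group1 \<beta>2 \<beta>3] unfolding P_eq by blast
  have e2_closed: "e2 (u, w) (u', w') \<in> carrier G2"
    if "{\<sigma>, \<tau>} \<in> UP2 \<Gamma>" "u \<in> \<sigma>" "w \<in> \<tau>" "u' \<in> \<sigma>" "w' \<in> \<tau>" for \<sigma> \<tau> u w u' w'
    by (rule cell_cocycleD(1)[OF M2.cell_cocycle_edge_class[folded G2_def e2_def] that])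
  have UP_UD: "{\<sigma>, \<tau>} \<in> UP2 \<Gamma> \<Longrightarrow> {\<sigma>, \<tau>} \<in> UD2 \<Gamma>" for \<sigma> \<tau> using UP2_subset by blast
  have \<alpha>_gen: "\<alpha> (move s) = GP.inr (free_gen S (idx s))" if "s \<in> generators" for s
  proof -
    obtain u u' w where s: "s = (u, u', w)" by (cases s)
    then have g: "(u, u', w) \<in> generators" using that by simp
    have "\<alpha> (e1 (u, w) (u', w)) = X.extension (u, w) (u', w)" by (rule \<alpha>_edge[OF generator_move[OF g]]) auto
    also have "\<dots> = \<zeta> (u, u', w)" by (rule X.extension_generator[OF g])
    finally show ?thesis by (simp add: move_def s \<zeta>_def)
  qed
  have \<beta>\<alpha>: "\<beta> \<circ> \<alpha> \<in> hom G1 G1" by (rule hom_compose[OF \<alpha> \<beta>])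
  have id1: "id \<in> hom G1 G1" and idP: "id \<in> hom P P" by (simp_all add: hom_def)
  have left: "\<beta> (\<alpha> x) = x" if x: "x \<in> carrier G1" for x
  proof -
    have "(\<beta> \<circ> \<alpha>) x = id x"
    proof (rule unique1[OF group1 \<beta>\<alpha> id1 _ x])
      fix \<sigma> \<tau> u w u' w' assume c: "{\<sigma>, \<tau>} \<in> UD2 \<Gamma>" "u \<in> \<sigma>" "w \<in> \<tau>" "u' \<in> \<sigma>" "w' \<in> \<tau>"
      have "(\<lambda>p q. (\<beta> \<circ> \<alpha>) (e1 p q)) (u, w) (u', w') = e1 (u, w) (u', w')"
      proof (rule cocycle_determined[OF group1 cocycle_hom1[OF group1 \<beta>\<alpha>] cocycle1 _ _ _ c])
        fix \<sigma> \<tau> u w u' w' assume c: "{\<sigma>, \<tau>} \<in> UP2 \<Gamma>" "u \<in> \<sigma>" "w \<in> \<tau>" "u' \<in> \<sigma>" "w' \<in> \<tau>"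
        show "(\<beta> \<circ> \<alpha>) (e1 (u, w) (u', w')) = e1 (u, w) (u', w')"
          using \<alpha>_edge[OF UP_UD[OF c(1)] c(2-5)] X.extension_UP2[OF c] \<beta>_inl[OF e2_closed[OF c]] \<beta>2_edge[OF c] by simp
      next
        fix v' v s assume "cluster_tree v' v s"
        then have "e1 (v', s) (v, s) = \<one>\<^bsub>G1\<^esub>" using normal1 tree by blast
        then show "(\<beta> \<circ> \<alpha>) (e1 (v', s) (v, s)) = e1 (v', s) (v, s)" using hom_one[OF \<beta>\<alpha> group1 group1] by simp
      next
        fix u u' w assume g: "(u, u', w) \<in> generators"
        show "(\<beta> \<circ> \<alpha>) (e1 (u, w) (u', w)) = e1 (u, w) (u', w)"
          using \<alpha>_gen[OF g] \<beta>_inr[OF gen_F[OF g]] \<beta>3_gen[OF g] by (simp add: move_def)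
      qed
      then show "(\<beta> \<circ> \<alpha>) (e1 (u, w) (u', w')) = id (e1 (u, w) (u', w'))" by simp
    qed
    then show ?thesis by simp
  qed
  have right: "\<alpha> (\<beta> z) = z" if z: "z \<in> carrier P" for z
  proof -
    have "(\<alpha> \<circ> \<beta>) z = id z"
    proof (rule GP.free_product_hom_unique[OF groupP, unfolded P_eq, OF hom_compose[OF \<beta> \<alpha>] idP _ _ z])
      fix x assume x: "x \<in> carrier G2"
      have "(\<alpha> \<circ> \<beta>2) x = GP.inl x"
      proof (rule unique2[OF groupP hom_compose[OF \<beta>2 \<alpha>] inl _ x])
        fix \<sigma> \<tau> u w u' w' assume c: "{\<sigma>, \<tau>} \<in> UP2 \<Gamma>" "u \<in> \<sigma>" "w \<in> \<tau>" "u' \<in> \<sigma>" "w' \<in> \<tau>"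
        show "(\<alpha> \<circ> \<beta>2) (e2 (u, w) (u', w')) = GP.inl (e2 (u, w) (u', w'))"
          using \<beta>2_edge[OF c] \<alpha>_edge[OF UP_UD[OF c(1)] c(2-5)] X.extension_UP2[OF c] by simp
      qed
      then show "(\<alpha> \<circ> \<beta>) (GP.inl x) = id (GP.inl x)" using \<beta>_inl[OF x] by simp
    next
      fix y assume y: "y \<in> carrier F"
      have "(\<alpha> \<circ> \<beta>3) y = GP.inr y"
      proof (rule free_group_hom_unique[OF groupP, of _ S, folded F_def, OF hom_compose[OF \<beta>3 \<alpha>] inr _ y])
        fix i assume "i \<in> S"
        then obtain s where s: "s \<in> generators" "i = idx s" using idx by (auto simp: bij_betw_def)
        show "(\<alpha> \<circ> \<beta>3) (free_gen S i) = GP.inr (free_gen S i)"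
          using \<beta>3_gen[OF s(1)] \<alpha>_gen[OF s(1)] s(2) by simp
      qed
      then show "(\<alpha> \<circ> \<beta>) (GP.inr y) = id (GP.inr y)" using \<beta>_inr[OF y] by simp
    qed
    then show ?thesis by simp
  qed
  have "bij_betw \<alpha> (carrier G1) (carrier P)"
    by (rule bij_betwI[where g = \<beta>]) (use \<alpha> \<beta> left right in \<open>auto intro: hom_in_carrier\<close>)
  then have "G1 \<cong> P" using \<alpha> unfolding is_iso_def iso_def by blast
  then show ?thesis
    unfolding P_def G1_def G2_def F_def S_def \<Omega>_def
    by (simp add: braid_group2_def realize_subcomplex_def subtopology_topspace)
qed

end

theorem proposition1p7:
  fixes T :: "'v sgraph" and l :: "'v \<Rightarrow> nat" and \<Gamma> :: "'v grape_vertex sgraph"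
  assumes "bunch_of_grapes T l"
    and "\<Gamma> = grapes_graph T l"
    and "normal_graph \<Gamma>"
  shows "locally_convex (UP2 \<Gamma>) (UD2 \<Gamma>) \<and>
    (\<exists>N::nat. 2 \<le> N \<and>
      (\<forall>p \<in> topspace (unordered_config2 (realize_graph \<Gamma>)).
       \<forall>q \<in> topspace (realize_subcomplex \<Gamma> (UP2 \<Gamma>)).
         braid_group2 \<Gamma> p \<cong>
           free_product (fundamental_group (realize_subcomplex \<Gamma> (UP2 \<Gamma>)) q)
                        (free_group {..<N})))"
proof -
  interpret normal_bunch T l \<Gamma> by unfold_locales (fact assms)+
  show ?thesis
    using locally_convex_UP2 two_generators braid_group_splits by blast
qed

end
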